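(* Let $\Omega\subset X$ be an open set. For any compact set $K\subset\Omega$ we have $$\mathrm{cap}_{1,\mathrm{O}}(K,\Omega)=\mathrm{cap}_{\mathrm{BV},\mathrm{O}}(K,\Omega).$$
   Context: Standing assumptions: $X=(X,d,\mu)$ is a complete metric space with a Borel regular outer measure $\mu$, $0<\mu(B)<\infty$ for all balls $B$, which is doubling: there is a constant $C_D$ with $\mu(2B)\le C_D\mu(B)$ for all balls $B$. Moreover $X$ supports a weak $(1,1)$-Poincaré inequality: there are constants $C_P>0$, $\tau\ge 1$ such that for all balls $B(x,r)$, all locally integrable $u$ on $X$ and all $1$-weak upper gradients $g$ of $u$, $$\frac{1}{\mu(B(x,r))}\int_{B(x,r)}|u-u_{B(x,r)}|\,d\mu\le C_P\,r\,\frac{1}{\mu(B(x,\tau r))}\int_{B(x,\tau r)}g\,d\mu,$$ where $u_{B(x,r)}=\frac{1}{\mu(B(x,r))}\int_{B(x,r)}u\,d\mu$. Paths and upper gradients: A path is a rectifiable nonconstant continuous mapping from a compact interval to $X$. A nonnegative Borel function $g$ on an open set $\Omega$ is an upper gradient of an extended real valued function $u$ on $\Omega$ if for all paths $\gamma$ in $\Omega$ with endpoints $x,y$: $|u(x)-u(y)|\le\int_\gamma g\,ds$ whenever $u(x),u(y)$ are both finite, and $\int_\gamma g\,ds=\infty$ otherwise. The $1$-modulus of a collection $\Gamma$ of paths in $\Omega$ is $\inf_\varrho\int_\Omega\varrho\,d\mu$, over all nonnegative Borel $\varrho$ with $\int_\gamma\varrho\,ds\ge1$ for every $\gamma\in\Gamma$.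 A nonnegative measurable $g$ is a $1$-weak upper gradient of $u$ if the upper gradient inequality holds (with $\int_\gamma g\,ds$ well defined) for all paths outside a family of zero $1$-modulus. Function spaces: $N^{1,1}(\Omega)$ consists of the $u\in L^1(\Omega)$ with $\|u\|_{N^{1,1}(\Omega)}=\int_\Omega|u|\,d\mu+\inf_g\int_\Omega g\,d\mu<\infty$, the infimum over $1$-weak upper gradients $g$ of $u$ (functions identified when the norm of their difference is $0$). For $u\in L^1_{\mathrm{loc}}(\Omega)$ the total variation is $\|Du\|(\Omega)=\inf\liminf_{i\to\infty}\int_\Omega g_{u_i}\,d\mu$, where $g_{u_i}$ is an upper gradient of $u_i$ and the infimum is over all sequences of locally Lipschitz functions $u_i$ on $\Omega$ with $u_i\to u$ in $L^1_{\mathrm{loc}}(\Omega)$. $\mathrm{BV}(\Omega)$ is the set of $u\in L^1(\Omega)$ with $\|Du\|(\Omega)<\infty$. $\mathrm{supt}(u)$ denotes the support of $u$. Capacities: for $\Omega$ open and $K\subset\Omega$ compact, $\mathrm{cap}_{1,\mathrm{O}}(K,\Omega)=\inf\int_\Omega g_u\,d\mu$, the infimum over all weak upper gradients $g_u$ of functions $u\in N^{1,1}(\Omega)$ such that $\mathrm{supt}(u)$ is a compact subset of $\Omega$ and $u=1$ on a neighborhood of $K$; $\mathrm{cap}_{\mathrm{BV},\mathrm{O}}(K,\Omega)=\inf\|Du\|(\Omega)$, the infimum over all $u\in\mathrm{BV}(\Omega)$ such that $0\le u\le1$, $\mathrm{supt}(u)$ is a compact subset of $\Omega$ and $u=1$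 on a neighborhood of $K$. *)

theory Defs
  imports "HOL-Analysis.Analysis"
begin

section \<open>The metric measure space\<close>

text \<open>
  The space \<open>X\<close> is the universe of a type of class \<open>complete_space\<close>. The measure is kept as a set
  function on all subsets, i.e. an outer measure; integrals are taken with respect to its
  restriction to the Caratheodory measurable sets.
\<close>

definition borel_regular_outer_measure :: "('a::topological_space set \<Rightarrow> ennreal) \<Rightarrow> bool" where
  "borel_regular_outer_measure mu \<longleftrightarrow>
     outer_measure_space UNIV mu \<and>
     sets borel \<subseteq> lambda_system UNIV UNIV mu \<and>
     (\<forall>A. \<exists>B\<in>sets borel. A \<subseteq> B \<and> mu B = mu A)"

definition caratheodory_measure :: "('a set \<Rightarrow> ennreal) \<Rightarrow> 'a measure" where
  "caratheodory_measure mu = measure_of UNIV (lambda_system UNIV UNIV mu) mu"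

lemma
  assumes "borel_regular_outer_measure mu"
  shows space_caratheodory_measure: "space (caratheodory_measure mu) = UNIV"
    and sets_caratheodory_measure: "sets (caratheodory_measure mu) = lambda_system UNIV UNIV mu"
    and emeasure_caratheodory_measure:
      "A \<in> lambda_system UNIV UNIV mu \<Longrightarrow> emeasure (caratheodory_measure mu) A = mu A"
proof -
  have "sigma_algebra (UNIV :: 'a set) UNIV"
    using sigma_algebra_Pow[of UNIV] by simp
  then have ms: "measure_space UNIV (lambda_system UNIV UNIV mu) mu"
    using sigma_algebra.caratheodory_lemma assms
    by (auto simp: borel_regular_outer_measure_def)
  then have sa: "sigma_algebra UNIV (lambda_system UNIV UNIV mu)"
    by (simp add: measure_space_def)
  show "space (caratheodory_measure mu) = UNIV"
    by (simp add: caratheodory_measure_def space_measure_of_conv)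
  show "sets (caratheodory_measure mu) = lambda_system UNIV UNIV mu"
    using sa by (simp add: caratheodory_measure_def sets_measure_of_conv
        sigma_algebra.sigma_sets_eq)
  show "emeasure (caratheodory_measure mu) A = mu A" if "A \<in> lambda_system UNIV UNIV mu"
    using ms that by (auto simp: caratheodory_measure_def measure_space_def
        intro: emeasure_measure_of_sigma)
qed

definition doubling :: "('a::metric_space set \<Rightarrow> ennreal) \<Rightarrow> bool" where
  "doubling mu \<longleftrightarrow>
     (\<exists>C\<^sub>D::real. \<forall>x. \<forall>r>0. mu (ball x (2 * r)) \<le> ennreal C\<^sub>D * mu (ball x r))"


section \<open>Paths and path integrals\<close>

text \<open>
  A path is a triple \<open>(a, b, \<gamma>)\<close>; only the values of \<open>\<gamma>\<close> on \<open>{a..b}\<close> matter.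
\<close>

type_synonym 'a pth = "real \<times> real \<times> (real \<Rightarrow> 'a)"

definition curve_length :: "(real \<Rightarrow> 'a::metric_space) \<Rightarrow> real \<Rightarrow> real \<Rightarrow> ennreal" where
  "curve_length \<gamma> a b =
     (SUP (n, t) \<in> {(n::nat, t::nat \<Rightarrow> real). mono_on {..n} t \<and> t ` {..n} \<subseteq> {a..b}}.
        \<Sum>i<n. ennreal (dist (\<gamma> (t i)) (\<gamma> (t (Suc i)))))"

definition paths_in :: "'a::metric_space set \<Rightarrow> 'a pth set" where
  "paths_in \<Omega> = {(a, b, \<gamma>). a \<le> b \<and> continuous_on {a..b} \<gamma> \<and> \<not> \<gamma> constant_on {a..b} \<and>
                   curve_length \<gamma> a b < \<infinity> \<and> \<gamma> ` {a..b} \<subseteq> \<Omega>}"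

definition path_len :: "'a::metric_space pth \<Rightarrow> real" where
  "path_len p = (case p of (a, b, \<gamma>) \<Rightarrow> enn2real (curve_length \<gamma> a b))"

text \<open>
  The arc-length parametrization on \<open>{0..path_len p}\<close>. The choice of \<open>t\<close> is immaterial, since \<open>\<gamma>\<close>
  is constant on every interval on which the length of its initial pieces is constant.
\<close>

definition arc_length_param :: "'a::metric_space pth \<Rightarrow> real \<Rightarrow> 'a" where
  "arc_length_param p s =
     (case p of (a, b, \<gamma>) \<Rightarrow> \<gamma> (SOME t. t \<in> {a..b} \<and> curve_length \<gamma> a t = ennreal s))"

definition path_integral :: "'a::metric_space pth \<Rightarrow> ('a \<Rightarrow> ennreal) \<Rightarrow> ennreal" where
  "path_integral p g = (\<integral>\<^sup>+ s \<in> {0..path_len p}. g (arc_length_param p s) \<partial>lebesgue)"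

text \<open>
  \<open>path_integral\<close> is a genuine integral only under the following condition, which is automatic for
  Borel functions \<open>g\<close>.
\<close>

definition path_integral_defined :: "'a::metric_space pth \<Rightarrow> ('a \<Rightarrow> ennreal) \<Rightarrow> bool" where
  "path_integral_defined p g \<longleftrightarrow>
     (\<lambda>s. g (arc_length_param p s)) \<in> borel_measurable (lebesgue_on {0..path_len p})"


section \<open>Upper gradients and the Poincare inequality\<close>

definition upper_gradient_ineq ::
    "('a::metric_space \<Rightarrow> ereal) \<Rightarrow> ('a \<Rightarrow> ennreal) \<Rightarrow> 'a pth \<Rightarrow> bool" where
  "upper_gradient_ineq u g p \<longleftrightarrow> (case p of (a, b, \<gamma>) \<Rightarrow>
     if \<bar>u (\<gamma> a)\<bar> \<noteq> \<infinity> \<and> \<bar>u (\<gamma> b)\<bar> \<noteq> \<infinity>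
     then e2ennreal \<bar>u (\<gamma> a) - u (\<gamma> b)\<bar> \<le> path_integral p g
     else path_integral p g = \<infinity>)"

definition upper_gradient ::
    "'a::metric_space set \<Rightarrow> ('a \<Rightarrow> ereal) \<Rightarrow> ('a \<Rightarrow> ennreal) \<Rightarrow> bool" where
  "upper_gradient \<Omega> u g \<longleftrightarrow>
     g \<in> borel_measurable (restrict_space borel \<Omega>) \<and>
     (\<forall>p\<in>paths_in \<Omega>. upper_gradient_ineq u g p)"

definition modulus1 ::
    "('a::metric_space set \<Rightarrow> ennreal) \<Rightarrow> 'a set \<Rightarrow> 'a pth set \<Rightarrow> ennreal" where
  "modulus1 mu \<Omega> \<Gamma> =
     (INF \<rho> \<in> {\<rho> :: 'a \<Rightarrow> ennreal. \<rho> \<in> borel_measurable (restrict_space borel \<Omega>) \<and>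
                                (\<forall>p\<in>\<Gamma>. path_integral p \<rho> \<ge> 1)}.
        \<integral>\<^sup>+ x \<in> \<Omega>. \<rho> x \<partial>caratheodory_measure mu)"

definition weak_upper_gradient ::
    "('a::metric_space set \<Rightarrow> ennreal) \<Rightarrow> 'a set \<Rightarrow> ('a \<Rightarrow> ereal) \<Rightarrow> ('a \<Rightarrow> ennreal) \<Rightarrow> bool" where
  "weak_upper_gradient mu \<Omega> u g \<longleftrightarrow>
     g \<in> borel_measurable (restrict_space (caratheodory_measure mu) \<Omega>) \<and>
     (\<exists>\<Gamma>\<subseteq>paths_in \<Omega>. modulus1 mu \<Omega> \<Gamma> = 0 \<and>
        (\<forall>p\<in>paths_in \<Omega> - \<Gamma>. path_integral_defined p g \<and> upper_gradient_ineq u g p))"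

definition L1 :: "('a::metric_space set \<Rightarrow> ennreal) \<Rightarrow> 'a set \<Rightarrow> ('a \<Rightarrow> ereal) set" where
  "L1 mu \<Omega> = {u. u \<in> borel_measurable (restrict_space (caratheodory_measure mu) \<Omega>) \<and>
                 (\<integral>\<^sup>+ x \<in> \<Omega>. e2ennreal \<bar>u x\<bar> \<partial>caratheodory_measure mu) < \<infinity>}"

definition L1_loc :: "('a::metric_space set \<Rightarrow> ennreal) \<Rightarrow> 'a set \<Rightarrow> ('a \<Rightarrow> ereal) set" where
  "L1_loc mu \<Omega> = {u. u \<in> borel_measurable (restrict_space (caratheodory_measure mu) \<Omega>) \<and>
                     (\<forall>x\<in>\<Omega>. \<exists>r>0. ball x r \<subseteq> \<Omega> \<and> u \<in> L1 mu (ball x r))}"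

text \<open>
  Functions in \<open>L1_loc\<close> are finite almost everywhere, so \<open>real_of_ereal\<close> changes them only on a
  null set.
\<close>

definition mean_value :: "('a::metric_space set \<Rightarrow> ennreal) \<Rightarrow> 'a set \<Rightarrow> ('a \<Rightarrow> ereal) \<Rightarrow> real" where
  "mean_value mu B u =
     (LINT x:B|caratheodory_measure mu. real_of_ereal (u x)) / enn2real (mu B)"

definition weak_poincare_1_1 :: "('a::metric_space set \<Rightarrow> ennreal) \<Rightarrow> bool" where
  "weak_poincare_1_1 mu \<longleftrightarrow>
     (\<exists>C\<^sub>P \<tau> :: real. C\<^sub>P > 0 \<and> \<tau> \<ge> 1 \<and>
        (\<forall>x. \<forall>r>0. \<forall>u \<in> L1_loc mu UNIV. \<forall>g. weak_upper_gradient mu UNIV u g \<longrightarrow>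
           (\<integral>\<^sup>+ y \<in> ball x r. e2ennreal \<bar>u y - ereal (mean_value mu (ball x r) u)\<bar>
              \<partial>caratheodory_measure mu) / mu (ball x r)
           \<le> ennreal (C\<^sub>P * r) *
              ((\<integral>\<^sup>+ y \<in> ball x (\<tau> * r). g y \<partial>caratheodory_measure mu) / mu (ball x (\<tau> * r)))))"


section \<open>Newtonian and BV functions\<close>

definition N11_norm ::
    "('a::metric_space set \<Rightarrow> ennreal) \<Rightarrow> 'a set \<Rightarrow> ('a \<Rightarrow> ereal) \<Rightarrow> ennreal" where
  "N11_norm mu \<Omega> u =
     (\<integral>\<^sup>+ x \<in> \<Omega>. e2ennreal \<bar>u x\<bar> \<partial>caratheodory_measure mu) +
     (INF g \<in> {g. weak_upper_gradient mu \<Omega> u g}. \<integral>\<^sup>+ x \<in> \<Omega>. g x \<partial>caratheodory_measure mu)"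

text \<open>
  Members of \<open>N11\<close> and \<open>BV\<close> are functions rather than equivalence classes of functions.
\<close>

definition N11 :: "('a::metric_space set \<Rightarrow> ennreal) \<Rightarrow> 'a set \<Rightarrow> ('a \<Rightarrow> ereal) set" where
  "N11 mu \<Omega> = {u \<in> L1 mu \<Omega>. N11_norm mu \<Omega> u < \<infinity>}"

definition locally_lipschitz_on :: "'a::metric_space set \<Rightarrow> ('a \<Rightarrow> real) \<Rightarrow> bool" where
  "locally_lipschitz_on \<Omega> u \<longleftrightarrow>
     (\<forall>x\<in>\<Omega>. \<exists>r>0. \<exists>L. ball x r \<subseteq> \<Omega> \<and> L-lipschitz_on (ball x r) u)"

definition converges_L1_loc ::
    "('a::metric_space set \<Rightarrow> ennreal) \<Rightarrow> 'a set \<Rightarrow> (nat \<Rightarrow> 'a \<Rightarrow> real) \<Rightarrow> ('a \<Rightarrow> ereal) \<Rightarrow> bool" where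
  "converges_L1_loc mu \<Omega> v u \<longleftrightarrow>
     (\<forall>x\<in>\<Omega>. \<exists>r>0. ball x r \<subseteq> \<Omega> \<and>
        (\<lambda>i. \<integral>\<^sup>+ y \<in> ball x r. e2ennreal \<bar>ereal (v i y) - u y\<bar> \<partial>caratheodory_measure mu)
          \<longlonglongrightarrow> 0)"

definition total_variation ::
    "('a::metric_space set \<Rightarrow> ennreal) \<Rightarrow> 'a set \<Rightarrow> ('a \<Rightarrow> ereal) \<Rightarrow> ennreal" where
  "total_variation mu \<Omega> u =
     (INF (v, g) \<in> {(v :: nat \<Rightarrow> 'a \<Rightarrow> real, g :: nat \<Rightarrow> 'a \<Rightarrow> ennreal).
                      (\<forall>i. locally_lipschitz_on \<Omega> (v i)) \<and>
                      converges_L1_loc mu \<Omega> v u \<and>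
                      (\<forall>i. upper_gradient \<Omega> (\<lambda>x. ereal (v i x)) (g i))}.
        liminf (\<lambda>i. \<integral>\<^sup>+ x \<in> \<Omega>. g i x \<partial>caratheodory_measure mu))"

definition BV :: "('a::metric_space set \<Rightarrow> ennreal) \<Rightarrow> 'a set \<Rightarrow> ('a \<Rightarrow> ereal) set" where
  "BV mu \<Omega> = {u \<in> L1 mu \<Omega>. total_variation mu \<Omega> u < \<infinity>}"


section \<open>Capacities\<close>

text \<open>
  The closure is taken in \<open>X\<close>. It is a compact subset of \<open>\<Omega>\<close> iff the closure relative to \<open>\<Omega>\<close> is
  compact, and then both agree.
\<close>

definition supt :: "'a::metric_space set \<Rightarrow> ('a \<Rightarrow> ereal) \<Rightarrow> 'a set" where
  "supt \<Omega> u = closure {x \<in> \<Omega>. u x \<noteq> 0}"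

definition one_near :: "'a::metric_space set \<Rightarrow> 'a set \<Rightarrow> ('a \<Rightarrow> ereal) \<Rightarrow> bool" where
  "one_near K \<Omega> u \<longleftrightarrow> (\<exists>V. open V \<and> K \<subseteq> V \<and> V \<subseteq> \<Omega> \<and> (\<forall>x\<in>V. u x = 1))"

definition cap_1_O ::
    "('a::metric_space set \<Rightarrow> ennreal) \<Rightarrow> 'a set \<Rightarrow> 'a set \<Rightarrow> ennreal" where
  "cap_1_O mu K \<Omega> =
     (INF (u, g) \<in> {(u, g). u \<in> N11 mu \<Omega> \<and> compact (supt \<Omega> u) \<and> supt \<Omega> u \<subseteq> \<Omega> \<and>
                            one_near K \<Omega> u \<and> weak_upper_gradient mu \<Omega> u g}.
        \<integral>\<^sup>+ x \<in> \<Omega>. g x \<partial>caratheodory_measure mu)"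

definition cap_BV_O ::
    "('a::metric_space set \<Rightarrow> ennreal) \<Rightarrow> 'a set \<Rightarrow> 'a set \<Rightarrow> ennreal" where
  "cap_BV_O mu K \<Omega> =
     (INF u \<in> {u \<in> BV mu \<Omega>. (\<forall>x\<in>\<Omega>. 0 \<le> u x \<and> u x \<le> 1) \<and>
                            compact (supt \<Omega> u) \<and> supt \<Omega> u \<subseteq> \<Omega> \<and> one_near K \<Omega> u}.
        total_variation mu \<Omega> u)"

end

theory Submission
  imports Defs
begin

text \<open>
  For \<open>cap\<^sub>1 \<le> cap\<^sub>B\<^sub>V\<close>, let \<open>v\<^sub>i \<rightarrow> u\<close> be locally Lipschitz with almost optimal upper gradients \<open>g\<^sub>i\<close>.
  With cutoff functions \<open>\<phi>\<close> near \<open>K\<close> and \<open>\<psi>\<close> near the support of \<open>u\<close>, the function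
  \<open>\<phi> + (1 - \<phi>) \<psi> v\<^sub>i\<close> is admissible, and \<open>g\<^sub>i\<close> is enlarged only by multiples of \<open>\<bar>v\<^sub>i - u\<bar>\<close> on a
  compact set, because \<open>\<phi>\<close> varies only where \<open>u = 1\<close> and \<open>\<psi>\<close> only where \<open>u = 0\<close>.

  For \<open>cap\<^sub>B\<^sub>V \<le> cap\<^sub>1\<close>, truncate \<open>u\<close> to \<open>[0, 1]\<close> and replace its weak upper gradient by a lower
  semicontinuous upper gradient with almost the same integral, the supremum of an increasing sequence
  of Lipschitz functions \<open>G\<^sub>n\<close>. Let \<open>E\<close> be a closed set with small complement on which \<open>u\<close> is lower
  semicontinuous, and let \<open>v\<^sub>n x\<close> be the infimum of \<open>u (p\<^sub>0) + (\<Sum>k. G\<^sub>n (p\<^sub>k\<^sub>+\<^sub>1) d (p\<^sub>k, p\<^sub>k\<^sub>+\<^sub>1))\<close> over chains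
  from \<open>p\<^sub>0 \<in> E\<close> to \<open>x\<close> with steps of size at most \<open>1 / (n + 1)\<close>. Then \<open>v\<^sub>n\<close> is locally Lipschitz with upper
  gradient \<open>G\<^sub>n\<close>, and \<open>v\<^sub>n \<rightarrow> u\<close> on \<open>E\<close>: otherwise, by an Arzela-Ascoli argument, chains that are too cheap
  would converge to a path violating the upper gradient inequality (closed balls are compact by
  doubling).
\<close>

section \<open>Length of curves\<close>

text \<open>The obstacle is the constant: neither inequality may lose a factor, so discrete
  convolutions, whose upper gradients are controlled only up to a factor, cannot serve as Lipschitz
  approximations. Chains avoid the loss: nearby points are one step apart, which makes
  \<open>chain_value\<close> locally Lipschitz without any curves joining them, and the weight
  \<open>G n\<close> itself is an upper gradient. Points off \<open>E\<close> are not forbidden as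
  starting points but get the price 1, the upper bound of \<open>u\<close>; the values then stay in
  [0, 1], and such starts never undercut \<open>u\<close>. A small multiple of a cutoff function is
  added to the weights, which bounds the length of chains of cost at most 1 near the support. Since
  the weights increase with \<open>n\<close>, the limit can be taken with one fixed continuous
  weight, and the supremum over the weights afterwards. For the newly constructed functions the
  upper gradient inequality is verified on short arcs, with an error small relative to arc length,
  and then summed; this replaces differentiation along paths.\<close>

lemma curve_length_leI:
  assumes "\<And>n t. mono_on {..n} t \<Longrightarrow> t ` {..n} \<subseteq> {a..b} \<Longrightarrow>
    (\<Sum>i<n. ennreal (dist (\<gamma> (t i)) (\<gamma> (t (Suc i))))) \<le> X"
  shows "curve_length \<gamma> a b \<le> X"
  unfolding curve_length_def using assms by (intro SUP_least) auto

lemma curve_length_ge_sum: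
  assumes "mono_on {..n} t" "t ` {..n} \<subseteq> {a..b}"
  shows "(\<Sum>i<n. ennreal (dist (\<gamma> (t i)) (\<gamma> (t (Suc i))))) \<le> curve_length \<gamma> a b"
  unfolding curve_length_def using assms by (intro SUP_upper2[where i = "(n, t)"]) auto

lemma dist_le_curve_length:
  assumes "a \<le> s" "s \<le> t" "t \<le> b"
  shows "ennreal (dist (\<gamma> s) (\<gamma> t)) \<le> curve_length \<gamma> a b"
proof -
  have "mono_on {..1} (\<lambda>i::nat. if i = 0 then s else t)"
    using assms by (auto simp: mono_on_def)
  moreover have "(\<lambda>i::nat. if i = 0 then s else t) ` {..1} \<subseteq> {a..b}"
    using assms by auto
  ultimately show ?thesis
    using curve_length_ge_sum[of 1 "\<lambda>i. if i = 0 then s else t" a b \<gamma>] by simp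
qed

lemma sum_lessThan_add:
  fixes f :: "nat \<Rightarrow> 'b::comm_monoid_add"
  shows "(\<Sum>i<n + m. f i) = (\<Sum>i<n. f i) + (\<Sum>i<m. f (n + i))"
  by (induction m) (auto simp: algebra_simps)

lemma ennreal_SUP_add_SUP_le:
  fixes f :: "'b \<Rightarrow> ennreal" and g :: "'c \<Rightarrow> ennreal"
  assumes "A \<noteq> {}" "B \<noteq> {}" "\<And>x y. x \<in> A \<Longrightarrow> y \<in> B \<Longrightarrow> f x + g y \<le> X"
  shows "(SUP x\<in>A. f x) + (SUP y\<in>B. g y) \<le> X"
proof -
  have "(SUP x\<in>A. f x) + (SUP y\<in>B. g y) = (SUP x\<in>A. f x + (SUP y\<in>B. g y))"
    using assms(1) by (simp add: ennreal_SUP_add_left)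
  also have "\<dots> = (SUP x\<in>A. SUP y\<in>B. f x + g y)"
    using assms(2) by (simp add: ennreal_SUP_add_right)
  also have "\<dots> \<le> X"
    using assms(3) by (auto intro!: SUP_least)
  finally show ?thesis .
qed

lemma curve_length_superadd:
  assumes "a \<le> b" "b \<le> c"
  shows "curve_length \<gamma> a b + curve_length \<gamma> b c \<le> curve_length \<gamma> a c"
proof -
  let ?d = "\<lambda>t i. ennreal (dist (\<gamma> (t i)) (\<gamma> (t (Suc i))))"
  have *: "(\<Sum>i<n. ?d t i) + (\<Sum>i<m. ?d r i) \<le> curve_length \<gamma> a c"
    if t: "mono_on {..n} t" "t ` {..n} \<subseteq> {a..b}" and r: "mono_on {..m} r" "r ` {..m} \<subseteq> {b..c}"
    for n t m r
  proof -
    \<comment> \<open>The partitions need not contain \<open>b\<close>, so the points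
      \<open>t n\<close> and \<open>r 0\<close> are both kept. This costs one additional step
      between them, whose nonnegative length is dropped; hence the shift by
      \<open>Suc n\<close>.\<close>
    define q where "q i = (if i \<le> n then t i else r (i - Suc n))" for i
    have "mono_on {..n + Suc m} q"
    proof (rule mono_onI)
      fix i j assume ij: "i \<in> {..n + Suc m}" "j \<in> {..n + Suc m}" "i \<le> j"
      consider "j \<le> n" | "i \<le> n" "n < j" | "n < i" using ij by linarith
      then show "q i \<le> q j"
      proof cases
        case 1 then show ?thesis using ij t by (auto simp: q_def mono_on_def)
      next
        case 2
        then have "t i \<le> b" "b \<le> r (j - Suc n)"
          using t(2) r(2) ij by (auto simp: image_subset_iff)
        then show ?thesis using 2 by (auto simp: q_def)
      next
        case 3
        then show ?thesis using ij mono_onD[OF r(1), of "i - Suc n" "j - Suc n"] by (auto simp: q_def)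
      qed
    qed
    moreover have "q ` {..n + Suc m} \<subseteq> {a..c}"
    proof (rule image_subsetI)
      fix i assume "i \<in> {..n + Suc m}"
      then have "q i \<in> {a..b} \<or> q i \<in> {b..c}"
        using image_subset_iff[THEN iffD1, OF t(2)] image_subset_iff[THEN iffD1, OF r(2)]
        unfolding q_def by (cases "i \<le> n") (simp_all del: atLeastAtMost_iff)
      then show "q i \<in> {a..c}"
        using assms by auto
    qed
    ultimately have "(\<Sum>i<n + Suc m. ?d q i) \<le> curve_length \<gamma> a c"
      by (rule curve_length_ge_sum)
    moreover have "(\<Sum>i<n + Suc m. ?d q i) = (\<Sum>i<n. ?d q i) + (\<Sum>i<Suc m. ?d q (n + i))"
      by (rule sum_lessThan_add)
    moreover have "(\<Sum>i<n. ?d q i) = (\<Sum>i<n. ?d t i)"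
      by (intro sum.cong) (auto simp: q_def)
    moreover have "(\<Sum>i<m. ?d r i) \<le> (\<Sum>i<Suc m. ?d q (n + i))"
      unfolding sum.lessThan_Suc_shift by (auto simp: q_def)
    ultimately show ?thesis
      by (metis (no_types, lifting) add_left_mono order_trans)
  qed
  have ne: "{(n::nat, t::nat \<Rightarrow> real). mono_on {..n} t \<and> t ` {..n} \<subseteq> {x..y}} \<noteq> {}" if "x \<le> y" for x y
  proof -
    have "(0, \<lambda>_. x) \<in> {(n::nat, t::nat \<Rightarrow> real). mono_on {..n} t \<and> t ` {..n} \<subseteq> {x..y}}"
      using that by (auto simp: mono_on_def)
    then show ?thesis by blast
  qed
  show ?thesis
    unfolding curve_length_def[of \<gamma> a b] curve_length_def[of \<gamma> b c]
    using assms * by (intro ennreal_SUP_add_SUP_le ne) auto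
qed

text \<open>Clamping all points of a partition to a subinterval gives a partition of the subinterval.\<close>

lemma curve_length_subadd:
  assumes "a \<le> b" "b \<le> c"
  shows "curve_length \<gamma> a c \<le> curve_length \<gamma> a b + curve_length \<gamma> b c"
proof (rule curve_length_leI)
  fix n and t :: "nat \<Rightarrow> real"
  assume t: "mono_on {..n} t" "t ` {..n} \<subseteq> {a..c}"
  let ?d = "\<lambda>t i. ennreal (dist (\<gamma> (t i)) (\<gamma> (t (Suc i))))"
  let ?t1 = "\<lambda>i. min (t i) b" and ?t2 = "\<lambda>i. max (t i) b"
  have "?d t i \<le> ?d ?t1 i + ?d ?t2 i" if "i < n" for i
  proof -
    have "t i \<le> t (Suc i)" using t(1) that by (auto simp: mono_on_def)
    then consider "t (Suc i) \<le> b" | "b \<le> t i" | "t i \<le> b" "b \<le> t (Suc i)" by linarith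
    then show ?thesis
    proof cases
      case 3
      then show ?thesis
        using dist_triangle[of "\<gamma> (t i)" "\<gamma> (t (Suc i))" "\<gamma> b"]
        by (auto simp flip: ennreal_plus simp: min_absorb1 max_absorb1 max_absorb2 min_absorb2 intro!: ennreal_leI)
    qed (use \<open>t i \<le> t (Suc i)\<close> in \<open>auto simp: min_def max_def\<close>)
  qed
  then have "(\<Sum>i<n. ?d t i) \<le> (\<Sum>i<n. ?d ?t1 i) + (\<Sum>i<n. ?d ?t2 i)"
    unfolding sum.distrib[symmetric] by (intro sum_mono) auto
  also have "\<dots> \<le> curve_length \<gamma> a b + curve_length \<gamma> b c"
  proof (intro add_mono curve_length_ge_sum)
    show "mono_on {..n} ?t1" "mono_on {..n} ?t2"
      using t(1) by (auto intro!: mono_onI min.mono max.mono dest: mono_onD)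
    show "?t1 ` {..n} \<subseteq> {a..b}" "?t2 ` {..n} \<subseteq> {b..c}"
      using t(2) assms by (auto simp: image_subset_iff)
  qed
  finally show "(\<Sum>i<n. ?d t i) \<le> curve_length \<gamma> a b + curve_length \<gamma> b c" .
qed

lemma curve_length_add:
  "a \<le> b \<Longrightarrow> b \<le> c \<Longrightarrow> curve_length \<gamma> a c = curve_length \<gamma> a b + curve_length \<gamma> b c"
  by (intro antisym curve_length_subadd curve_length_superadd)

lemma curve_length_self [simp]: "curve_length \<gamma> a a = 0"
proof -
  have "curve_length \<gamma> a a \<le> 0"
  proof (rule curve_length_leI)
    fix n and t :: "nat \<Rightarrow> real"
    assume "t ` {..n} \<subseteq> {a..a}"
    then have "t i = a" if "i \<le> n" for i using that by (auto simp: image_subset_iff)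
    then show "(\<Sum>i<n. ennreal (dist (\<gamma> (t i)) (\<gamma> (t (Suc i))))) \<le> 0" by simp
  qed
  then show ?thesis by simp
qed

lemma curve_length_le_lipschitz:
  assumes "a \<le> b" "1-lipschitz_on {a..b} \<gamma>"
  shows "curve_length \<gamma> a b \<le> ennreal (b - a)"
proof (rule curve_length_leI)
  fix n and t :: "nat \<Rightarrow> real"
  assume t: "mono_on {..n} t" "t ` {..n} \<subseteq> {a..b}"
  have "(\<Sum>i<n. ennreal (dist (\<gamma> (t i)) (\<gamma> (t (Suc i))))) \<le> (\<Sum>i<n. ennreal (t (Suc i) - t i))"
  proof (intro sum_mono ennreal_leI)
    fix i assume "i \<in> {..<n}"
    then have "t i \<le> t (Suc i)" "t i \<in> {a..b}" "t (Suc i) \<in> {a..b}"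
      using t by (auto simp: mono_on_def image_subset_iff)
    then show "dist (\<gamma> (t i)) (\<gamma> (t (Suc i))) \<le> t (Suc i) - t i"
      using lipschitz_onD[OF assms(2), of "t i" "t (Suc i)"] by (auto simp: dist_real_def)
  qed
  also have "\<dots> = ennreal (\<Sum>i<n. t (Suc i) - t i)"
    using t(1) by (intro sum_ennreal) (auto simp: mono_on_def)
  also have "\<dots> = ennreal (t n - t 0)"
    by (simp add: sum_lessThan_telescope)
  also have "\<dots> \<le> ennreal (b - a)"
    using t(2) by (intro ennreal_leI) (auto simp: image_subset_iff intro: diff_mono)
  finally show "(\<Sum>i<n. ennreal (dist (\<gamma> (t i)) (\<gamma> (t (Suc i))))) \<le> ennreal (b - a)" .
qed

text \<open>Unlike membership in \<open>paths_in\<close>, this admits constant curves and one-point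
  intervals, so that it passes to every subinterval.\<close>

definition rectifiable :: "real \<Rightarrow> real \<Rightarrow> (real \<Rightarrow> 'a::metric_space) \<Rightarrow> bool" where
  "rectifiable a b \<gamma> \<longleftrightarrow> a \<le> b \<and> continuous_on {a..b} \<gamma> \<and> curve_length \<gamma> a b < \<infinity>"

text \<open>A real-valued length allows subtraction. It is meaningful for rectifiable curves, as
  \<open>enn2real\<close> sends infinite length to 0.\<close>

definition len_upto :: "real \<Rightarrow> (real \<Rightarrow> 'a::metric_space) \<Rightarrow> real \<Rightarrow> real" where
  "len_upto a \<gamma> t = enn2real (curve_length \<gamma> a t)"

lemma curve_length_mono:
  assumes "a \<le> c" "c \<le> d" "d \<le> b"
  shows "curve_length \<gamma> c d \<le> curve_length \<gamma> a b"
proof -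
  have "curve_length \<gamma> a b = curve_length \<gamma> a c + (curve_length \<gamma> c d + curve_length \<gamma> d b)"
    using assms by (metis curve_length_add order_trans)
  then show ?thesis by (simp add: add.assoc add_increasing add_increasing2)
qed

lemma rectifiable_sub:
  "rectifiable a b \<gamma> \<Longrightarrow> a \<le> c \<Longrightarrow> c \<le> d \<Longrightarrow> d \<le> b \<Longrightarrow> rectifiable c d \<gamma>"
  unfolding rectifiable_def
  by (meson atLeastatMost_subset_iff continuous_on_subset curve_length_mono le_less_trans)

lemma ennreal_len_upto:
  assumes "rectifiable a b \<gamma>" "t \<in> {a..b}"
  shows "ennreal (len_upto a \<gamma> t) = curve_length \<gamma> a t"
  using rectifiable_sub[OF assms(1), of a t] assms(2)
  by (auto simp: len_upto_def rectifiable_def)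

lemma len_upto_start [simp]: "len_upto a \<gamma> a = 0"
  by (simp add: len_upto_def)

lemma len_upto_nonneg: "0 \<le> len_upto a \<gamma> t"
  by (simp add: len_upto_def)

lemma curve_length_eq_diff:
  assumes "rectifiable a b \<gamma>" "a \<le> s" "s \<le> t" "t \<le> b"
  shows "curve_length \<gamma> s t = ennreal (len_upto a \<gamma> t - len_upto a \<gamma> s)"
    and "len_upto a \<gamma> s \<le> len_upto a \<gamma> t"
    and "dist (\<gamma> s) (\<gamma> t) \<le> len_upto a \<gamma> t - len_upto a \<gamma> s"
proof -
  have eq: "curve_length \<gamma> a t = curve_length \<gamma> a s + curve_length \<gamma> s t"
    using assms by (intro curve_length_add) auto
  have fin: "curve_length \<gamma> s t < \<infinity>"
    using rectifiable_sub[OF assms(1), of s t] assms by (auto simp: rectifiable_def)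
  define k where "k = enn2real (curve_length \<gamma> s t)"
  have k: "curve_length \<gamma> s t = ennreal k" "0 \<le> k"
    using fin by (auto simp: k_def)
  have "ennreal (len_upto a \<gamma> t) = ennreal (len_upto a \<gamma> s + k)"
    using eq k ennreal_len_upto[OF assms(1), of t] ennreal_len_upto[OF assms(1), of s] assms
    by (simp add: ennreal_plus len_upto_nonneg)
  then have *: "len_upto a \<gamma> t = len_upto a \<gamma> s + k"
    using k by (subst (asm) ennreal_inj) (auto simp: len_upto_nonneg)
  show "curve_length \<gamma> s t = ennreal (len_upto a \<gamma> t - len_upto a \<gamma> s)"
    "len_upto a \<gamma> s \<le> len_upto a \<gamma> t"
    using * k by auto
  have "ennreal (dist (\<gamma> s) (\<gamma> t)) \<le> ennreal k"
    using dist_le_curve_length[of s s t t \<gamma>] assms k by simp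
  then show "dist (\<gamma> s) (\<gamma> t) \<le> len_upto a \<gamma> t - len_upto a \<gamma> s"
    using * k by simp
qed

text \<open>
  Refining an almost optimal partition by a short interval shows that this interval carries little
  length: only the clamped partition points contribute, and their number is fixed in advance.
\<close>

lemma continuous_on_len_upto:
  assumes "rectifiable a b \<gamma>"
  shows "continuous_on {a..b} (len_upto a \<gamma>)"
proof -
  have ab: "a \<le> b" and cont: "continuous_on {a..b} \<gamma>" and fin: "curve_length \<gamma> a b < \<infinity>"
    using assms by (auto simp: rectifiable_def)
  let ?d = "\<lambda>t i. dist (\<gamma> (t i)) (\<gamma> (t (Suc i)))"
  \<comment> \<open>One \<open>\<epsilon>\<close> is the defect of the chosen partition, the other
    bounds the contribution of that partition clamped to the interval from \<open>s\<close> to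
    \<open>t\<close>.\<close>
  have "\<exists>\<delta>>0. \<forall>s\<in>{a..b}. \<forall>t\<in>{a..b}. s \<le> t \<longrightarrow> t - s < \<delta> \<longrightarrow> len_upto a \<gamma> t - len_upto a \<gamma> s \<le> 2 * \<epsilon>"
    if "\<epsilon> > 0" for \<epsilon> :: real
  proof -
    have "\<exists>p\<in>{(n::nat, t::nat \<Rightarrow> real). mono_on {..n} t \<and> t ` {..n} \<subseteq> {a..b}}.
       curve_length \<gamma> a b < (case p of (n, t) \<Rightarrow> \<Sum>i<n. ennreal (?d t i)) + ennreal \<epsilon>"
    proof (rule SUP_approx_ennreal)
      show "0 < \<epsilon>" using \<open>\<epsilon> > 0\<close> by simp
      have "(0, \<lambda>_. a) \<in> {(n::nat, t::nat \<Rightarrow> real). mono_on {..n} t \<and> t ` {..n} \<subseteq> {a..b}}"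
        using ab by (auto simp: mono_on_def)
      then show "{(n::nat, t::nat \<Rightarrow> real). mono_on {..n} t \<and> t ` {..n} \<subseteq> {a..b}} \<noteq> {}"
        by blast
      show "curve_length \<gamma> a b \<noteq> \<infinity>" using fin by auto
    qed (simp add: curve_length_def)
    then obtain n and q :: "nat \<Rightarrow> real" where q: "mono_on {..n} q" "q ` {..n} \<subseteq> {a..b}"
      and less: "curve_length \<gamma> a b < (\<Sum>i<n. ennreal (?d q i)) + ennreal \<epsilon>"
      by auto
    have "uniformly_continuous_on {a..b} \<gamma>"
      by (intro compact_uniformly_continuous cont) auto
    \<comment> \<open>The sum over the clamped points has \<open>n\<close> terms, so this bound on
      each term keeps it below \<open>\<epsilon>\<close>.\<close>
    moreover have "0 < \<epsilon> / (real n + 1)" using \<open>\<epsilon> > 0\<close> by simp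
    ultimately obtain \<delta> where \<delta>: "\<delta> > 0"
      and unif: "\<And>s t. s \<in> {a..b} \<Longrightarrow> t \<in> {a..b} \<Longrightarrow> dist t s < \<delta> \<Longrightarrow> dist (\<gamma> t) (\<gamma> s) < \<epsilon> / (real n + 1)"
      unfolding uniformly_continuous_on_def by metis
    have "len_upto a \<gamma> t - len_upto a \<gamma> s \<le> 2 * \<epsilon>"
      if st: "s \<in> {a..b}" "t \<in> {a..b}" "s \<le> t" "t - s < \<delta>" for s t
    proof -
      let ?t1 = "\<lambda>i. min (q i) s" and ?t2 = "\<lambda>i. max (q i) t" and ?m = "\<lambda>i. max s (min (q i) t)"
      have qm: "q i \<le> q (Suc i)" if "i < n" for i
        using q(1) that by (auto simp: mono_on_def)
      have step: "?d q i \<le> ?d ?t1 i + (?d ?m i + ?d ?t2 i)" if "i < n" for i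
      proof -
        have *: "q i \<le> q (Suc i)" using qm that .
        \<comment> \<open>All positions of \<open>q i \<le> q (Suc i)\<close> relative to
          \<open>s \<le> t\<close>. The distance is split by the triangle inequality at whichever of
          \<open>s\<close> and \<open>t\<close> lies between.\<close>
        consider "q (Suc i) \<le> s" | "t \<le> q i" | "s \<le> q i" "q (Suc i) \<le> t"
          | "q i \<le> s" "s \<le> q (Suc i)" "q (Suc i) \<le> t" | "q i \<le> s" "t \<le> q (Suc i)"
          | "s \<le> q i" "q i \<le> t" "t \<le> q (Suc i)"
          by linarith
        then show ?thesis
        proof cases
          case 1 then show ?thesis using * st by (auto simp: min_def max_def)
        next
          case 2 then show ?thesis using * st by (auto simp: min_def max_def)
        next
          case 3 then show ?thesis using * st by (auto simp: min_absorb1 max_absorb2)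
        next
          case 4 then show ?thesis using * st dist_triangle[of "\<gamma> (q i)" "\<gamma> (q (Suc i))" "\<gamma> s"]
            by (auto simp: min_absorb1 min_absorb2 max_absorb1 max_absorb2)
        next
          case 5 then show ?thesis
            using * st dist_triangle[of "\<gamma> (q i)" "\<gamma> (q (Suc i))" "\<gamma> s"]
              dist_triangle[of "\<gamma> s" "\<gamma> (q (Suc i))" "\<gamma> t"]
            by (auto simp: min_absorb1 min_absorb2 max_absorb1 max_absorb2)
        next
          case 6 then show ?thesis using * st dist_triangle[of "\<gamma> (q i)" "\<gamma> (q (Suc i))" "\<gamma> t"]
            by (auto simp: min_absorb1 min_absorb2 max_absorb1 max_absorb2)
        qed
      qed
      have le: "(\<Sum>i<n. ennreal (?d q i)) \<le> (\<Sum>i<n. ennreal (?d ?t1 i)) + ((\<Sum>i<n. ennreal (?d ?m i)) + (\<Sum>i<n. ennreal (?d ?t2 i)))"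
        unfolding sum.distrib[symmetric] using step
        by (intro sum_mono) (auto simp flip: ennreal_plus intro!: ennreal_leI)
      have t1: "(\<Sum>i<n. ennreal (?d ?t1 i)) \<le> curve_length \<gamma> a s"
      proof (rule curve_length_ge_sum)
        show "mono_on {..n} ?t1"
          by (intro mono_onI min.mono mono_onD[OF q(1)]) auto
        show "?t1 ` {..n} \<subseteq> {a..s}"
          using q(2) st by (auto simp: image_subset_iff)
      qed
      have t2: "(\<Sum>i<n. ennreal (?d ?t2 i)) \<le> curve_length \<gamma> t b"
      proof (rule curve_length_ge_sum)
        show "mono_on {..n} ?t2"
          by (intro mono_onI max.mono mono_onD[OF q(1)]) auto
        show "?t2 ` {..n} \<subseteq> {t..b}"
          using q(2) st by (auto simp: image_subset_iff)
      qed
      have "(\<Sum>i<n. ennreal (?d ?m i)) \<le> (\<Sum>i<n. ennreal (\<epsilon> / (real n + 1)))"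
      proof (intro sum_mono ennreal_leI less_imp_le unif)
        fix i
        show "?m i \<in> {a..b}" "?m (Suc i) \<in> {a..b}" "dist (?m i) (?m (Suc i)) < \<delta>"
          using st by (auto simp: dist_real_def)
      qed
      also have "\<dots> = ennreal (real n * (\<epsilon> / (real n + 1)))"
        using \<open>\<epsilon> > 0\<close> by (subst sum_ennreal) auto
      also have "\<dots> \<le> ennreal \<epsilon>"
        using \<open>\<epsilon> > 0\<close> by (intro ennreal_leI) (auto simp: field_simps)
      finally have m: "(\<Sum>i<n. ennreal (?d ?m i)) \<le> ennreal \<epsilon>" .
      have "(\<Sum>i<n. ennreal (?d q i)) \<le> curve_length \<gamma> a s + (ennreal \<epsilon> + curve_length \<gamma> t b)"
        by (rule order_trans[OF le]) (intro add_mono t1 t2 m)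
      with less have "curve_length \<gamma> a b \<le> curve_length \<gamma> a s + (ennreal \<epsilon> + curve_length \<gamma> t b) + ennreal \<epsilon>"
        by (meson add_right_mono less_imp_le order_trans)
      also have "curve_length \<gamma> a s = ennreal (len_upto a \<gamma> s)"
        using ennreal_len_upto[OF assms] st by auto
      also have "curve_length \<gamma> t b = ennreal (len_upto a \<gamma> b - len_upto a \<gamma> t)"
        using curve_length_eq_diff[OF assms, of t b] st by auto
      also have "curve_length \<gamma> a b = ennreal (len_upto a \<gamma> b)"
        using ennreal_len_upto[OF assms] ab by auto
      finally show ?thesis
        using \<open>\<epsilon> > 0\<close> curve_length_eq_diff(2)[OF assms, of t b] st
        by (auto simp flip: ennreal_plus simp: len_upto_nonneg ennreal_le_iff)
    qed
    then show ?thesis using \<delta> by blast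
  qed
  note key = this
  show ?thesis
    unfolding continuous_on_iff
  proof (intro ballI allI impI)
    fix x and e :: real assume x: "x \<in> {a..b}" and "0 < e"
    then obtain \<delta> where \<delta>: "\<delta> > 0" and
      *: "\<And>s t. s\<in>{a..b} \<Longrightarrow> t\<in>{a..b} \<Longrightarrow> s \<le> t \<Longrightarrow> t - s < \<delta> \<Longrightarrow> len_upto a \<gamma> t - len_upto a \<gamma> s \<le> 2 * (e / 4)"
      using key[of "e / 4"] by auto
    have "dist (len_upto a \<gamma> y) (len_upto a \<gamma> x) < e" if y: "y \<in> {a..b}" "dist y x < \<delta>" for y
    proof (cases "x \<le> y")
      case True
      then have "len_upto a \<gamma> y - len_upto a \<gamma> x \<le> 2 * (e / 4)"
        using x y by (intro *) (auto simp: dist_real_def)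
      moreover have "len_upto a \<gamma> x \<le> len_upto a \<gamma> y"
        using True x y by (intro curve_length_eq_diff(2)[OF assms]) auto
      ultimately show ?thesis using \<open>0 < e\<close> by (simp add: dist_real_def)
    next
      case False
      then have "len_upto a \<gamma> x - len_upto a \<gamma> y \<le> 2 * (e / 4)"
        using x y by (intro *) (auto simp: dist_real_def)
      moreover have "len_upto a \<gamma> y \<le> len_upto a \<gamma> x"
        using False x y by (intro curve_length_eq_diff(2)[OF assms]) auto
      ultimately show ?thesis using \<open>0 < e\<close> by (simp add: dist_real_def)
    qed
    then show "\<exists>d>0. \<forall>x'\<in>{a..b}. dist x' x < d \<longrightarrow> dist (len_upto a \<gamma> x') (len_upto a \<gamma> x) < e"
      using \<delta> by blast
  qed
qed

section \<open>Arc-length parametrization\<close>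

lemma len_upto_IVT:
  assumes "rectifiable a b \<gamma>" "a \<le> c" "c \<le> d" "d \<le> b" "len_upto a \<gamma> c \<le> s" "s \<le> len_upto a \<gamma> d"
  obtains t where "t \<in> {c..d}" "len_upto a \<gamma> t = s"
proof -
  have "continuous_on {c..d} (len_upto a \<gamma>)"
    using assms by (intro continuous_on_subset[OF continuous_on_len_upto[OF assms(1)]]) auto
  then have "\<exists>t\<ge>c. t \<le> d \<and> len_upto a \<gamma> t = s"
    by (intro IVT' assms)
  then obtain t where "c \<le> t" "t \<le> d" "len_upto a \<gamma> t = s" by blast
  then show ?thesis by (intro that[of t]) simp_all
qed

lemma arc_length_param_len_upto:
  assumes "rectifiable a b \<gamma>" "t \<in> {a..b}"
  shows "arc_length_param (a, b, \<gamma>) (len_upto a \<gamma> t) = \<gamma> t"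
proof -
  define r where "r = (SOME r. r \<in> {a..b} \<and> curve_length \<gamma> a r = ennreal (len_upto a \<gamma> t))"
  have "r \<in> {a..b} \<and> curve_length \<gamma> a r = ennreal (len_upto a \<gamma> t)"
    unfolding r_def using ennreal_len_upto[OF assms] assms(2) by (rule_tac someI[of _ t]) simp
  then have r: "r \<in> {a..b}" "len_upto a \<gamma> r = len_upto a \<gamma> t"
    by (auto simp: len_upto_def)
  have "dist (\<gamma> r) (\<gamma> t) \<le> 0"
  proof (cases "r \<le> t")
    case True
    then show ?thesis
      using curve_length_eq_diff(3)[OF assms(1), of r t] r assms(2) by simp
  next
    case False
    then show ?thesis
      using curve_length_eq_diff(3)[OF assms(1), of t r] r assms(2) by (simp add: dist_commute)
  qed
  then show ?thesis by (simp add: arc_length_param_def r_def)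
qed

lemma path_len_eq: "path_len (a, b, \<gamma>) = len_upto a \<gamma> b"
  by (simp add: path_len_def len_upto_def)

lemma lipschitz_on_arc_length_param:
  assumes "rectifiable a b \<gamma>"
  shows "1-lipschitz_on {0..len_upto a \<gamma> b} (arc_length_param (a, b, \<gamma>))"
proof (rule lipschitz_onI)
  fix s r assume sr: "s \<in> {0..len_upto a \<gamma> b}" "r \<in> {0..len_upto a \<gamma> b}"
  have ab: "a \<le> b" using assms by (simp add: rectifiable_def)
  obtain t where t: "t \<in> {a..b}" "len_upto a \<gamma> t = s"
    using len_upto_IVT[OF assms, of a b s] sr ab by auto
  obtain q where q: "q \<in> {a..b}" "len_upto a \<gamma> q = r"
    using len_upto_IVT[OF assms, of a b r] sr ab by auto
  have "dist (\<gamma> t) (\<gamma> q) \<le> dist s r"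
  proof (cases "t \<le> q")
    case True
    then show ?thesis
      using curve_length_eq_diff(3)[OF assms, of t q] t q by (simp add: dist_real_def)
  next
    case False
    then show ?thesis
      using curve_length_eq_diff(3)[OF assms, of q t] t q by (simp add: dist_commute dist_real_def)
  qed
  then show "dist (arc_length_param (a, b, \<gamma>) s) (arc_length_param (a, b, \<gamma>) r) \<le> 1 * dist s r"
    using arc_length_param_len_upto[OF assms] t q by auto
qed simp

lemma paths_in_rectifiable: "(a, b, \<gamma>) \<in> paths_in \<Omega> \<Longrightarrow> rectifiable a b \<gamma>"
  by (auto simp: paths_in_def rectifiable_def)

lemma path_len_nonneg [simp]: "0 \<le> path_len p"
  by (auto simp: path_len_def split: prod.split)

lemma paths_in_arc_length_param:
  assumes "p \<in> paths_in \<Omega>"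
  shows "1-lipschitz_on {0..path_len p} (arc_length_param p)"
    and "\<And>s. s \<in> {0..path_len p} \<Longrightarrow> arc_length_param p s \<in> \<Omega>"
    and "arc_length_param p 0 = (case p of (a, b, \<gamma>) \<Rightarrow> \<gamma> a)"
    and "arc_length_param p (path_len p) = (case p of (a, b, \<gamma>) \<Rightarrow> \<gamma> b)"
proof -
  obtain a b \<gamma> where p: "p = (a, b, \<gamma>)" by (cases p)
  have r: "rectifiable a b \<gamma>" and ab: "a \<le> b" and im: "\<gamma> ` {a..b} \<subseteq> \<Omega>"
    using assms paths_in_rectifiable p by (auto simp: paths_in_def)
  show "1-lipschitz_on {0..path_len p} (arc_length_param p)"
    using lipschitz_on_arc_length_param[OF r] by (simp add: p path_len_eq)
  show "arc_length_param p s \<in> \<Omega>" if s: "s \<in> {0..path_len p}" for s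
  proof -
    obtain t where "t \<in> {a..b}" "len_upto a \<gamma> t = s"
      using len_upto_IVT[OF r, of a b s] s ab by (auto simp: p path_len_eq)
    then show ?thesis
      using arc_length_param_len_upto[OF r, of t] im by (auto simp: p)
  qed
  show "arc_length_param p 0 = (case p of (a, b, \<gamma>) \<Rightarrow> \<gamma> a)"
    using arc_length_param_len_upto[OF r, of a] ab by (simp add: p)
  show "arc_length_param p (path_len p) = (case p of (a, b, \<gamma>) \<Rightarrow> \<gamma> b)"
    using arc_length_param_len_upto[OF r, of b] ab by (simp add: p path_len_eq)
qed

section \<open>Integrals over intervals\<close>

lemma nn_integral_Icc_le:
  assumes "\<And>q. q \<in> {s..t} \<Longrightarrow> f q \<le> ennreal c" "0 \<le> c" "s \<le> t"
  shows "(\<integral>\<^sup>+ q \<in> {s..t}. f q \<partial>lborel) \<le> ennreal (c * (t - s))"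
proof -
  have "(\<integral>\<^sup>+ q \<in> {s..t}. f q \<partial>lborel) \<le> (\<integral>\<^sup>+ q \<in> {s..t}. ennreal c \<partial>lborel)"
    using assms(1) by (intro nn_integral_mono) (auto simp: indicator_def)
  also have "\<dots> = ennreal (c * (t - s))"
    using assms by (simp add: nn_integral_cmult_indicator ennreal_mult)
  finally show ?thesis .
qed

text \<open>The error \<open>e\<close> stands next to \<open>f\<close>, so that nothing is
  subtracted in \<open>ennreal\<close>. Measurability concerns \<open>f\<close> cut off to the
  interval, because a function along a path is controlled only there.\<close>

lemma nn_integral_Icc_ge:
  assumes "\<And>q. q \<in> {s..t} \<Longrightarrow> ennreal c \<le> f q + ennreal e" "0 \<le> c" "0 \<le> e" "s \<le> t"
    and [measurable]: "(\<lambda>q. f q * indicator {s..t} q) \<in> borel_measurable borel"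
  shows "ennreal (c * (t - s)) \<le> (\<integral>\<^sup>+ q \<in> {s..t}. f q \<partial>lborel) + ennreal (e * (t - s))"
proof -
  have "ennreal (c * (t - s)) = (\<integral>\<^sup>+ q \<in> {s..t}. ennreal c \<partial>lborel)"
    using assms by (simp add: nn_integral_cmult_indicator ennreal_mult)
  also have "\<dots> \<le> (\<integral>\<^sup>+ q. f q * indicator {s..t} q + ennreal e * indicator {s..t} q \<partial>lborel)"
    using assms(1) by (intro nn_integral_mono) (auto simp: indicator_def)
  also have "\<dots> = (\<integral>\<^sup>+ q \<in> {s..t}. f q \<partial>lborel) + ennreal (e * (t - s))"
    using assms by (simp add: nn_integral_add nn_integral_cmult_indicator ennreal_mult)
  finally show ?thesis .
qed

lemma nn_integral_Icc_split:
  fixes f :: "real \<Rightarrow> ennreal"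
  assumes "s \<le> r" "r \<le> t" and m: "(\<lambda>q. f q * indicator {s..t} q) \<in> borel_measurable borel"
  shows "(\<integral>\<^sup>+ q \<in> {s..t}. f q \<partial>lborel) = (\<integral>\<^sup>+ q \<in> {s..r}. f q \<partial>lborel) + (\<integral>\<^sup>+ q \<in> {r..t}. f q \<partial>lborel)"
proof -
  have eq: "(\<lambda>q. f q * indicator {x..y} q) = (\<lambda>q. (f q * indicator {s..t} q) * indicator {x..y} q)"
    if "s \<le> x" "y \<le> t" for x y
    using that by (auto simp: fun_eq_iff indicator_def)
  have [measurable]: "(\<lambda>q. f q * indicator {s..r} q) \<in> borel_measurable borel"
    "(\<lambda>q. f q * indicator {r..t} q) \<in> borel_measurable borel"
    using assms by (auto simp only: eq[of s r] eq[of r t] order_refl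
        intro!: borel_measurable_times_ennreal m borel_measurable_indicator borel_closed closed_atLeastAtMost)
  have "(\<integral>\<^sup>+ q \<in> {s..t}. f q \<partial>lborel) = (\<integral>\<^sup>+ q. f q * indicator {s..r} q + f q * indicator {r..t} q \<partial>lborel)"
  proof (rule nn_integral_cong_AE)
    show "AE q in lborel. f q * indicator {s..t} q = f q * indicator {s..r} q + f q * indicator {r..t} q"
      using AE_lborel_singleton[of r] assms by (auto elim!: eventually_mono simp: indicator_def)
  qed
  then show ?thesis by (simp add: nn_integral_add)
qed

text \<open>Bisection: if \<open>F\<close> exceeded \<open>J\<close> on an interval, it would do so
  on one of the halves, and the halves shrink to a point at which the local estimate fails.\<close>

lemma local_to_global_ennreal:
  fixes F J :: "real \<Rightarrow> real \<Rightarrow> ennreal"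
  assumes "a \<le> b"
    and "\<And>s r t. a \<le> s \<Longrightarrow> s \<le> r \<Longrightarrow> r \<le> t \<Longrightarrow> t \<le> b \<Longrightarrow> F s t \<le> F s r + F r t"
    and "\<And>s r t. a \<le> s \<Longrightarrow> s \<le> r \<Longrightarrow> r \<le> t \<Longrightarrow> t \<le> b \<Longrightarrow> J s r + J r t \<le> J s t"
    and loc: "\<And>r. a \<le> r \<Longrightarrow> r \<le> b \<Longrightarrow> \<exists>\<delta>>0. \<forall>s t. a \<le> s \<longrightarrow> s \<le> r \<longrightarrow> r \<le> t \<longrightarrow> t \<le> b \<longrightarrow> t - s < \<delta> \<longrightarrow> F s t \<le> J s t"
  shows "F a b \<le> J a b"
proof -
  have "a \<le> a \<and> b \<le> b \<longrightarrow> F a b \<le> J a b"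
    using assms(1)
  proof (induction rule: Bolzano[where P = "\<lambda>s t. a \<le> s \<and> t \<le> b \<longrightarrow> F s t \<le> J s t"])
    case (trans s r t)
    show ?case
    proof
      assume st: "a \<le> s \<and> t \<le> b"
      then have "F s t \<le> F s r + F r t" using trans assms(2) by auto
      also have "\<dots> \<le> J s r + J r t" using trans st by (intro add_mono) auto
      also have "\<dots> \<le> J s t" using trans st assms(3) by auto
      finally show "F s t \<le> J s t" .
    qed
  next
    case (local r)
    then show ?case using loc[of r] by blast
  qed
  then show ?thesis by simp
qed

section \<open>Path integrals and upper gradients\<close>

lemma path_integral_eq_lborel:
  "path_integral p g = (\<integral>\<^sup>+ s \<in> {0..path_len p}. g (arc_length_param p s) \<partial>lborel)"
  unfolding path_integral_def by (rule nn_integral_completion)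

lemma path_integral_mono:
  assumes "p \<in> paths_in \<Omega>" "\<And>x. x \<in> \<Omega> \<Longrightarrow> g x \<le> h x"
  shows "path_integral p g \<le> path_integral p h"
  unfolding path_integral_def using assms paths_in_arc_length_param(2)[OF assms(1)]
  by (intro nn_integral_mono) (auto simp: indicator_def)

lemma measurable_along_path:
  fixes g :: "'a::metric_space \<Rightarrow> ennreal"
  assumes "p \<in> paths_in \<Omega>" and g: "g \<in> borel_measurable (restrict_space borel \<Omega>)"
  shows "(\<lambda>s. g (arc_length_param p s)) \<in> borel_measurable (restrict_space borel {0..path_len p})"
proof (rule measurable_compose[OF _ g])
  have "continuous_on {0..path_len p} (arc_length_param p)"
    using paths_in_arc_length_param(1)[OF assms(1)] by (rule lipschitz_on_continuous_on)
  then have "arc_length_param p \<in> restrict_space borel {0..path_len p} \<rightarrow>\<^sub>M borel"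
    by (rule borel_measurable_continuous_on_restrict)
  then show "arc_length_param p \<in> restrict_space borel {0..path_len p} \<rightarrow>\<^sub>M restrict_space borel \<Omega>"
    using paths_in_arc_length_param(2)[OF assms(1)]
    by (intro measurable_restrict_space2) (auto simp: space_restrict_space)
qed

lemma measurable_along_path_Icc:
  fixes g :: "'a::metric_space \<Rightarrow> ennreal"
  assumes "p \<in> paths_in \<Omega>" "g \<in> borel_measurable (restrict_space borel \<Omega>)" "0 \<le> s" "t \<le> path_len p"
  shows "(\<lambda>q. g (arc_length_param p q) * indicator {s..t} q) \<in> borel_measurable borel"
proof -
  have [measurable]: "(\<lambda>q. g (arc_length_param p q) * indicator {0..path_len p} q) \<in> borel_measurable borel"
    using measurable_along_path[OF assms(1,2)] by (subst (asm) borel_measurable_restrict_space_iff_ennreal) auto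
  have "(\<lambda>q. g (arc_length_param p q) * indicator {s..t} q) =
      (\<lambda>q. (g (arc_length_param p q) * indicator {0..path_len p} q) * indicator {s..t} q)"
    using assms by (auto simp: fun_eq_iff indicator_def)
  then show ?thesis by simp
qed

lemma path_integral_defined_borel:
  assumes "p \<in> paths_in \<Omega>" "g \<in> borel_measurable (restrict_space borel \<Omega>)"
  shows "path_integral_defined p g"
proof -
  have "(\<lambda>s. g (arc_length_param p s) * indicator {0..path_len p} s) \<in> borel_measurable borel"
    using measurable_along_path_Icc[OF assms] by auto
  then have "(\<lambda>s. g (arc_length_param p s) * indicator {0..path_len p} s) \<in> borel_measurable lebesgue"
    by (intro measurable_completion) simp
  then show ?thesis
    unfolding path_integral_defined_def by (subst borel_measurable_restrict_space_iff_ennreal) auto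
qed

lemma upper_gradient_ineq_real:
  "upper_gradient_ineq (\<lambda>x. ereal (v x)) g p \<longleftrightarrow>
    ennreal \<bar>v (arc_length_param p (path_len p)) - v (arc_length_param p 0)\<bar> \<le> path_integral p g"
  if "p \<in> paths_in \<Omega>"
  using paths_in_arc_length_param(3,4)[OF that]
  by (auto simp: upper_gradient_ineq_def abs_minus_commute split: prod.splits)

text \<open>Restricting the curve to parameters \<open>t\<close>, \<open>w\<close> with initial
  lengths \<open>s\<close>, \<open>r\<close> gives a path whose arc-length parametrization is that
  of \<open>p\<close> shifted by \<open>s\<close>. If the two endpoints coincide, the restriction
  may be constant and thus no path, but then the left side is 0.\<close>

lemma upper_gradient_subpath:
  fixes v :: "'a::metric_space \<Rightarrow> real"
  assumes ug: "upper_gradient \<Omega> (\<lambda>x. ereal (v x)) g" and p: "p \<in> paths_in \<Omega>"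
    and s: "0 \<le> s" "s \<le> r" "r \<le> path_len p"
  shows "ennreal \<bar>v (arc_length_param p r) - v (arc_length_param p s)\<bar>
    \<le> (\<integral>\<^sup>+ q \<in> {s..r}. g (arc_length_param p q) \<partial>lborel)"
proof (cases "arc_length_param p r = arc_length_param p s")
  case False
  obtain a b \<gamma> where pe: "p = (a, b, \<gamma>)" by (cases p)
  have rect: "rectifiable a b \<gamma>" and ab: "a \<le> b" and im: "\<gamma> ` {a..b} \<subseteq> \<Omega>"
    using p paths_in_rectifiable pe by (auto simp: paths_in_def)
  have gm: "g \<in> borel_measurable (restrict_space borel \<Omega>)"
    using ug by (simp add: upper_gradient_def)
  let ?l = "len_upto a \<gamma>" and ?\<sigma> = "arc_length_param p"
  obtain t where t: "t \<in> {a..b}" "?l t = s"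
    using len_upto_IVT[OF rect, of a b s] s ab by (auto simp: pe path_len_eq)
  obtain w where w: "w \<in> {t..b}" "?l w = r"
    using len_upto_IVT[OF rect, of t b r] s t by (auto simp: pe path_len_eq)
  have tw: "a \<le> t" "t \<le> w" "w \<le> b" using t w by auto
  have \<sigma>: "?\<sigma> s = \<gamma> t" "?\<sigma> r = \<gamma> w"
    using arc_length_param_len_upto[OF rect] t w tw by (auto simp: pe)
  have rect': "rectifiable t w \<gamma>" using rectifiable_sub[OF rect] tw by auto
  have "\<not> \<gamma> constant_on {t..w}"
    using False \<sigma> tw unfolding constant_on_def by (metis atLeastAtMost_iff order_refl)
  then have q: "(t, w, \<gamma>) \<in> paths_in \<Omega>"
    using rect' im tw by (force simp: paths_in_def rectifiable_def)
  have len: "len_upto t \<gamma> x = ?l x - s" if "x \<in> {t..w}" for x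
    using curve_length_eq_diff[OF rect, of t x] that tw t by (simp add: len_upto_def[of t])
  have par: "arc_length_param (t, w, \<gamma>) x = ?\<sigma> (s + x)" if x: "x \<in> {0..r - s}" for x
  proof -
    obtain y where y: "y \<in> {t..w}" "?l y = s + x"
      using len_upto_IVT[OF rect, of t w "s + x"] x t w tw by auto
    then have "arc_length_param (t, w, \<gamma>) x = \<gamma> y"
      using arc_length_param_len_upto[OF rect', of y] len[of y] by simp
    also have "\<gamma> y = ?\<sigma> (s + x)"
      using arc_length_param_len_upto[OF rect, of y] y tw by (simp add: pe)
    finally show ?thesis .
  qed
  have "path_len (t, w, \<gamma>) = r - s"
    using len[of w] tw w by (simp add: path_len_eq)
  then have "path_integral (t, w, \<gamma>) g = (\<integral>\<^sup>+ x \<in> {0..r - s}. g (?\<sigma> (s + x)) \<partial>lborel)"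
    unfolding path_integral_eq_lborel using par by (intro nn_integral_cong) (auto simp: indicator_def)
  \<comment> \<open>The shift is written with a factor 1 to match the affine substitution
    rule.\<close>
  also have "\<dots> = (\<integral>\<^sup>+ x. g (?\<sigma> (s + 1 * x)) * indicator {s..r} (s + 1 * x) \<partial>lborel)"
    by (intro nn_integral_cong) (auto simp: indicator_def)
  also have "\<dots> = (\<integral>\<^sup>+ x \<in> {s..r}. g (?\<sigma> x) \<partial>lborel)"
    using nn_integral_real_affine[OF measurable_along_path_Icc[OF p gm, of s r], of 1 s] s by simp
  finally have "path_integral (t, w, \<gamma>) g = (\<integral>\<^sup>+ x \<in> {s..r}. g (?\<sigma> x) \<partial>lborel)" .
  moreover have "ennreal \<bar>v (\<gamma> t) - v (\<gamma> w)\<bar> \<le> path_integral (t, w, \<gamma>) g"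
    using ug q by (auto simp: upper_gradient_def upper_gradient_ineq_def)
  ultimately show ?thesis by (simp add: \<sigma> abs_minus_commute)
qed simp

text \<open>On an arc the increment of \<open>v\<close> is subadditive, and the right side is
  additive. The local errors add up to \<open>\<epsilon>\<close> times the length of the path, which
  is arbitrarily small.\<close>

lemma upper_gradient_localI:
  fixes v :: "'a::metric_space \<Rightarrow> real"
  assumes H: "H \<in> borel_measurable (restrict_space borel \<Omega>)"
    and loc: "\<And>p \<epsilon> r. p \<in> paths_in \<Omega> \<Longrightarrow> \<epsilon> > 0 \<Longrightarrow> r \<in> {0..path_len p} \<Longrightarrow>
      \<exists>\<delta>>0. \<forall>s t. 0 \<le> s \<longrightarrow> s \<le> r \<longrightarrow> r \<le> t \<longrightarrow> t \<le> path_len p \<longrightarrow> t - s < \<delta> \<longrightarrow>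
        ennreal \<bar>v (arc_length_param p t) - v (arc_length_param p s)\<bar>
          \<le> (\<integral>\<^sup>+ q \<in> {s..t}. H (arc_length_param p q) \<partial>lborel) + ennreal (\<epsilon> * (t - s))"
  shows "upper_gradient \<Omega> (\<lambda>x. ereal (v x)) H"
  unfolding upper_gradient_def
proof (intro conjI H ballI)
  fix p assume p: "p \<in> paths_in \<Omega>"
  let ?\<sigma> = "arc_length_param p"
  have "ennreal \<bar>v (?\<sigma> (path_len p)) - v (?\<sigma> 0)\<bar> \<le> path_integral p H"
  proof (rule ennreal_le_epsilon)
    fix e :: real assume "0 < e"
    \<comment> \<open>The \<open>+ 1\<close> keeps the denominator positive; the total error over
      the path is still at most \<open>e\<close>.\<close>
    define \<epsilon> where "\<epsilon> = e / (path_len p + 1)"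
    have \<epsilon>: "\<epsilon> > 0" "\<epsilon> * path_len p \<le> e"
      using \<open>0 < e\<close> path_len_nonneg[of p] by (auto simp: \<epsilon>_def field_simps add_pos_nonneg add_nonneg_pos)
    have "ennreal \<bar>v (?\<sigma> (path_len p)) - v (?\<sigma> 0)\<bar>
      \<le> (\<integral>\<^sup>+ q \<in> {0..path_len p}. H (?\<sigma> q) \<partial>lborel) + ennreal (\<epsilon> * (path_len p - 0))"
    proof (rule local_to_global_ennreal[where
          F = "\<lambda>s t. ennreal \<bar>v (?\<sigma> t) - v (?\<sigma> s)\<bar>" and
          J = "\<lambda>s t. (\<integral>\<^sup>+ q \<in> {s..t}. H (?\<sigma> q) \<partial>lborel) + ennreal (\<epsilon> * (t - s))"])
      fix s r t assume st: "0 \<le> s" "s \<le> r" "r \<le> t" "t \<le> path_len p"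
      show "ennreal \<bar>v (?\<sigma> t) - v (?\<sigma> s)\<bar> \<le> ennreal \<bar>v (?\<sigma> r) - v (?\<sigma> s)\<bar> + ennreal \<bar>v (?\<sigma> t) - v (?\<sigma> r)\<bar>"
        by (simp flip: ennreal_plus)
      have "ennreal (\<epsilon> * (t - s)) = ennreal (\<epsilon> * (r - s)) + ennreal (\<epsilon> * (t - r))"
        using st \<epsilon> by (simp flip: ennreal_plus add: algebra_simps mult_left_mono)
      then show "(\<integral>\<^sup>+ q \<in> {s..r}. H (?\<sigma> q) \<partial>lborel) + ennreal (\<epsilon> * (r - s))
          + ((\<integral>\<^sup>+ q \<in> {r..t}. H (?\<sigma> q) \<partial>lborel) + ennreal (\<epsilon> * (t - r)))
        \<le> (\<integral>\<^sup>+ q \<in> {s..t}. H (?\<sigma> q) \<partial>lborel) + ennreal (\<epsilon> * (t - s))"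
        using nn_integral_Icc_split[OF st(2,3) measurable_along_path_Icc[OF p H]] st
        by (simp add: ac_simps)
    qed (use loc[OF p \<epsilon>(1)] in auto)
    also have "\<dots> \<le> path_integral p H + ennreal e"
      unfolding path_integral_eq_lborel using \<epsilon> by (intro add_left_mono ennreal_leI) simp
    finally show "ennreal \<bar>v (?\<sigma> (path_len p)) - v (?\<sigma> 0)\<bar> \<le> path_integral p H + ennreal e" .
  qed
  then show "upper_gradient_ineq (\<lambda>x. ereal (v x)) H p"
    using upper_gradient_ineq_real[OF p] by blast
qed

text \<open>The path integral refers to arc length, whereas \<open>\<gamma>\<close> may run at any
  speed up to 1, so its parameter interval is at least as long. Limits of chains arrive in such a
  parametrization. Continuity of \<open>G\<close> makes the comparison a local one between nearly
  constant integrands.\<close>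

lemma path_integral_le_lipschitz:
  fixes G :: "'a::metric_space \<Rightarrow> real"
  assumes p: "(0, L, \<gamma>) \<in> paths_in \<Omega>" and lip: "1-lipschitz_on {0..L} \<gamma>"
    and G: "continuous_on UNIV G" "\<And>x. 0 \<le> G x"
  shows "path_integral (0, L, \<gamma>) (\<lambda>x. ennreal (G x)) \<le> (\<integral>\<^sup>+ s \<in> {0..L}. ennreal (G (\<gamma> s)) \<partial>lborel)"
proof (rule ennreal_le_epsilon)
  fix e :: real assume "0 < e"
  have L: "0 \<le> L" using p by (simp add: paths_in_def)
  let ?\<sigma> = "arc_length_param (0, L, \<gamma>)" and ?l = "len_upto 0 \<gamma>"
  define \<epsilon> where "\<epsilon> = e / (L + 1)"
  have \<epsilon>: "\<epsilon> > 0" "\<epsilon> * L \<le> e"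
    using \<open>0 < e\<close> L by (auto simp: \<epsilon>_def field_simps add_pos_nonneg add_nonneg_pos)
  have rect: "rectifiable 0 L \<gamma>" using paths_in_rectifiable[OF p] .
  have cG\<gamma>: "continuous_on {0..L} (\<lambda>s. G (\<gamma> s))"
    using continuous_on_compose2[OF G(1) lipschitz_on_continuous_on[OF lip]] by auto
  have m1: "(\<lambda>q. ennreal (G (?\<sigma> q)) * indicator {s..t} q) \<in> borel_measurable borel"
    if "0 \<le> s" "t \<le> ?l L" for s t
  proof -
    have "(\<lambda>x. ennreal (G x)) \<in> borel_measurable (restrict_space borel \<Omega>)"
      using borel_measurable_continuous_onI[OF G(1)] by (intro measurable_restrict_space1) simp
    then show ?thesis
      using that measurable_along_path_Icc[OF p, of "\<lambda>x. ennreal (G x)" s t] by (simp add: path_len_eq)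
  qed
  have m2: "(\<lambda>q. ennreal (G (\<gamma> q)) * indicator {s..t} q) \<in> borel_measurable borel"
    if "0 \<le> s" "t \<le> L" for s t
  proof -
    have "(\<lambda>s. G (\<gamma> s)) \<in> borel_measurable (restrict_space borel {0..L})"
      using cG\<gamma> by (rule borel_measurable_continuous_on_restrict)
    then have "(\<lambda>s. ennreal (G (\<gamma> s))) \<in> borel_measurable (restrict_space borel {0..L})"
      by simp
    then have "(\<lambda>q. ennreal (G (\<gamma> q)) * indicator {0..L} q) \<in> borel_measurable borel"
      by (subst (asm) borel_measurable_restrict_space_iff_ennreal) auto
    then have "(\<lambda>q. ennreal (G (\<gamma> q)) * indicator {0..L} q * indicator {s..t} q) \<in> borel_measurable borel"
      by simp
    moreover have "(\<lambda>q. ennreal (G (\<gamma> q)) * indicator {0..L} q * indicator {s..t} q)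
      = (\<lambda>q. ennreal (G (\<gamma> q)) * indicator {s..t} q)"
      using that by (auto simp: fun_eq_iff indicator_def)
    ultimately show ?thesis by simp
  qed
  have mono: "0 \<le> ?l s" "?l s \<le> ?l t" "?l t \<le> ?l L" "?l t - ?l s \<le> t - s" if "0 \<le> s" "s \<le> t" "t \<le> L" for s t
  proof -
    show "0 \<le> ?l s" "?l s \<le> ?l t" "?l t \<le> ?l L"
      using curve_length_eq_diff(2)[OF rect] that by (auto simp: len_upto_nonneg)
    have "curve_length \<gamma> s t \<le> ennreal (t - s)"
      using that by (intro curve_length_le_lipschitz lipschitz_on_subset[OF lip]) auto
    then show "?l t - ?l s \<le> t - s"
      using curve_length_eq_diff(1)[OF rect that] that by simp
  qed
  have "(\<integral>\<^sup>+ q \<in> {?l 0..?l L}. ennreal (G (?\<sigma> q)) \<partial>lborel)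
    \<le> (\<integral>\<^sup>+ q \<in> {0..L}. ennreal (G (\<gamma> q)) \<partial>lborel) + ennreal (\<epsilon> * (L - 0))"
  \<comment> \<open>Both interval functions are indexed by the parameter of \<open>\<gamma>\<close>:
    \<open>F\<close> integrates over the corresponding range of arc length, \<open>J\<close> over
    the parameters themselves.\<close>
  proof (rule local_to_global_ennreal[where
        F = "\<lambda>s t. \<integral>\<^sup>+ q \<in> {?l s..?l t}. ennreal (G (?\<sigma> q)) \<partial>lborel" and
        J = "\<lambda>s t. (\<integral>\<^sup>+ q \<in> {s..t}. ennreal (G (\<gamma> q)) \<partial>lborel) + ennreal (\<epsilon> * (t - s))"])
    fix s r t :: real assume st: "0 \<le> s" "s \<le> r" "r \<le> t" "t \<le> L"
    show "(\<integral>\<^sup>+ q \<in> {?l s..?l t}. ennreal (G (?\<sigma> q)) \<partial>lborel)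
      \<le> (\<integral>\<^sup>+ q \<in> {?l s..?l r}. ennreal (G (?\<sigma> q)) \<partial>lborel) + (\<integral>\<^sup>+ q \<in> {?l r..?l t}. ennreal (G (?\<sigma> q)) \<partial>lborel)"
      using st mono[of s r] mono[of r t] by (subst nn_integral_Icc_split[of "?l s" "?l r" "?l t"]) (auto intro!: m1)
    have "ennreal (\<epsilon> * (t - s)) = ennreal (\<epsilon> * (r - s)) + ennreal (\<epsilon> * (t - r))"
      using st \<epsilon> by (simp flip: ennreal_plus add: algebra_simps mult_left_mono)
    then show "(\<integral>\<^sup>+ q \<in> {s..r}. ennreal (G (\<gamma> q)) \<partial>lborel) + ennreal (\<epsilon> * (r - s))
        + ((\<integral>\<^sup>+ q \<in> {r..t}. ennreal (G (\<gamma> q)) \<partial>lborel) + ennreal (\<epsilon> * (t - r)))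
      \<le> (\<integral>\<^sup>+ q \<in> {s..t}. ennreal (G (\<gamma> q)) \<partial>lborel) + ennreal (\<epsilon> * (t - s))"
      using nn_integral_Icc_split[OF st(2,3) m2[OF st(1,4)]] by (simp add: ac_simps)
  next
    fix r :: real assume r: "0 \<le> r" "r \<le> L"
    \<comment> \<open>The values of \<open>G\<close> along the curve stay within
      \<open>\<epsilon> / 2\<close> of the value at \<open>r\<close>. This is used once for the
      upper and once for the lower estimate.\<close>
    have "\<epsilon> / 2 > 0" using \<epsilon> by simp
    then obtain \<delta> where \<delta>: "\<delta> > 0" and
      near: "\<And>q. q \<in> {0..L} \<Longrightarrow> dist q r < \<delta> \<Longrightarrow> dist (G (\<gamma> q)) (G (\<gamma> r)) < \<epsilon> / 2"
      using cG\<gamma> r unfolding continuous_on_iff by (metis atLeastAtMost_iff)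
    have "(\<integral>\<^sup>+ q \<in> {?l s..?l t}. ennreal (G (?\<sigma> q)) \<partial>lborel)
        \<le> (\<integral>\<^sup>+ q \<in> {s..t}. ennreal (G (\<gamma> q)) \<partial>lborel) + ennreal (\<epsilon> * (t - s))"
      if st: "0 \<le> s" "s \<le> r" "r \<le> t" "t \<le> L" "t - s < \<delta>" for s t
    proof -
      have close: "\<bar>G (\<gamma> q) - G (\<gamma> r)\<bar> \<le> \<epsilon> / 2" if "q \<in> {s..t}" for q
      proof -
        have "\<bar>q - r\<bar> < \<delta>" using that st by (auto simp: abs_less_iff)
        then show ?thesis using near[of q] that st by (auto simp: dist_real_def)
      qed
      have "(\<integral>\<^sup>+ q \<in> {?l s..?l t}. ennreal (G (?\<sigma> q)) \<partial>lborel) \<le> ennreal ((G (\<gamma> r) + \<epsilon> / 2) * (?l t - ?l s))"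
      proof (rule nn_integral_Icc_le)
        fix q assume q: "q \<in> {?l s..?l t}"
        obtain w where w: "w \<in> {s..t}" "?l w = q"
          using len_upto_IVT[OF rect, of s t q] q st by auto
        then have "?\<sigma> q = \<gamma> w"
          using arc_length_param_len_upto[OF rect, of w] st by auto
        then show "ennreal (G (?\<sigma> q)) \<le> ennreal (G (\<gamma> r) + \<epsilon> / 2)"
          using abs_le_D1[OF close[OF w(1)]] by (intro ennreal_leI) (simp add: algebra_simps)
      qed (use G(2)[of "\<gamma> r"] \<epsilon> mono[of s t] st in auto)
      also have "\<dots> \<le> ennreal ((G (\<gamma> r) + \<epsilon> / 2) * (t - s))"
        using G(2)[of "\<gamma> r"] \<epsilon> mono[of s t] st by (intro ennreal_leI mult_left_mono) auto
      also have "\<dots> \<le> (\<integral>\<^sup>+ q \<in> {s..t}. ennreal (G (\<gamma> q)) \<partial>lborel) + ennreal (\<epsilon> * (t - s))"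
      proof (rule nn_integral_Icc_ge)
        fix q assume "q \<in> {s..t}"
        then show "ennreal (G (\<gamma> r) + \<epsilon> / 2) \<le> ennreal (G (\<gamma> q)) + ennreal \<epsilon>"
          using abs_le_D2[OF close[of q]] G(2)[of "\<gamma> q"] \<epsilon> by (auto simp flip: ennreal_plus intro!: ennreal_leI)
      qed (use G(2)[of "\<gamma> r"] \<epsilon> st in \<open>auto intro!: m2\<close>)
      finally show ?thesis .
    qed
    then show "\<exists>\<delta>>0. \<forall>s t. 0 \<le> s \<longrightarrow> s \<le> r \<longrightarrow> r \<le> t \<longrightarrow> t \<le> L \<longrightarrow> t - s < \<delta> \<longrightarrow>
        (\<integral>\<^sup>+ q \<in> {?l s..?l t}. ennreal (G (?\<sigma> q)) \<partial>lborel)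
        \<le> (\<integral>\<^sup>+ q \<in> {s..t}. ennreal (G (\<gamma> q)) \<partial>lborel) + ennreal (\<epsilon> * (t - s))"
      using \<delta> by blast
  qed (use L in auto)
  also have "\<dots> \<le> (\<integral>\<^sup>+ q \<in> {0..L}. ennreal (G (\<gamma> q)) \<partial>lborel) + ennreal e"
    using \<epsilon> by (intro add_left_mono ennreal_leI) simp
  finally show "path_integral (0, L, \<gamma>) (\<lambda>x. ennreal (G x)) \<le> (\<integral>\<^sup>+ s \<in> {0..L}. ennreal (G (\<gamma> s)) \<partial>lborel) + ennreal e"
    by (simp add: path_integral_eq_lborel path_len_eq)
qed

lemma lipschitz_path:
  assumes "1-lipschitz_on {0..L} \<gamma>" "0 \<le> L" "\<gamma> ` {0..L} \<subseteq> \<Omega>" "\<gamma> 0 \<noteq> \<gamma> L"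
  shows "(0, L, \<gamma>) \<in> paths_in \<Omega>"
proof -
  have "curve_length \<gamma> 0 L \<le> ennreal (L - 0)"
    using assms by (intro curve_length_le_lipschitz)
  then have "curve_length \<gamma> 0 L < \<infinity>"
    by (auto simp: less_top[symmetric] top_unique)
  moreover have "\<not> \<gamma> constant_on {0..L}"
    using assms unfolding constant_on_def by (metis atLeastAtMost_iff order_refl)
  ultimately show ?thesis
    using assms lipschitz_on_continuous_on[OF assms(1)] by (auto simp: paths_in_def)
qed

section \<open>Topology and measure of the space\<close>

lemma infdist_less_obtain:
  assumes "infdist x K < e" "K \<noteq> {}"
  obtains k where "k \<in> K" "dist x k < e"
  using assms by (auto simp: infdist_notempty cINF_less_iff)

lemma lipschitz_on_infdist_clamp:
  assumes "0 \<le> c"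
  shows "c-lipschitz_on UNIV (\<lambda>x. max 0 (min 1 (d - c * infdist x S)))"
    and "c-lipschitz_on UNIV (\<lambda>x. max 0 (min 1 (c * infdist x S)))"
proof -
  have *: "\<bar>c * infdist x S - c * infdist y S\<bar> \<le> c * dist x y" for x y
    using mult_left_mono[OF infdist_triangle_abs[of x S y] assms] assms
    by (metis abs_mult abs_of_nonneg right_diff_distrib)
  show "c-lipschitz_on UNIV (\<lambda>x. max 0 (min 1 (d - c * infdist x S)))"
  proof (intro lipschitz_onI assms)
    fix x y
    show "dist (max 0 (min 1 (d - c * infdist x S))) (max 0 (min 1 (d - c * infdist y S))) \<le> c * dist x y"
      using *[of x y] by (auto simp: dist_real_def)
  qed
  show "c-lipschitz_on UNIV (\<lambda>x. max 0 (min 1 (c * infdist x S)))"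
  proof (intro lipschitz_onI assms)
    fix x y
    show "dist (max 0 (min 1 (c * infdist x S))) (max 0 (min 1 (c * infdist y S))) \<le> c * dist x y"
      using *[of x y] by (auto simp: dist_real_def)
  qed
qed

lemma open_lipschitz_approx:
  fixes U :: "'a::metric_space set"
  assumes "open U"
  obtains f :: "nat \<Rightarrow> 'a \<Rightarrow> real"
  where "\<And>n. \<exists>L. L-lipschitz_on UNIV (f n)" "\<And>n x. 0 \<le> f n x" "\<And>n x. f n x \<le> 1"
    "\<And>x. mono (\<lambda>n. f n x)" "\<And>n x. x \<notin> U \<Longrightarrow> f n x = 0"
    "\<And>x. x \<in> U \<Longrightarrow> eventually (\<lambda>n. f n x = 1) sequentially"
\<comment> \<open>\<open>infdist\<close> to the empty set is 0 by convention, so the distance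
  formula would vanish identically here.\<close>
proof (cases "U = UNIV")
  case True
  show ?thesis
    by (rule that[of "\<lambda>_ _. 1"]) (use True in \<open>auto simp: mono_def intro!: exI[of _ 0] lipschitz_onI\<close>)
next
  case False
  then have ne: "- U \<noteq> {}" by auto
  let ?f = "\<lambda>(n::nat) x. max 0 (min 1 (real n * infdist x (- U)))"
  show ?thesis
  proof (rule that[of ?f])
    show "\<exists>L. L-lipschitz_on UNIV (?f n)" for n
      using lipschitz_on_infdist_clamp(2)[of "real n" "- U"] by auto
    show "mono (\<lambda>n. ?f n x)" for x
      by (intro monoI max.mono min.mono mult_right_mono) (auto simp: infdist_nonneg)
    show "?f n x = 0" if "x \<notin> U" for n x using that by simp
    show "eventually (\<lambda>n. ?f n x = 1) sequentially" if "x \<in> U" for x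
    proof -
      have "0 < infdist x (- U)"
        using that assms ne by (intro infdist_pos_not_in_closed) auto
      moreover obtain N where "1 / infdist x (- U) < real N" using reals_Archimedean2 by blast
      ultimately have "1 \<le> real n * infdist x (- U)" if "n \<ge> N" for n
      proof -
        have "1 / infdist x (- U) \<le> real n"
          using \<open>1 / infdist x (- U) < real N\<close> that by linarith
        then show ?thesis using \<open>0 < infdist x (- U)\<close> by (simp add: field_simps)
      qed
      then show ?thesis by (auto simp: eventually_sequentially intro!: exI[of _ N])
    qed
  qed auto
qed

text \<open>Besides the usual data (\<open>\<phi> = 1\<close> on the neighbourhood \<open>W\<close>
  of \<open>K\<close>, \<open>\<phi> = 0\<close> off the compact set \<open>C\<close>), an open set
  \<open>A\<close> away from \<open>K\<close> is recorded outside of which \<open>\<phi>\<close> is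
  locally constant. It is where the Lipschitz constant of \<open>\<phi>\<close> enters an upper
  gradient.\<close>

definition cutoff_function ::
    "'a::metric_space set \<Rightarrow> 'a set \<Rightarrow> real \<Rightarrow> ('a \<Rightarrow> real) \<Rightarrow> 'a set \<Rightarrow> 'a set \<Rightarrow> 'a set \<Rightarrow> bool" where
  "cutoff_function K U L \<phi> W C A \<longleftrightarrow>
     L-lipschitz_on UNIV \<phi> \<and> (\<forall>x. 0 \<le> \<phi> x) \<and> (\<forall>x. \<phi> x \<le> 1) \<and>
     open W \<and> K \<subseteq> W \<and> (\<forall>x. x \<in> W \<longrightarrow> \<phi> x = 1) \<and>
     compact C \<and> C \<subseteq> U \<and> (\<forall>x. x \<notin> C \<longrightarrow> \<phi> x = 0) \<and>
     open A \<and> A \<subseteq> C \<and> A \<inter> K = {} \<and> (\<forall>x. x \<notin> A \<longrightarrow> (\<exists>r>0. \<forall>y\<in>ball x r. \<phi> y = \<phi> x))"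

lemma cutoff_functionD:
  assumes "cutoff_function K U L \<phi> W C A"
  shows "L-lipschitz_on UNIV \<phi>" "\<And>x. 0 \<le> \<phi> x" "\<And>x. \<phi> x \<le> 1"
    "open W" "K \<subseteq> W" "\<And>x. x \<in> W \<Longrightarrow> \<phi> x = 1"
    "compact C" "C \<subseteq> U" "\<And>x. x \<notin> C \<Longrightarrow> \<phi> x = 0"
    "open A" "A \<subseteq> C" "A \<inter> K = {}" "\<And>x. x \<notin> A \<Longrightarrow> \<exists>r>0. \<forall>y\<in>ball x r. \<phi> y = \<phi> x"
  using assms unfolding cutoff_function_def by simp_all

section \<open>Compactness, cutoff functions and regularity of the measure in a doubling
  space\<close>

locale doubling_space =
  fixes mu :: "'a::complete_space set \<Rightarrow> ennreal"
  assumes outer: "borel_regular_outer_measure mu"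
    and ball_pos_finite: "\<And>x r. r > 0 \<Longrightarrow> 0 < mu (ball x r) \<and> mu (ball x r) < \<infinity>"
    and doubling: "doubling mu"
begin

abbreviation M :: "'a measure" where "M \<equiv> caratheodory_measure mu"

lemma space_M [simp]: "space M = UNIV"
  by (rule space_caratheodory_measure[OF outer])

lemma emeasure_M: "A \<in> sets M \<Longrightarrow> emeasure M A = mu A"
  using emeasure_caratheodory_measure[OF outer] by (simp add: sets_caratheodory_measure[OF outer])

lemma borel_sets_M: "A \<in> sets borel \<Longrightarrow> A \<in> sets M"
  using outer by (auto simp: borel_regular_outer_measure_def sets_caratheodory_measure[OF outer])

lemma open_sets_M [intro]: "open A \<Longrightarrow> A \<in> sets M"
  by (simp add: borel_sets_M)

lemma closed_sets_M [intro]: "closed A \<Longrightarrow> A \<in> sets M"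
  by (simp add: borel_sets_M)

lemma measurable_M: "f \<in> measurable borel N \<Longrightarrow> f \<in> measurable M N"
  using borel_sets_M by (auto simp: measurable_def)

lemma measurable_restrict_M:
  "f \<in> measurable (restrict_space borel S) N \<Longrightarrow> f \<in> measurable (restrict_space M S) N"
  using borel_sets_M by (auto simp: measurable_def space_restrict_space sets_restrict_space)

lemma Borel_hull:
  assumes "A \<in> sets M"
  obtains B where "B \<in> sets borel" "A \<subseteq> B" "emeasure M B = emeasure M A"
  using outer assms emeasure_M borel_sets_M unfolding borel_regular_outer_measure_def by metis

lemma bounded_finite_measure:
  assumes "bounded S" "S \<in> sets M"
  shows "emeasure M S < \<infinity>"
proof -
  obtain x e where "S \<subseteq> ball x e" "e > 0"
    using assms(1) by (metis bounded_subset_ballD)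
  then have "emeasure M S \<le> mu (ball x e)"
    using emeasure_mono[of S "ball x e" M] emeasure_M[of "ball x e"] by auto
  then show ?thesis using ball_pos_finite[OF \<open>e > 0\<close>, of x] by (metis le_less_trans)
qed

lemma compact_finite_measure: "compact S \<Longrightarrow> emeasure M S < \<infinity>"
  by (intro bounded_finite_measure) (auto simp: compact_imp_bounded compact_imp_closed)

text \<open>Volume counting: the \<open>e / 2\<close>-balls about the points of an
  \<open>e\<close>-separated subset of \<open>S\<close> are disjoint, lie in the fixed ball
  \<open>B\<close>, and each has measure at least \<open>mu B\<close> divided by a fixed power of
  the doubling constant. So their number is bounded, and \<open>S\<close> is totally
  bounded.\<close>

lemma bounded_closed_imp_compact:
  fixes S :: "'a set"
  assumes "bounded S" "closed S"
  shows "compact S"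
  unfolding compact_eq_totally_bounded
proof (intro conjI allI impI)
  show "complete S" using assms by (simp add: complete_eq_closed)
  fix e :: real assume e: "0 < e"
  obtain x0 R where S: "S \<subseteq> ball x0 R" and R: "R > 0"
    using assms(1) by (metis bounded_subset_ballD)
  obtain C where C: "\<And>x r. r > 0 \<Longrightarrow> mu (ball x (2 * r)) \<le> ennreal C * mu (ball x r)"
    using doubling unfolding doubling_def by blast
  define B where "B = ball x0 (R + e)"
  have B: "0 < mu B" "mu B < \<infinity>" using ball_pos_finite[of "R + e" x0] R e by (auto simp: B_def)
  have pow: "mu (ball y (2 ^ n * r)) \<le> ennreal C ^ n * mu (ball y r)" if "r > 0" for y r and n :: nat
  proof (induction n)
    case (Suc n)
    have "mu (ball y (2 ^ Suc n * r)) \<le> ennreal C * mu (ball y (2 ^ n * r))"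
      using C[of "2 ^ n * r" y] that by (simp add: ac_simps)
    also have "\<dots> \<le> ennreal C * (ennreal C ^ n * mu (ball y r))"
      by (intro mult_left_mono Suc) simp
    finally show ?case by (simp add: ac_simps)
  qed simp
  \<comment> \<open>A point of \<open>S\<close> is within \<open>R\<close> of \<open>x0\<close> and
    \<open>B\<close> has radius \<open>R + e\<close>, so a ball of radius \<open>2 * R + e\<close>
    about it contains \<open>B\<close>. This radius is reached from \<open>e / 2\<close> by
    \<open>N\<close> doublings.\<close>
  obtain N where N: "(2 * R + e) / (e / 2) < 2 ^ N"
    using real_arch_pow[of 2] by auto
  have big: "mu B \<le> ennreal C ^ N * emeasure M (ball y (e / 2))" if "y \<in> S" for y
  proof -
    have "B \<subseteq> ball y (2 ^ N * (e / 2))"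
    proof
      fix z assume "z \<in> B"
      moreover have "dist x0 y < R" using that S by auto
      ultimately have "dist y z < 2 * R + e"
        using dist_triangle[of y z x0] by (simp add: B_def dist_commute)
      also have "2 * R + e \<le> 2 ^ N * (e / 2)"
        using N e by (simp add: field_simps)
      finally show "z \<in> ball y (2 ^ N * (e / 2))" by simp
    qed
    then have "emeasure M B \<le> emeasure M (ball y (2 ^ N * (e / 2)))"
      by (rule emeasure_mono) (rule open_sets_M, simp)
    then have "mu B \<le> mu (ball y (2 ^ N * (e / 2)))"
      by (simp add: emeasure_M[OF open_sets_M] B_def)
    also have "\<dots> \<le> ennreal C ^ N * mu (ball y (e / 2))"
      using pow[of "e / 2" y N] e by simp
    finally show ?thesis by (simp add: emeasure_M[OF open_sets_M])
  qed
  show "\<exists>k. finite k \<and> S \<subseteq> (\<Union>x\<in>k. ball x e)"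
  proof (rule ccontr)
    assume no: "\<nexists>k. finite k \<and> S \<subseteq> (\<Union>x\<in>k. ball x e)"
    \<comment> \<open>If no finite family of \<open>e\<close>-balls about points covers
      \<open>S\<close>, every finite separated set leaves a point uncovered and can be enlarged;
      this yields separated sets of every size.\<close>
    have ex: "\<exists>k. finite k \<and> card k = n \<and> k \<subseteq> S \<and> (\<forall>x\<in>k. \<forall>y\<in>k. x \<noteq> y \<longrightarrow> e \<le> dist x y)" for n
    proof (induction n)
      case 0 show ?case by (rule exI[of _ "{}"]) simp
    next
      case (Suc n)
      from this(1) obtain k where k: "finite k" "card k = n" "k \<subseteq> S" "\<forall>x\<in>k. \<forall>y\<in>k. x \<noteq> y \<longrightarrow> e \<le> dist x y"
        by (elim exE conjE)
      have "\<not> S \<subseteq> (\<Union>x\<in>k. ball x e)" using no k(1) by blast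
      then obtain y where y0: "y \<in> S" "y \<notin> (\<Union>x\<in>k. ball x e)" by blast
      then have y: "y \<in> S" "\<And>x. x \<in> k \<Longrightarrow> e \<le> dist x y"
        by (auto simp: not_less)
      then have "y \<notin> k" using e by fastforce
      then have "finite (insert y k) \<and> card (insert y k) = Suc n \<and> insert y k \<subseteq> S"
        using k y by simp
      moreover have "\<forall>x\<in>insert y k. \<forall>z\<in>insert y k. x \<noteq> z \<longrightarrow> e \<le> dist x z"
        using k(4) y(2) by (auto simp: dist_commute[of y])
      ultimately show ?case by blast
    qed
    have bound: "of_nat n \<le> ennreal C ^ N" for n
    proof -
      from ex[of n] obtain k where k: "finite k" "card k = n" "k \<subseteq> S" "\<forall>x\<in>k. \<forall>y\<in>k. x \<noteq> y \<longrightarrow> e \<le> dist x y"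
        by (elim exE conjE)
      have disj: "disjoint_family_on (\<lambda>y. ball y (e / 2)) k"
        unfolding disjoint_family_on_def
      proof (intro ballI impI)
        fix x y assume xy: "x \<in> k" "y \<in> k" "x \<noteq> y"
        then have "e \<le> dist x y" using k(4) by auto
        then have False if "dist x z < e / 2" "dist y z < e / 2" for z
          using that dist_triangle2[of x y z] by linarith
        then show "ball x (e / 2) \<inter> ball y (e / 2) = {}" by auto
      qed
      have "mu B * of_nat n = (\<Sum>y\<in>k. mu B)" using k by (simp add: mult.commute)
      also have "\<dots> \<le> (\<Sum>y\<in>k. ennreal C ^ N * emeasure M (ball y (e / 2)))"
        using k by (intro sum_mono big) auto
      also have "\<dots> = ennreal C ^ N * emeasure M (\<Union>y\<in>k. ball y (e / 2))"
        using k disj by (simp flip: sum_distrib_left) (subst sum_emeasure, auto)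
      also have "\<dots> \<le> ennreal C ^ N * emeasure M B"
      proof (intro mult_left_mono emeasure_mono)
        show "(\<Union>y\<in>k. ball y (e / 2)) \<subseteq> B"
        proof
          fix z assume "z \<in> (\<Union>y\<in>k. ball y (e / 2))"
          then obtain y where y: "y \<in> k" "dist y z < e / 2" by auto
          then have "dist x0 y < R" using k S by auto
          then show "z \<in> B" using y e dist_triangle[of x0 z y] by (simp add: B_def)
        qed
      qed (auto simp: B_def)
      also have "emeasure M B = mu B" by (rule emeasure_M) (auto simp: B_def)
      finally have "mu B * of_nat n \<le> mu B * ennreal C ^ N"
        by (simp add: mult.commute)
      then show ?thesis
        using B by (subst (asm) ennreal_mult_le_mult_iff) auto
    qed
    have "ennreal C ^ N < \<infinity>" by (simp add: power_less_top_ennreal)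
    then obtain c where c: "ennreal C ^ N = ennreal c" "0 \<le> c"
      by (metis ennreal_cases infinity_ennreal_def less_irrefl)
    obtain n where n: "c < real n" using reals_Archimedean2 by blast
    have "ennreal (real n) \<le> ennreal c"
      using bound[of n] c(1) by (simp add: ennreal_of_nat_eq_real_of_nat)
    then show False using n c(2) by (simp add: ennreal_le_iff2)
  qed
qed

text \<open>The metric neighbourhood of radius \<open>e / 2\<close> works: its closure lies in the
  \<open>e\<close>-neighbourhood, hence is bounded, hence compact.\<close>

lemma compact_nbhd:
  fixes S :: "'a set"
  assumes "compact S" "open U" "S \<subseteq> U"
  obtains N where "open N" "S \<subseteq> N" "compact (closure N)" "closure N \<subseteq> U"
proof -
  obtain e where e: "e > 0" "(\<Union>x\<in>S. ball x e) \<subseteq> U"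
    using compact_subset_open_imp_ball_epsilon_subset[OF assms] by blast
  define N where "N = (\<Union>x\<in>S. ball x (e / 2))"
  have cl: "closure N \<subseteq> (\<Union>x\<in>S. ball x e)"
  proof
    fix y assume "y \<in> closure N"
    then obtain z where z: "z \<in> N" "dist z y < e / 2"
      using e(1) by (auto simp: closure_approachable dest: spec[of _ "e / 2"])
    then obtain x where "x \<in> S" "dist x z < e / 2" by (auto simp: N_def)
    then show "y \<in> (\<Union>x\<in>S. ball x e)" using z dist_triangle[of x y z] by force
  qed
  obtain x0 R where R: "S \<subseteq> ball x0 R"
    using compact_imp_bounded[OF assms(1)] by (metis bounded_subset_ballD)
  have "(\<Union>x\<in>S. ball x e) \<subseteq> ball x0 (R + e)"
  proof
    fix y assume "y \<in> (\<Union>x\<in>S. ball x e)"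
    then obtain x where "x \<in> S" "dist x y < e" by auto
    then show "y \<in> ball x0 (R + e)" using R dist_triangle[of x0 y x] by force
  qed
  then have "bounded (closure N)" using cl by (meson bounded_ball bounded_subset)
  then have "compact (closure N)" by (intro bounded_closed_imp_compact) auto
  moreover have "open N" "S \<subseteq> N" using e by (auto simp: N_def)
  ultimately show ?thesis using that cl e(2) by blast
qed

lemma cutoff_exists:
  fixes K :: "'a set"
  assumes "compact K" "open U" "K \<subseteq> U"
  obtains L \<phi> W C A where "cutoff_function K U L \<phi> W C A"
proof (cases "K = {}")
  \<comment> \<open>With \<open>K\<close> empty, \<open>infdist\<close> is 0 everywhere and the
    formula used below would give the constant 1 instead of a compactly supported function.\<close>
  case True
  show ?thesis
    by (rule that[of 0 "\<lambda>_. 0" "{}" "{}" "{}"])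
       (use True in \<open>auto simp: cutoff_function_def intro!: lipschitz_onI exI[of _ 1]\<close>)
next
  case False
  obtain e where e: "e > 0" "(\<Union>x\<in>K. ball x e) \<subseteq> U"
    using compact_subset_open_imp_ball_epsilon_subset[OF assms] by blast
  \<comment> \<open>\<open>\<phi>\<close> is 1 up to distance \<open>r\<close> from \<open>K\<close>
    and 0 from distance \<open>2 * r\<close> on. The quarter leaves room for \<open>C\<close>, which
    reaches to distance \<open>3 * r < e\<close>.\<close>
  define r where "r = e / 4"
  have r: "r > 0" using e by (simp add: r_def)
  define \<phi> where "\<phi> x = max 0 (min 1 (2 - (1 / r) * infdist x K))" for x
  have one: "\<phi> x = 1" if "infdist x K \<le> r" for x
    using that r by (simp add: \<phi>_def field_simps)
  have zero: "\<phi> x = 0" if "infdist x K \<ge> 2 * r" for x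
    using that r by (simp add: \<phi>_def field_simps max_def)
  have cont: "continuous_on UNIV (\<lambda>x. infdist x K)"
    by (intro continuous_intros)
  define C where "C = {x. infdist x K \<le> 3 * r}"
  have CU: "C \<subseteq> (\<Union>x\<in>K. ball x e)"
  proof
    fix x assume "x \<in> C"
    then have "infdist x K < e" using r e by (simp add: C_def r_def)
    then show "x \<in> (\<Union>x\<in>K. ball x e)"
      using False by (auto elim!: infdist_less_obtain simp: dist_commute)
  qed
  obtain x0 R where R: "K \<subseteq> ball x0 R"
    using compact_imp_bounded[OF assms(1)] by (metis bounded_subset_ballD)
  have "(\<Union>x\<in>K. ball x e) \<subseteq> ball x0 (R + e)"
  proof
    fix y assume "y \<in> (\<Union>x\<in>K. ball x e)"
    then obtain x where "x \<in> K" "dist x y < e" by auto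
    then show "y \<in> ball x0 (R + e)" using R dist_triangle[of x0 y x] by force
  qed
  then have "bounded C" using CU by (meson bounded_ball bounded_subset)
  moreover have "closed C" unfolding C_def by (intro closed_Collect_le continuous_intros)
  ultimately have "compact C" by (rule bounded_closed_imp_compact)
  show ?thesis
  proof (rule that[of "1 / r" \<phi> "{x. infdist x K < r}" C "{x. r / 2 < infdist x K \<and> infdist x K < 3 * r}"],
      unfold cutoff_function_def, intro conjI allI impI)
    show "(1 / r)-lipschitz_on UNIV \<phi>"
      unfolding \<phi>_def using r by (intro lipschitz_on_infdist_clamp) simp
    show "open {x. infdist x K < r}" by (intro open_Collect_less continuous_intros)
    show "open {x. r / 2 < infdist x K \<and> infdist x K < 3 * r}"
      by (intro open_Collect_conj open_Collect_less continuous_intros)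
    \<comment> \<open>\<open>A\<close> exceeds the region where \<open>\<phi>\<close> varies by
      \<open>r / 2\<close> on the inner side and by \<open>r\<close> on the outer side; these
      margins are the radii of the balls on which \<open>\<phi>\<close> is constant.\<close>
    show "\<exists>q>0. \<forall>y\<in>ball x q. \<phi> y = \<phi> x"
      if "x \<notin> {x. r / 2 < infdist x K \<and> infdist x K < 3 * r}" for x
    proof (cases "infdist x K \<le> r / 2")
      case True
      have "\<phi> y = \<phi> x" if "y \<in> ball x (r / 2)" for y
      proof -
        have "infdist y K \<le> r"
          using that True infdist_triangle[of y K x] by (simp add: dist_commute)
        then show ?thesis using one True r by simp
      qed
      then show ?thesis using half_gt_zero[OF r] by blast
    next
      case F: False
      have "\<phi> y = \<phi> x" if "y \<in> ball x r" for y
      proof -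
        have "infdist y K \<ge> 2 * r"
          using that F \<open>x \<notin> _\<close> infdist_triangle[of x K y] by simp
        then show ?thesis using zero[of y] zero[of x] F \<open>x \<notin> _\<close> r by simp
      qed
      then show ?thesis using r by blast
    qed
    show "\<phi> x = 0" if "x \<notin> C" for x using that r by (intro zero) (simp add: C_def)
    show "C \<subseteq> U" using CU e by blast
  qed (use r one \<open>compact C\<close> in \<open>auto simp: C_def \<phi>_def\<close>)
qed

text \<open>The sets that can be squeezed between a closed and an open set form a sigma-algebra
  containing the open sets. Approximating from both sides at once makes complements trivial, as the
  two approximants swap roles.\<close>

lemma closed_inner_open_outer:
  assumes N: "open N" "emeasure M N < \<infinity>" and B: "B \<in> sets borel"
  shows "\<forall>e>0. \<exists>F U. closed F \<and> open U \<and> F \<subseteq> B \<and> B \<subseteq> U \<and> emeasure M (N \<inter> (U - F)) \<le> ennreal e"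
proof -
  \<comment> \<open>An increasing union of closed sets need not be closed, but some stage
    \<open>F n\<close> loses at most \<open>e\<close> more. This is continuity of the measure from
    above, valid inside \<open>N\<close> because its measure is finite.\<close>
  have lim: "\<exists>n. emeasure M (N \<inter> (U - F n)) \<le> emeasure M (N \<inter> (U - (\<Union>i. F i))) + ennreal e"
    if "open U" "incseq F" "\<And>n. closed (F n)" "0 < e" for U e and F :: "nat \<Rightarrow> 'a set"
  proof -
    have s: "N \<inter> (U - F n) \<in> sets M" for n using that N by auto
    have fin: "emeasure M A < \<infinity>" if "A \<subseteq> N" for A
      using emeasure_mono[OF that, of M] N by (auto intro: le_less_trans)
    have "(\<lambda>n. emeasure M (N \<inter> (U - F n))) \<longlonglongrightarrow> emeasure M (\<Inter>n. N \<inter> (U - F n))"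
      using s fin \<open>incseq F\<close> by (intro Lim_emeasure_decseq) (auto simp: decseq_def incseq_def less_top, fastforce)
    also have "(\<Inter>n. N \<inter> (U - F n)) = N \<inter> (U - (\<Union>i. F i))" by auto
    finally have "(\<lambda>n. emeasure M (N \<inter> (U - F n))) \<longlonglongrightarrow> emeasure M (N \<inter> (U - (\<Union>i. F i)))" .
    moreover have "emeasure M (N \<inter> (U - (\<Union>i. F i))) < emeasure M (N \<inter> (U - (\<Union>i. F i))) + ennreal e"
      using fin[of "N \<inter> (U - (\<Union>i. F i))"] \<open>0 < e\<close>
      by (cases "emeasure M (N \<inter> (U - (\<Union>i. F i)))") (auto simp flip: ennreal_plus simp: ennreal_less_iff)
    ultimately have "eventually (\<lambda>n. emeasure M (N \<inter> (U - F n)) < emeasure M (N \<inter> (U - (\<Union>i. F i))) + ennreal e) sequentially"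
      by (rule order_tendstoD)
    then show ?thesis by (auto simp: eventually_sequentially intro: less_imp_le)
  qed
  have "B \<in> sigma_sets UNIV {S. open S}" using B by (simp add: sets_borel)
  then show ?thesis
  proof induction
    case (Basic S)
    then have S: "open S" by simp
    define F where "F n = (if S = UNIV then UNIV else {x. 1 / (real n + 1) \<le> infdist x (- S)})" for n
    have cl: "closed (F n)" for n
      unfolding F_def by (auto intro!: closed_Collect_le continuous_intros)
    have inc: "incseq F"
    proof (rule incseq_SucI)
      fix n
      have "1 / (real (Suc n) + 1) \<le> 1 / (real n + 1)" by (simp add: frac_le)
      then show "F n \<subseteq> F (Suc n)" by (auto simp: F_def)
    qed
    have sub: "F n \<subseteq> S" for n
    proof
      fix x assume "x \<in> F n"
      then show "x \<in> S"
        by (cases "x \<in> S") (auto simp: F_def field_simps split: if_splits)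
    qed
    have "S \<subseteq> (\<Union>n. F n)"
    proof
      fix x assume x: "x \<in> S"
      show "x \<in> (\<Union>n. F n)"
      proof (cases "S = UNIV")
        case False
        then have "0 < infdist x (- S)"
          using x S by (intro infdist_pos_not_in_closed) auto
        then obtain n where "1 / (real n + 1) < infdist x (- S)"
          by (metis nat_approx_posE of_nat_Suc add.commute)
        then show ?thesis using False by (auto simp: F_def intro!: exI[of _ n])
      qed (simp add: F_def)
    qed
    then have eq: "S - (\<Union>n. F n) = {}" by auto
    show ?case
    proof (intro allI impI)
      fix e :: real assume "0 < e"
      from lim[OF S inc cl this] obtain n where "emeasure M (N \<inter> (S - F n)) \<le> ennreal e"
        unfolding eq by auto
      then show "\<exists>F U. closed F \<and> open U \<and> F \<subseteq> S \<and> S \<subseteq> U \<and> emeasure M (N \<inter> (U - F)) \<le> ennreal e"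
        using S cl sub by blast
    qed
  next
    case Empty
    show ?case by (intro allI impI exI[of _ "{}"]) simp
  next
    case (Compl B)
    show ?case
    proof (intro allI impI)
      fix e :: real assume "0 < e"
      from Compl.IH[rule_format, OF this]
      obtain F U where "closed F" "open U" "F \<subseteq> B" "B \<subseteq> U" "emeasure M (N \<inter> (U - F)) \<le> ennreal e"
        by blast
      moreover have "- F - - U = U - F" by auto
      ultimately show "\<exists>F U. closed F \<and> open U \<and> F \<subseteq> UNIV - B \<and> UNIV - B \<subseteq> U \<and> emeasure M (N \<inter> (U - F)) \<le> ennreal e"
        by (intro exI[of _ "- U"] exI[of _ "- F"]) auto
    qed
  next
    case (Union B)
    show ?case
    proof (intro allI impI)
      fix e :: real assume e: "0 < e"
      \<comment> \<open>Half of the budget is distributed over the sets of the sequence; the other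
        half pays for replacing the union of the closed sets by a finite one.\<close>
      have "\<exists>F U. closed F \<and> open U \<and> F \<subseteq> B i \<and> B i \<subseteq> U \<and> emeasure M (N \<inter> (U - F)) \<le> ennreal (e / 2 * (1 / 2) ^ Suc i)" for i
        using Union.IH[of i] e by simp
      then obtain F U where FU: "\<And>i. closed (F i)" "\<And>i. open (U i)" "\<And>i. F i \<subseteq> B i" "\<And>i. B i \<subseteq> U i"
        "\<And>i. emeasure M (N \<inter> (U i - F i)) \<le> ennreal (e / 2 * (1 / 2) ^ Suc i)"
        by metis
      define G where "G n = (\<Union>i<n. F i)" for n :: nat
      have G: "closed (G n)" for n using FU by (auto simp: G_def)
      have incG: "incseq G" by (force simp: G_def incseq_def)
      have UG: "(\<Union>n. G n) = (\<Union>i. F i)" by (auto simp: G_def)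
      have sm: "N \<inter> (U i - F i) \<in> sets M" for i
        by (intro sets.Int sets.Diff open_sets_M closed_sets_M FU N)
      have "emeasure M (N \<inter> ((\<Union>i. U i) - (\<Union>i. F i))) \<le> emeasure M (\<Union>i. N \<inter> (U i - F i))"
        by (intro emeasure_mono sets.countable_UN image_subsetI sm) auto
      also have "\<dots> \<le> (\<Sum>i. emeasure M (N \<inter> (U i - F i)))"
        using sm by (intro emeasure_subadditive_countably) auto
      also have "\<dots> \<le> (\<Sum>i. ennreal (e / 2 * (1 / 2) ^ Suc i))"
        by (intro suminf_le FU(5)) auto
      also have "\<dots> = ennreal (e / 2)"
        using e sums_mult[OF power_half_series, of "e / 2"] by (intro suminf_ennreal_eq) auto
      finally have half: "emeasure M (N \<inter> ((\<Union>i. U i) - (\<Union>i. F i))) \<le> ennreal (e / 2)" .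
      have oU: "open (\<Union>i. U i)" using FU(2) by blast
      obtain n where "emeasure M (N \<inter> ((\<Union>i. U i) - G n)) \<le> emeasure M (N \<inter> ((\<Union>i. U i) - (\<Union>i. F i))) + ennreal (e / 2)"
        using lim[OF oU incG G half_gt_zero[OF e]] unfolding UG by blast
      also have "\<dots> \<le> ennreal (e / 2) + ennreal (e / 2)"
        by (intro add_right_mono half)
      also have "\<dots> = ennreal e" using e by (simp flip: ennreal_plus)
      finally have "emeasure M (N \<inter> ((\<Union>i. U i) - G n)) \<le> ennreal e" .
      moreover have "G n \<subseteq> (\<Union>i. B i)" "(\<Union>i. B i) \<subseteq> (\<Union>i. U i)"
        using FU(3,4) by (fastforce simp: G_def)+
      ultimately show "\<exists>F V. closed F \<and> open V \<and> F \<subseteq> (\<Union>i. B i) \<and> (\<Union>i. B i) \<subseteq> V \<and> emeasure M (N \<inter> (V - F)) \<le> ennreal e"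
        using G FU(2) by (intro exI[of _ "G n"] exI[of _ "\<Union>i. U i"]) auto
    qed
  qed
qed

text \<open>The Borel hull of equal measure reduces this to Borel sets, and intersecting with
  \<open>N\<close> keeps the open set inside.\<close>

lemma open_outer:
  assumes A: "A \<in> sets M" "A \<subseteq> N" and N: "open N" "emeasure M N < \<infinity>" and e: "0 < (e::real)"
  obtains U where "open U" "A \<subseteq> U" "U \<subseteq> N" "emeasure M U \<le> emeasure M A + ennreal e"
proof -
  obtain B where B: "B \<in> sets borel" "A \<subseteq> B" "emeasure M B = emeasure M A"
    using Borel_hull[OF A(1)] .
  obtain F U where FU: "closed F" "open U" "F \<subseteq> B" "B \<subseteq> U" "emeasure M (N \<inter> (U - F)) \<le> ennreal e"
    using closed_inner_open_outer[OF N B(1), rule_format, OF e] by blast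
  have "emeasure M (U \<inter> N) \<le> emeasure M (B \<union> (N \<inter> (U - F)))"
    using FU N borel_sets_M[OF B(1)] by (intro emeasure_mono) auto
  also have "\<dots> \<le> emeasure M B + emeasure M (N \<inter> (U - F))"
    using FU N borel_sets_M[OF B(1)] by (intro emeasure_subadditive) auto
  also have "\<dots> \<le> emeasure M A + ennreal e"
    using FU B by (intro add_mono) auto
  finally show ?thesis
    using that[of "U \<inter> N"] FU B A N by auto
qed

end

section \<open>From functions of bounded variation to Newtonian functions\<close>

lemma locally_lipschitz_on_continuous_on:
  assumes "locally_lipschitz_on \<Omega> v"
  shows "continuous_on \<Omega> v"
proof -
  have "continuous (at x within \<Omega>) v" if x: "x \<in> \<Omega>" for x
  proof -
    obtain r L where r: "r > 0" "L-lipschitz_on (ball x r) v"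
      using bspec[OF assms[unfolded locally_lipschitz_on_def] x] by (elim exE conjE)
    then have "continuous_on (ball x r) v" by (auto intro: lipschitz_on_continuous_on)
    then have "continuous (at x) v"
      using r(1) by (auto simp: continuous_on_eq_continuous_at)
    then show ?thesis by (rule continuous_at_imp_continuous_within)
  qed
  then show ?thesis by (simp add: continuous_on_eq_continuous_within)
qed

lemma lipschitz_along_path:
  assumes "p \<in> paths_in \<Omega>" "0 \<le> s" "s \<le> t" "t \<le> path_len p"
  shows "dist (arc_length_param p t) (arc_length_param p s) \<le> t - s"
  using lipschitz_onD[OF paths_in_arc_length_param(1)[OF assms(1)], of t s] assms
  by (auto simp: dist_real_def)

text \<open>
  Where \<open>\<psi>\<close> varies, \<open>\<phi> = 0\<close> and the function is \<open>\<psi> v\<close>; where \<open>\<phi>\<close> varies, \<open>\<psi> = 1\<close> and the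
  function is \<open>1 - (1 - \<phi>) (1 - v)\<close>. So only \<open>\<bar>v\<bar>\<close> and \<open>\<bar>1 - v\<bar>\<close> enter the two error terms.
\<close>

lemma upper_gradient_cutoff:
  fixes v \<phi> \<psi> :: "'a::metric_space \<Rightarrow> real"
  assumes "open \<Omega>" and v: "continuous_on \<Omega> v" "upper_gradient \<Omega> (\<lambda>x. ereal (v x)) g"
    and \<phi>: "L\<^sub>1-lipschitz_on UNIV \<phi>" "\<And>x. 0 \<le> \<phi> x" "\<And>x. \<phi> x \<le> 1"
    and \<psi>: "L\<^sub>2-lipschitz_on UNIV \<psi>" "\<And>x. 0 \<le> \<psi> x" "\<And>x. \<psi> x \<le> 1"
    and A: "open A" "\<And>x. x \<notin> A \<Longrightarrow> \<exists>r>0. \<forall>y\<in>ball x r. \<psi> y = \<psi> x" "\<And>x. x \<in> A \<Longrightarrow> \<phi> x = 0"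
    and B: "open B" "\<And>x. x \<notin> B \<Longrightarrow> \<exists>r>0. \<forall>y\<in>ball x r. \<phi> y = \<phi> x" "\<And>x. x \<in> B \<Longrightarrow> \<psi> x = 1"
  defines "H \<equiv> \<lambda>x. g x + (ennreal (L\<^sub>2 * \<bar>v x\<bar>) * indicator A x + ennreal (L\<^sub>1 * \<bar>1 - v x\<bar>) * indicator B x)"
  shows "upper_gradient \<Omega> (\<lambda>x. ereal (\<phi> x + (1 - \<phi> x) * \<psi> x * v x)) H"
proof (rule upper_gradient_localI)
  define w where "w x = \<phi> x + (1 - \<phi> x) * \<psi> x * v x" for x
  have gm[measurable]: "g \<in> borel_measurable (restrict_space borel \<Omega>)"
    using v(2) by (simp add: upper_gradient_def)
  have vm[measurable]: "v \<in> borel_measurable (restrict_space borel \<Omega>)"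
    using v(1) by (rule borel_measurable_continuous_on_restrict)
  have ind[measurable]: "indicator U \<in> borel_measurable (restrict_space borel \<Omega>)" if "open U" for U :: "'a set"
    using that by (intro measurable_restrict_space1) simp
  have fm: "(\<lambda>x. ennreal (L\<^sub>2 * \<bar>v x\<bar>) * indicator A x) \<in> borel_measurable (restrict_space borel \<Omega>)"
    "(\<lambda>x. ennreal (L\<^sub>1 * \<bar>1 - v x\<bar>) * indicator B x) \<in> borel_measurable (restrict_space borel \<Omega>)"
    using ind[OF A(1)] ind[OF B(1)] by measurable
  show Hm: "H \<in> borel_measurable (restrict_space borel \<Omega>)"
    unfolding H_def using gm fm by (intro borel_measurable_add)
  have L: "0 \<le> L\<^sub>1" "0 \<le> L\<^sub>2" using \<phi>(1) \<psi>(1) by (auto dest: lipschitz_on_nonneg)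
  fix p and \<epsilon> r :: real
  assume p: "p \<in> paths_in \<Omega>" and \<epsilon>: "0 < \<epsilon>" and r: "r \<in> {0..path_len p}"
  let ?\<sigma> = "arc_length_param p"
  have inO: "?\<sigma> q \<in> \<Omega>" if "0 \<le> q" "q \<le> path_len p" for q
    using paths_in_arc_length_param(2)[OF p] that by auto
  \<comment> \<open>If the cutoffs add at most \<open>c * (t - s)\<close> to the increment of
    \<open>v\<close>, and \<open>f\<close> is at least \<open>c\<close> along the arc up to
    \<open>\<epsilon>\<close>, then \<open>g + f\<close> pays for both parts. Each case below only
    has to name \<open>f\<close> and \<open>c\<close>.\<close>
  have est: "ennreal \<bar>w (?\<sigma> t) - w (?\<sigma> s)\<bar> \<le> (\<integral>\<^sup>+ q \<in> {s..t}. H (?\<sigma> q) \<partial>lborel) + ennreal (\<epsilon> * (t - s))"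
    if st: "0 \<le> s" "s \<le> t" "t \<le> path_len p"
      and f: "f \<in> borel_measurable (restrict_space borel \<Omega>)" "\<And>x. g x + f x \<le> H x"
      and c: "0 \<le> c" "\<And>q. q \<in> {s..t} \<Longrightarrow> ennreal c \<le> f (?\<sigma> q) + ennreal \<epsilon>"
        "\<bar>w (?\<sigma> t) - w (?\<sigma> s)\<bar> \<le> \<bar>v (?\<sigma> t) - v (?\<sigma> s)\<bar> + c * (t - s)" for s t c f
  proof -
    have "ennreal \<bar>w (?\<sigma> t) - w (?\<sigma> s)\<bar> \<le> ennreal \<bar>v (?\<sigma> t) - v (?\<sigma> s)\<bar> + ennreal (c * (t - s))"
      using c(1,3) st by (simp flip: ennreal_plus)
    also have "\<dots> \<le> (\<integral>\<^sup>+ q \<in> {s..t}. g (?\<sigma> q) \<partial>lborel) +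
        ((\<integral>\<^sup>+ q \<in> {s..t}. f (?\<sigma> q) \<partial>lborel) + ennreal (\<epsilon> * (t - s)))"
      using st c(1,2) \<epsilon>
      by (intro add_mono upper_gradient_subpath[OF v(2) p] nn_integral_Icc_ge
          measurable_along_path_Icc[OF p f(1)]) auto
    also have "\<dots> = (\<integral>\<^sup>+ q. g (?\<sigma> q) * indicator {s..t} q + f (?\<sigma> q) * indicator {s..t} q \<partial>lborel) + ennreal (\<epsilon> * (t - s))"
      using measurable_along_path_Icc[OF p gm] measurable_along_path_Icc[OF p f(1)] st
      by (subst nn_integral_add) (auto simp: add.assoc)
    also have "\<dots> \<le> (\<integral>\<^sup>+ q \<in> {s..t}. H (?\<sigma> q) \<partial>lborel) + ennreal (\<epsilon> * (t - s))"
      using f(2) by (intro add_right_mono nn_integral_mono) (auto simp: indicator_def)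
    finally show ?thesis .
  qed
  define x where "x = ?\<sigma> r"
  have xO: "x \<in> \<Omega>" using inO r by (auto simp: x_def)
  \<comment> \<open>Values of \<open>v\<close> on the arc differ by up to
    \<open>2 * \<epsilon>'\<close>, which after multiplication by one of the Lipschitz constants
    must be at most \<open>\<epsilon>\<close>.\<close>
  define \<epsilon>' where "\<epsilon>' = \<epsilon> / (2 * (L\<^sub>1 + L\<^sub>2 + 1))"
  have \<epsilon>': "0 < \<epsilon>'" using \<epsilon> L by (simp add: \<epsilon>'_def add_nonneg_pos)
  have L\<epsilon>: "L * (2 * \<epsilon>') \<le> \<epsilon>" if "L \<le> L\<^sub>1 + L\<^sub>2" for L
  proof -
    have "L * (2 * \<epsilon>') \<le> (L\<^sub>1 + L\<^sub>2 + 1) * (2 * \<epsilon>')" using that \<epsilon>' by (intro mult_right_mono) auto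
    also have "\<dots> = \<epsilon>"
    proof -
      define k where "k = L\<^sub>1 + L\<^sub>2 + 1"
      have "k \<noteq> 0" using L by (simp add: k_def)
      then show ?thesis unfolding \<epsilon>'_def k_def[symmetric] by simp
    qed
    finally show ?thesis .
  qed
  obtain \<delta>\<^sub>1 where \<delta>\<^sub>1: "\<delta>\<^sub>1 > 0" "\<And>y. y \<in> \<Omega> \<Longrightarrow> dist y x < \<delta>\<^sub>1 \<Longrightarrow> dist (v y) (v x) < \<epsilon>'"
    using v(1) xO \<epsilon>' unfolding continuous_on_iff by blast
  have osc: "\<bar>v y - v z\<bar> \<le> 2 * \<epsilon>'" if "y \<in> \<Omega>" "z \<in> \<Omega>" "dist y x < \<delta>\<^sub>1" "dist z x < \<delta>\<^sub>1" for y z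
    using \<delta>\<^sub>1(2)[of y] \<delta>\<^sub>1(2)[of z] that by (auto simp: dist_real_def)
  \<comment> \<open>Only arcs inside a ball about \<open>x\<close> matter, because arc-length
    parameters less than \<open>\<delta>\<close> apart belong to points less than
    \<open>\<delta>\<close> apart.\<close>
  have key: "\<exists>\<delta>>0. \<forall>s t. 0 \<le> s \<longrightarrow> s \<le> r \<longrightarrow> r \<le> t \<longrightarrow> t \<le> path_len p \<longrightarrow> t - s < \<delta> \<longrightarrow>
        ennreal \<bar>w (?\<sigma> t) - w (?\<sigma> s)\<bar> \<le> (\<integral>\<^sup>+ q \<in> {s..t}. H (?\<sigma> q) \<partial>lborel) + ennreal (\<epsilon> * (t - s))"
    if ex: "\<And>s t. 0 \<le> s \<Longrightarrow> s \<le> t \<Longrightarrow> t \<le> path_len p \<Longrightarrow> (\<And>q. q \<in> {s..t} \<Longrightarrow> dist (?\<sigma> q) x < \<delta>) \<Longrightarrow>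
       \<exists>f c. f \<in> borel_measurable (restrict_space borel \<Omega>) \<and> (\<forall>x. g x + f x \<le> H x) \<and> 0 \<le> c \<and>
         (\<forall>q\<in>{s..t}. ennreal c \<le> f (?\<sigma> q) + ennreal \<epsilon>) \<and>
        \<bar>w (?\<sigma> t) - w (?\<sigma> s)\<bar> \<le> \<bar>v (?\<sigma> t) - v (?\<sigma> s)\<bar> + c * (t - s)" and "\<delta> > 0" for \<delta>
  proof (intro exI[of _ \<delta>] conjI allI impI)
    fix s t assume st: "0 \<le> s" "s \<le> r" "r \<le> t" "t \<le> path_len p" "t - s < \<delta>"
    have "dist (?\<sigma> q) x < \<delta>" if "q \<in> {s..t}" for q
      using lipschitz_along_path[OF p, of q r] lipschitz_along_path[OF p, of r q] st that
      by (cases "q \<le> r") (auto simp: x_def dist_commute)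
    with ex[of s t] st obtain f c where "f \<in> borel_measurable (restrict_space borel \<Omega>)" "\<And>x. g x + f x \<le> H x" "0 \<le> c"
         "\<And>q. q\<in>{s..t} \<Longrightarrow> ennreal c \<le> f (?\<sigma> q) + ennreal \<epsilon>"
        "\<bar>w (?\<sigma> t) - w (?\<sigma> s)\<bar> \<le> \<bar>v (?\<sigma> t) - v (?\<sigma> s)\<bar> + c * (t - s)"
      by auto
    then show "ennreal \<bar>w (?\<sigma> t) - w (?\<sigma> s)\<bar> \<le> (\<integral>\<^sup>+ q \<in> {s..t}. H (?\<sigma> q) \<partial>lborel) + ennreal (\<epsilon> * (t - s))"
      using st by (intro est) auto
  qed (use that in auto)
  have lip: "\<bar>\<eta> (?\<sigma> t) - \<eta> (?\<sigma> s)\<bar> \<le> L * (t - s)"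
    if "L-lipschitz_on UNIV \<eta>" "0 \<le> s" "s \<le> t" "t \<le> path_len p" for \<eta> :: "'a \<Rightarrow> real" and L s t
  proof -
    have "\<bar>\<eta> (?\<sigma> t) - \<eta> (?\<sigma> s)\<bar> \<le> L * dist (?\<sigma> t) (?\<sigma> s)"
      using lipschitz_onD[OF that(1), of "?\<sigma> t" "?\<sigma> s"] by (simp add: dist_real_def)
    also have "\<dots> \<le> L * (t - s)"
      using lipschitz_along_path[OF p that(2-4)] lipschitz_on_nonneg[OF that(1)] by (rule mult_left_mono)
    finally show ?thesis .
  qed
  \<comment> \<open>A product rule for differences. The factor \<open>a \<le> 1\<close> leaves the
    increment of \<open>v\<close> with coefficient 1, which is why no constant is lost.\<close>
  have prod: "\<bar>a * y - b * z\<bar> \<le> \<bar>y - z\<bar> + \<bar>z\<bar> * d" if "0 \<le> a" "a \<le> 1" "\<bar>a - b\<bar> \<le> d" for a b y z d :: real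
  proof -
    have "\<bar>a * y - b * z\<bar> = \<bar>a * (y - z) + z * (a - b)\<bar>" by (simp add: algebra_simps)
    also have "\<dots> \<le> a * \<bar>y - z\<bar> + \<bar>z\<bar> * \<bar>a - b\<bar>"
      using that(1) by (metis abs_mult abs_of_nonneg abs_triangle_ineq)
    also have "\<dots> \<le> 1 * \<bar>y - z\<bar> + \<bar>z\<bar> * d"
      using that by (intro add_mono mult_right_mono mult_left_mono) auto
    finally show ?thesis by simp
  qed
  consider "x \<in> A" | "x \<notin> A" "x \<in> B" | "x \<notin> A" "x \<notin> B" by blast
  then have "\<exists>\<delta>>0. \<forall>s t. 0 \<le> s \<longrightarrow> s \<le> r \<longrightarrow> r \<le> t \<longrightarrow> t \<le> path_len p \<longrightarrow> t - s < \<delta> \<longrightarrow>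
        ennreal \<bar>w (?\<sigma> t) - w (?\<sigma> s)\<bar> \<le> (\<integral>\<^sup>+ q \<in> {s..t}. H (?\<sigma> q) \<partial>lborel) + ennreal (\<epsilon> * (t - s))"
  proof cases
    case 1
    then obtain \<delta>\<^sub>2 where \<delta>\<^sub>2: "\<delta>\<^sub>2 > 0" "ball x \<delta>\<^sub>2 \<subseteq> A"
      using A(1) by (metis open_contains_ball)
    show ?thesis
    proof (rule key[of "min \<delta>\<^sub>1 \<delta>\<^sub>2"])
      fix s t assume st: "0 \<le> s" "s \<le> t" "t \<le> path_len p"
        and near: "\<And>q. q \<in> {s..t} \<Longrightarrow> dist (?\<sigma> q) x < min \<delta>\<^sub>1 \<delta>\<^sub>2"
      have inA: "?\<sigma> q \<in> A" if "q \<in> {s..t}" for q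
        using near[OF that] \<delta>\<^sub>2(2) by (auto simp: dist_commute)
      have "\<bar>w (?\<sigma> t) - w (?\<sigma> s)\<bar> \<le> \<bar>v (?\<sigma> t) - v (?\<sigma> s)\<bar> + \<bar>v (?\<sigma> s)\<bar> * (L\<^sub>2 * (t - s))"
        using prod[OF \<psi>(2,3) lip[OF \<psi>(1) st]] A(3)[OF inA[of s]] A(3)[OF inA[of t]] st by (simp add: w_def)
      moreover have "ennreal (L\<^sub>2 * \<bar>v (?\<sigma> s)\<bar>) \<le> ennreal (L\<^sub>2 * \<bar>v (?\<sigma> q)\<bar>) * indicator A (?\<sigma> q) + ennreal \<epsilon>"
        if q: "q \<in> {s..t}" for q
      proof -
        have "\<bar>v (?\<sigma> s) - v (?\<sigma> q)\<bar> \<le> 2 * \<epsilon>'"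
          using near[of s] near[of q] st q by (intro osc inO) auto
        then have "L\<^sub>2 * \<bar>v (?\<sigma> s)\<bar> \<le> L\<^sub>2 * (\<bar>v (?\<sigma> q)\<bar> + 2 * \<epsilon>')"
          using L by (intro mult_left_mono) auto
        also have "\<dots> \<le> L\<^sub>2 * \<bar>v (?\<sigma> q)\<bar> + \<epsilon>" using L\<epsilon>[of L\<^sub>2] L by (simp add: distrib_left)
        finally show ?thesis using inA[OF q] L \<epsilon> by (simp flip: ennreal_plus)
      qed
      ultimately show "\<exists>f c. f \<in> borel_measurable (restrict_space borel \<Omega>) \<and> (\<forall>x. g x + f x \<le> H x) \<and> 0 \<le> c \<and>
         (\<forall>q\<in>{s..t}. ennreal c \<le> f (?\<sigma> q) + ennreal \<epsilon>) \<and>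
        \<bar>w (?\<sigma> t) - w (?\<sigma> s)\<bar> \<le> \<bar>v (?\<sigma> t) - v (?\<sigma> s)\<bar> + c * (t - s)"
        using fm L
        by (intro exI[of _ "\<lambda>x. ennreal (L\<^sub>2 * \<bar>v x\<bar>) * indicator A x"] exI[of _ "L\<^sub>2 * \<bar>v (?\<sigma> s)\<bar>"])
          (auto simp: H_def ac_simps intro!: add_left_mono)
    qed (use \<delta>\<^sub>1 \<delta>\<^sub>2 in auto)
  next
    case 2
    then obtain \<delta>\<^sub>2 where \<delta>\<^sub>2: "\<delta>\<^sub>2 > 0" "ball x \<delta>\<^sub>2 \<subseteq> B"
      using B(1) by (metis open_contains_ball)
    show ?thesis
    proof (rule key[of "min \<delta>\<^sub>1 \<delta>\<^sub>2"])
      fix s t assume st: "0 \<le> s" "s \<le> t" "t \<le> path_len p"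
        and near: "\<And>q. q \<in> {s..t} \<Longrightarrow> dist (?\<sigma> q) x < min \<delta>\<^sub>1 \<delta>\<^sub>2"
      have inB: "?\<sigma> q \<in> B" if "q \<in> {s..t}" for q
        using near[OF that] \<delta>\<^sub>2(2) by (auto simp: dist_commute)
      have w1: "w y = 1 - (1 - \<phi> y) * (1 - v y)" if "y \<in> B" for y
        using B(3)[OF that] by (simp add: w_def algebra_simps)
      have d: "\<bar>(1 - \<phi> (?\<sigma> t)) - (1 - \<phi> (?\<sigma> s))\<bar> \<le> L\<^sub>1 * (t - s)"
        using lip[OF \<phi>(1) st] by (simp add: abs_minus_commute)
      have "\<bar>w (?\<sigma> t) - w (?\<sigma> s)\<bar> \<le> \<bar>v (?\<sigma> t) - v (?\<sigma> s)\<bar> + \<bar>1 - v (?\<sigma> s)\<bar> * (L\<^sub>1 * (t - s))"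
        using prod[OF _ _ d, of "1 - v (?\<sigma> t)" "1 - v (?\<sigma> s)"] \<phi>(2,3)[of "?\<sigma> t"]
        unfolding w1[OF inB[of s]] using w1[OF inB[of t]] w1[OF inB[of s]] st by (simp add: abs_minus_commute)
      moreover have "ennreal (L\<^sub>1 * \<bar>1 - v (?\<sigma> s)\<bar>) \<le> ennreal (L\<^sub>1 * \<bar>1 - v (?\<sigma> q)\<bar>) * indicator B (?\<sigma> q) + ennreal \<epsilon>"
        if q: "q \<in> {s..t}" for q
      proof -
        have "\<bar>v (?\<sigma> s) - v (?\<sigma> q)\<bar> \<le> 2 * \<epsilon>'"
          using near[of s] near[of q] st q by (intro osc inO) auto
        then have "L\<^sub>1 * \<bar>1 - v (?\<sigma> s)\<bar> \<le> L\<^sub>1 * (\<bar>1 - v (?\<sigma> q)\<bar> + 2 * \<epsilon>')"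
          using L by (intro mult_left_mono) auto
        also have "\<dots> \<le> L\<^sub>1 * \<bar>1 - v (?\<sigma> q)\<bar> + \<epsilon>" using L\<epsilon>[of L\<^sub>1] L by (simp add: distrib_left)
        finally show ?thesis using inB[OF q] L \<epsilon> by (simp flip: ennreal_plus)
      qed
      ultimately show "\<exists>f c. f \<in> borel_measurable (restrict_space borel \<Omega>) \<and> (\<forall>x. g x + f x \<le> H x) \<and> 0 \<le> c \<and>
         (\<forall>q\<in>{s..t}. ennreal c \<le> f (?\<sigma> q) + ennreal \<epsilon>) \<and>
        \<bar>w (?\<sigma> t) - w (?\<sigma> s)\<bar> \<le> \<bar>v (?\<sigma> t) - v (?\<sigma> s)\<bar> + c * (t - s)"
        using fm L
        by (intro exI[of _ "\<lambda>x. ennreal (L\<^sub>1 * \<bar>1 - v x\<bar>) * indicator B x"] exI[of _ "L\<^sub>1 * \<bar>1 - v (?\<sigma> s)\<bar>"])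
          (auto simp: H_def ac_simps intro!: add_left_mono)
    qed (use \<delta>\<^sub>1 \<delta>\<^sub>2 in auto)
  next
    case 3
    obtain \<delta>\<^sub>2 where \<delta>\<^sub>2: "\<delta>\<^sub>2 > 0" "\<And>y. y \<in> ball x \<delta>\<^sub>2 \<Longrightarrow> \<psi> y = \<psi> x"
      using A(2)[OF 3(1)] by blast
    obtain \<delta>\<^sub>3 where \<delta>\<^sub>3: "\<delta>\<^sub>3 > 0" "\<And>y. y \<in> ball x \<delta>\<^sub>3 \<Longrightarrow> \<phi> y = \<phi> x"
      using B(2)[OF 3(2)] by blast
    show ?thesis
    proof (rule key[of "min \<delta>\<^sub>2 \<delta>\<^sub>3"])
      fix s t assume st: "0 \<le> s" "s \<le> t" "t \<le> path_len p"
        and near: "\<And>q. q \<in> {s..t} \<Longrightarrow> dist (?\<sigma> q) x < min \<delta>\<^sub>2 \<delta>\<^sub>3"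
      have c: "\<psi> (?\<sigma> q) = \<psi> x" "\<phi> (?\<sigma> q) = \<phi> x" if "q \<in> {s..t}" for q
        using near[OF that] by (auto simp: dist_commute intro!: \<delta>\<^sub>2(2) \<delta>\<^sub>3(2))
      define k where "k = (1 - \<phi> x) * \<psi> x"
      have k: "0 \<le> k" "k \<le> 1" using \<phi>(2,3) \<psi>(2,3) by (auto simp: k_def mult_le_one)
      have "w (?\<sigma> q) = \<phi> x + k * v (?\<sigma> q)" if "q \<in> {s..t}" for q
        using c[OF that] by (simp add: w_def k_def)
      then have "w (?\<sigma> t) - w (?\<sigma> s) = k * v (?\<sigma> t) - k * v (?\<sigma> s)" using st by auto
      then have "\<bar>w (?\<sigma> t) - w (?\<sigma> s)\<bar> \<le> \<bar>v (?\<sigma> t) - v (?\<sigma> s)\<bar> + 0 * (t - s)"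
        using prod[OF k, of k 0 "v (?\<sigma> t)" "v (?\<sigma> s)"] by simp
      then show "\<exists>f c. f \<in> borel_measurable (restrict_space borel \<Omega>) \<and> (\<forall>x. g x + f x \<le> H x) \<and> 0 \<le> c \<and>
         (\<forall>q\<in>{s..t}. ennreal c \<le> f (?\<sigma> q) + ennreal \<epsilon>) \<and>
        \<bar>w (?\<sigma> t) - w (?\<sigma> s)\<bar> \<le> \<bar>v (?\<sigma> t) - v (?\<sigma> s)\<bar> + c * (t - s)"
        by (intro exI[of _ "\<lambda>_. 0"] exI[of _ 0]) (simp add: H_def)
    qed (use \<delta>\<^sub>2 \<delta>\<^sub>3 in auto)
  qed
  then show "\<exists>\<delta>>0. \<forall>s t. 0 \<le> s \<longrightarrow> s \<le> r \<longrightarrow> r \<le> t \<longrightarrow> t \<le> path_len p \<longrightarrow> t - s < \<delta> \<longrightarrow>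
        ennreal \<bar>(\<phi> (?\<sigma> t) + (1 - \<phi> (?\<sigma> t)) * \<psi> (?\<sigma> t) * v (?\<sigma> t)) -
          (\<phi> (?\<sigma> s) + (1 - \<phi> (?\<sigma> s)) * \<psi> (?\<sigma> s) * v (?\<sigma> s))\<bar>
          \<le> (\<integral>\<^sup>+ q \<in> {s..t}. H (?\<sigma> q) \<partial>lborel) + ennreal (\<epsilon> * (t - s))"
    by (simp only: w_def)
qed

section \<open>Admissible functions from an approximating sequence\<close>

context doubling_space
begin

lemma upper_gradient_imp_weak:
  assumes "upper_gradient \<Omega> u g"
  shows "weak_upper_gradient mu \<Omega> u g"
  unfolding weak_upper_gradient_def
proof (intro conjI exI[of _ "{}"] ballI)
  have g: "g \<in> borel_measurable (restrict_space borel \<Omega>)"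
    using assms by (simp add: upper_gradient_def)
  then show "g \<in> borel_measurable (restrict_space M \<Omega>)"
    by (rule measurable_restrict_M)
  have "modulus1 mu \<Omega> {} \<le> (\<integral>\<^sup>+ x \<in> \<Omega>. 0 \<partial>M)"
    unfolding modulus1_def by (rule INF_lower) simp
  then show "modulus1 mu \<Omega> {} = 0" by simp
  show "path_integral_defined p g" "upper_gradient_ineq u g p" if "p \<in> paths_in \<Omega> - {}" for p
    using that assms path_integral_defined_borel[OF _ g] by (auto simp: upper_gradient_def)
qed simp

lemma measurable_L1_diff:
  assumes "open \<Omega>" "u \<in> borel_measurable (restrict_space M \<Omega>)" "continuous_on \<Omega> v" "S \<subseteq> \<Omega>" "S \<in> sets M"
  shows "(\<lambda>y. e2ennreal \<bar>ereal (v y) - u y\<bar> * indicator S y) \<in> borel_measurable M"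
proof -
  have [measurable]: "v \<in> borel_measurable (restrict_space M \<Omega>)"
    using assms(3) by (intro measurable_restrict_M borel_measurable_continuous_on_restrict)
  note assms(2)[measurable]
  have "(\<lambda>y. e2ennreal \<bar>ereal (v y) - u y\<bar>) \<in> borel_measurable (restrict_space M \<Omega>)"
    by measurable
  then have "(\<lambda>y. e2ennreal \<bar>ereal (v y) - u y\<bar>) \<in> borel_measurable (restrict_space M S)"
    using assms(4) by (rule measurable_restrict_mono)
  then show ?thesis
    using assms(5) by (subst (asm) borel_measurable_restrict_space_iff_ennreal) auto
qed

text \<open>Local convergence provides one ball about each point of \<open>C\<close>; finitely many
  of them cover \<open>C\<close>, and their integrals bound the one over \<open>C\<close>.\<close>

lemma converges_L1_compact:
  assumes "open \<Omega>" "u \<in> borel_measurable (restrict_space M \<Omega>)" "\<And>i. continuous_on \<Omega> (v i)"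
    and conv: "converges_L1_loc mu \<Omega> v u" and C: "compact C" "C \<subseteq> \<Omega>"
  shows "(\<lambda>i. \<integral>\<^sup>+ y \<in> C. e2ennreal \<bar>ereal (v i y) - u y\<bar> \<partial>M) \<longlonglongrightarrow> 0"
proof -
  let ?d = "\<lambda>i y. e2ennreal \<bar>ereal (v i y) - u y\<bar>"
  have "\<forall>x\<in>C. \<exists>r>0. ball x r \<subseteq> \<Omega> \<and> (\<lambda>i. \<integral>\<^sup>+ y \<in> ball x r. ?d i y \<partial>M) \<longlonglongrightarrow> 0"
    using conv C(2) unfolding converges_L1_loc_def by blast
  from bchoice[OF this] obtain r where "\<forall>x\<in>C. r x > 0 \<and> ball x (r x) \<subseteq> \<Omega> \<and>
      (\<lambda>i. \<integral>\<^sup>+ y \<in> ball x (r x). ?d i y \<partial>M) \<longlonglongrightarrow> 0" ..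
  then have r: "\<And>x. x \<in> C \<Longrightarrow> r x > 0" "\<And>x. x \<in> C \<Longrightarrow> ball x (r x) \<subseteq> \<Omega>"
    "\<And>x. x \<in> C \<Longrightarrow> (\<lambda>i. \<integral>\<^sup>+ y \<in> ball x (r x). ?d i y \<partial>M) \<longlonglongrightarrow> 0"
    by simp_all
  have "C \<subseteq> (\<Union>x\<in>C. ball x (r x))" using r(1) by force
  then obtain F where F: "F \<subseteq> C" "finite F" "C \<subseteq> (\<Union>x\<in>F. ball x (r x))"
    using compactE_image[OF C(1), of C "\<lambda>x. ball x (r x)"] by (metis open_ball)
  have "(\<integral>\<^sup>+ y \<in> C. ?d i y \<partial>M) \<le> (\<Sum>x\<in>F. \<integral>\<^sup>+ y \<in> ball x (r x). ?d i y \<partial>M)" for i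
  proof -
    have "(\<integral>\<^sup>+ y \<in> C. ?d i y \<partial>M) \<le> (\<integral>\<^sup>+ y. (\<Sum>x\<in>F. ?d i y * indicator (ball x (r x)) y) \<partial>M)"
    proof (rule nn_integral_mono)
      fix y
      show "?d i y * indicator C y \<le> (\<Sum>x\<in>F. ?d i y * indicator (ball x (r x)) y)"
      proof (cases "y \<in> C")
        case True
        then obtain x where x: "x \<in> F" "y \<in> ball x (r x)" using F by blast
        have "?d i y * indicator (ball x (r x)) y \<le> (\<Sum>x\<in>F. ?d i y * indicator (ball x (r x)) y)"
          using x F by (intro member_le_sum) auto
        then show ?thesis using x True by simp
      qed simp
    qed
    also have "\<dots> = (\<Sum>x\<in>F. \<integral>\<^sup>+ y \<in> ball x (r x). ?d i y \<partial>M)"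
      using F r(2) assms(1-3) by (intro nn_integral_sum measurable_L1_diff) auto
    finally show ?thesis .
  qed
  note le = this
  have "(\<lambda>i. \<Sum>x\<in>F. \<integral>\<^sup>+ y \<in> ball x (r x). ?d i y \<partial>M) \<longlonglongrightarrow> (\<Sum>x\<in>F. 0)"
    using F(1) r(3) by (intro tendsto_sum) auto
  then have lim: "(\<lambda>i. \<Sum>x\<in>F. \<integral>\<^sup>+ y \<in> ball x (r x). ?d i y \<partial>M) \<longlonglongrightarrow> 0"
    by simp
  show ?thesis
    by (rule tendsto_sandwich[OF _ _ tendsto_const lim]) (use le in simp_all)
qed

text \<open>A continuous function vanishing off a compact set is bounded and integrable, so
  \<open>w\<close> is admissible once \<open>H\<close> has finite integral. Otherwise the right side
  is infinite.\<close>

lemma cap_1_O_le: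
  fixes w :: "'a \<Rightarrow> real"
  assumes \<Omega>: "open \<Omega>" and w: "continuous_on \<Omega> w" "upper_gradient \<Omega> (\<lambda>x. ereal (w x)) H"
    and C: "compact C" "C \<subseteq> \<Omega>" "\<And>x. x \<in> \<Omega> \<Longrightarrow> x \<notin> C \<Longrightarrow> w x = 0"
    and W: "open W" "K \<subseteq> W" "\<And>x. x \<in> W \<Longrightarrow> w x = 1" "K \<subseteq> \<Omega>"
  shows "cap_1_O mu K \<Omega> \<le> (\<integral>\<^sup>+ x \<in> \<Omega>. H x \<partial>M)"
proof (cases "(\<integral>\<^sup>+ x \<in> \<Omega>. H x \<partial>M) < \<infinity>")
  case True
  have weak: "weak_upper_gradient mu \<Omega> (\<lambda>x. ereal (w x)) H"
    by (rule upper_gradient_imp_weak[OF w(2)])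
  have "bounded (w ` C)"
    using C w(1) by (intro compact_imp_bounded compact_continuous_image) (auto intro: continuous_on_subset)
  then obtain m where m: "\<And>x. x \<in> C \<Longrightarrow> \<bar>w x\<bar> \<le> m"
    unfolding bounded_iff by auto
  have "(\<integral>\<^sup>+ x \<in> \<Omega>. e2ennreal \<bar>ereal (w x)\<bar> \<partial>M) \<le> (\<integral>\<^sup>+ x. ennreal m * indicator C x \<partial>M)"
    using m C(3) by (intro nn_integral_mono) (auto simp: indicator_def intro!: ennreal_leI)
  also have "\<dots> = ennreal m * emeasure M C"
    using C(1) by (intro nn_integral_cmult_indicator) (auto intro: compact_imp_closed)
  also have "\<dots> < \<infinity>"
    using compact_finite_measure[OF C(1)] by (simp add: ennreal_mult_less_top)
  finally have fin: "(\<integral>\<^sup>+ x \<in> \<Omega>. e2ennreal \<bar>ereal (w x)\<bar> \<partial>M) < \<infinity>" .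
  have "(\<lambda>x. ereal (w x)) \<in> borel_measurable (restrict_space M \<Omega>)"
    using borel_measurable_continuous_on_restrict[OF w(1)] by (intro borel_measurable_ereal measurable_restrict_M)
  then have L1: "(\<lambda>x. ereal (w x)) \<in> L1 mu \<Omega>"
    using fin by (simp add: L1_def)
  have "N11_norm mu \<Omega> (\<lambda>x. ereal (w x)) \<le> (\<integral>\<^sup>+ x \<in> \<Omega>. e2ennreal \<bar>ereal (w x)\<bar> \<partial>M) + (\<integral>\<^sup>+ x \<in> \<Omega>. H x \<partial>M)"
    unfolding N11_norm_def using weak by (intro add_left_mono INF_lower) auto
  also have "\<dots> < \<infinity>" using fin True by simp
  finally have N: "(\<lambda>x. ereal (w x)) \<in> N11 mu \<Omega>"
    using L1 by (simp add: N11_def)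
  have sub: "supt \<Omega> (\<lambda>x. ereal (w x)) \<subseteq> C"
    unfolding supt_def using C compact_imp_closed[OF C(1)] by (intro closure_minimal) auto
  then have "compact (supt \<Omega> (\<lambda>x. ereal (w x)))"
    using compact_Int_closed[OF C(1), of "supt \<Omega> (\<lambda>x. ereal (w x))"] by (simp add: supt_def inf.absorb2)
  moreover have "one_near K \<Omega> (\<lambda>x. ereal (w x))"
    unfolding one_near_def using W \<Omega> by (intro exI[of _ "W \<inter> \<Omega>"]) auto
  ultimately show ?thesis
    unfolding cap_1_O_def using N weak sub C(2)
    by (intro INF_lower2[of "(\<lambda>x. ereal (w x), H)"]) auto
qed (simp add: less_top[symmetric])

lemma ennreal_le_liminf:
  fixes X D :: "nat \<Rightarrow> ennreal"
  assumes "\<And>i. c \<le> X i + D i" "D \<longlonglongrightarrow> 0"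
  shows "c \<le> liminf X"
proof (rule ennreal_le_epsilon)
  fix e :: real assume "0 < e"
  then have "eventually (\<lambda>i. D i < ennreal e) sequentially"
    using assms(2) by (intro order_tendstoD) auto
  then have "eventually (\<lambda>i. c - ennreal e \<le> X i) sequentially"
  proof (rule eventually_mono)
    fix i assume "D i < ennreal e"
    then have "c \<le> X i + ennreal e"
      using assms(1)[of i] by (meson add_left_mono less_imp_le order_trans)
    then show "c - ennreal e \<le> X i"
      by (simp add: ennreal_minus_le_iff add.commute)
  qed
  then have "c - ennreal e \<le> liminf X" by (rule Liminf_bounded)
  then show "c \<le> liminf X + ennreal e"
    by (simp add: ennreal_minus_le_iff add.commute)
qed

lemma cap_1_O_le_cap_BV_O:
  assumes \<Omega>: "open \<Omega>" and K: "compact K" "K \<subseteq> \<Omega>"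
  shows "cap_1_O mu K \<Omega> \<le> cap_BV_O mu K \<Omega>"
  unfolding cap_BV_O_def
proof (rule INF_greatest)
  fix u assume "u \<in> {u \<in> BV mu \<Omega>. (\<forall>x\<in>\<Omega>. 0 \<le> u x \<and> u x \<le> 1) \<and>
                            compact (supt \<Omega> u) \<and> supt \<Omega> u \<subseteq> \<Omega> \<and> one_near K \<Omega> u}"
  then have um: "u \<in> borel_measurable (restrict_space M \<Omega>)"
    and S: "compact (supt \<Omega> u)" "supt \<Omega> u \<subseteq> \<Omega>" and "one_near K \<Omega> u"
    by (auto simp: BV_def L1_def)
  then obtain V where V: "open V" "K \<subseteq> V" "V \<subseteq> \<Omega>" "\<And>x. x \<in> V \<Longrightarrow> u x = 1"
    unfolding one_near_def by blast
  \<comment> \<open>This couples the two cutoffs: \<open>B\<close> lies in \<open>V\<close> and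
    hence in the support of \<open>u\<close>, where \<open>\<psi> = 1\<close>, while
    \<open>A\<close> avoids the support and hence \<open>V\<close>, so \<open>\<phi> = 0\<close>
    there.\<close>
  have VS: "V \<subseteq> supt \<Omega> u"
  proof
    fix x assume "x \<in> V"
    then have "x \<in> {x \<in> \<Omega>. u x \<noteq> 0}" using V by auto
    then show "x \<in> supt \<Omega> u" unfolding supt_def by (rule subsetD[OF closure_subset])
  qed
  have off: "u x = 0" if "x \<in> \<Omega>" "x \<notin> supt \<Omega> u" for x
    using that closure_subset[of "{x \<in> \<Omega>. u x \<noteq> 0}"] by (auto simp: supt_def)
  obtain L\<^sub>2 \<psi> W\<^sub>2 C\<^sub>2 A where "cutoff_function (supt \<Omega> u) \<Omega> L\<^sub>2 \<psi> W\<^sub>2 C\<^sub>2 A"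
    using cutoff_exists[OF S(1) \<Omega> S(2)] .
  note \<psi> = cutoff_functionD[OF this]
  obtain L\<^sub>1 \<phi> W\<^sub>1 C\<^sub>1 B where "cutoff_function K V L\<^sub>1 \<phi> W\<^sub>1 C\<^sub>1 B"
    using cutoff_exists[OF K(1) V(1,2)] .
  note \<phi> = cutoff_functionD[OF this]
  have L: "0 \<le> L\<^sub>1" "0 \<le> L\<^sub>2" using \<phi>(1) \<psi>(1) by (auto dest: lipschitz_on_nonneg)
  define C where "C = C\<^sub>1 \<union> C\<^sub>2"
  have C: "compact C" "C \<subseteq> \<Omega>" using \<phi>(7,8) \<psi>(7,8) V(3) by (auto simp: C_def)
  show "cap_1_O mu K \<Omega> \<le> total_variation mu \<Omega> u"
    unfolding total_variation_def
  proof (rule INF_greatest, clarify)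
    fix v :: "nat \<Rightarrow> 'a \<Rightarrow> real" and g :: "nat \<Rightarrow> 'a \<Rightarrow> ennreal"
    assume v: "\<forall>i. locally_lipschitz_on \<Omega> (v i)" "converges_L1_loc mu \<Omega> v u"
      "\<forall>i. upper_gradient \<Omega> (\<lambda>x. ereal (v i x)) (g i)"
    have cont: "continuous_on \<Omega> (v i)" for i
      using v(1) locally_lipschitz_on_continuous_on by blast
    define D where "D i = (\<integral>\<^sup>+ y \<in> C. e2ennreal \<bar>ereal (v i y) - u y\<bar> \<partial>M)" for i
    have D0: "D \<longlonglongrightarrow> 0"
      unfolding D_def by (rule converges_L1_compact[OF \<Omega> um cont v(2) C])
    have "cap_1_O mu K \<Omega> \<le> (\<integral>\<^sup>+ x \<in> \<Omega>. g i x \<partial>M) + ennreal (L\<^sub>1 + L\<^sub>2) * D i" for i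
    proof -
      define w where "w x = \<phi> x + (1 - \<phi> x) * \<psi> x * v i x" for x
      define H where "H x = g i x + (ennreal (L\<^sub>2 * \<bar>v i x\<bar>) * indicator A x + ennreal (L\<^sub>1 * \<bar>1 - v i x\<bar>) * indicator B x)" for x
      have B\<psi>: "\<psi> x = 1" if "x \<in> B" for x
        using that \<phi>(8,11) VS \<psi>(5,6) by blast
      have A\<phi>: "\<phi> x = 0" if "x \<in> A" for x
        using that \<phi>(8,9) VS \<psi>(12) by blast
      have ug: "upper_gradient \<Omega> (\<lambda>x. ereal (w x)) H"
        unfolding w_def H_def
        using upper_gradient_cutoff[OF \<Omega> cont _ \<phi>(1-3) \<psi>(1-3,10,13) A\<phi> \<phi>(10,13) B\<psi>, of i "g i"] v(3) by simp
      have "continuous_on \<Omega> \<phi>" "continuous_on \<Omega> \<psi>"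
        using \<phi>(1) \<psi>(1) by (meson continuous_on_subset lipschitz_on_continuous_on subset_UNIV)+
      then have "continuous_on \<Omega> w"
        unfolding w_def by (intro continuous_intros cont)
      then have "cap_1_O mu K \<Omega> \<le> (\<integral>\<^sup>+ x \<in> \<Omega>. H x \<partial>M)"
        by (rule cap_1_O_le[OF \<Omega> _ ug C _ \<phi>(4,5) _ K(2)]) (auto simp: w_def \<phi>(6) C_def \<phi>(9) \<psi>(9))
      also have "\<dots> \<le> (\<integral>\<^sup>+ x. g i x * indicator \<Omega> x + ennreal (L\<^sub>1 + L\<^sub>2) * (e2ennreal \<bar>ereal (v i x) - u x\<bar> * indicator C x) \<partial>M)"
      proof (rule nn_integral_mono)
        fix x
        \<comment> \<open>\<open>A\<close> and \<open>B\<close> are disjoint, so at most one error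
          term is present at \<open>x\<close>. As \<open>u\<close> is 0 on \<open>A\<close> and 1 on
          \<open>B\<close>, either term is a constant times the distance of the approximant to
          \<open>u\<close>.\<close>
        consider "x \<in> A" | "x \<in> B" | "x \<notin> A" "x \<notin> B" by blast
        then have "ennreal (L\<^sub>2 * \<bar>v i x\<bar>) * indicator A x + ennreal (L\<^sub>1 * \<bar>1 - v i x\<bar>) * indicator B x
          \<le> ennreal (L\<^sub>1 + L\<^sub>2) * (e2ennreal \<bar>ereal (v i x) - u x\<bar> * indicator C x)"
        proof cases
          case 1
          then have "x \<notin> supt \<Omega> u" "x \<in> \<Omega>" "x \<in> C"
            using \<psi>(8,11,12) by (auto simp: C_def)
          then have "x \<notin> B" "x \<in> C" "u x = 0"
            using \<phi>(8,11) VS off[of x] by auto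
          then show ?thesis
            using 1 L by (auto simp: zero_ereal_def simp del: ennreal_plus simp flip: ennreal_mult intro!: ennreal_leI mult_right_mono)
        next
          case 2
          then have "x \<notin> A" "x \<in> C" "u x = 1"
            using \<phi>(8,11) \<psi>(12) VS V(4) by (auto simp: C_def)
          then show ?thesis
            using 2 L by (auto simp: one_ereal_def abs_minus_commute simp del: ennreal_plus simp flip: ennreal_mult intro!: ennreal_leI mult_right_mono)
        qed simp
        then show "H x * indicator \<Omega> x \<le> g i x * indicator \<Omega> x + ennreal (L\<^sub>1 + L\<^sub>2) * (e2ennreal \<bar>ereal (v i x) - u x\<bar> * indicator C x)"
          by (auto simp: H_def indicator_def[of \<Omega>] intro!: add_left_mono)
      qed
      also have "\<dots> = (\<integral>\<^sup>+ x \<in> \<Omega>. g i x \<partial>M) + ennreal (L\<^sub>1 + L\<^sub>2) * D i"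
      proof -
        have m1: "(\<lambda>x. g i x * indicator \<Omega> x) \<in> borel_measurable M"
        proof -
          have "g i \<in> borel_measurable (restrict_space M \<Omega>)"
            using v(3) by (auto simp: upper_gradient_def intro: measurable_restrict_M)
          then show ?thesis using \<Omega> by (subst (asm) borel_measurable_restrict_space_iff_ennreal) auto
        qed
        have m2: "(\<lambda>x. e2ennreal \<bar>ereal (v i x) - u x\<bar> * indicator C x) \<in> borel_measurable M"
          using C by (intro measurable_L1_diff[OF \<Omega> um cont]) (auto intro: compact_imp_closed)
        show ?thesis
          unfolding D_def using m1 m2
          by (subst nn_integral_add) (auto simp: nn_integral_cmult)
      qed
      finally show ?thesis .
    qed
    moreover have "(\<lambda>i. ennreal (L\<^sub>1 + L\<^sub>2) * D i) \<longlonglongrightarrow> 0"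
      using ennreal_tendsto_cmult[OF _ D0, of "ennreal (L\<^sub>1 + L\<^sub>2)"] by simp
    ultimately show "cap_1_O mu K \<Omega> \<le> liminf (\<lambda>i. \<integral>\<^sup>+ x \<in> \<Omega>. g i x \<partial>M)"
      by (rule ennreal_le_liminf)
  qed
qed

end

section \<open>Semicontinuous approximation\<close>

text \<open>The sum counts the levels \<open>j * \<eta>\<close> below \<open>y\<close>, so it rounds
  \<open>y\<close> up to a multiple of \<open>\<eta>\<close>. Applied to \<open>f x\<close> it
  writes a function, up to \<open>\<eta>\<close>, as a sum of indicators of superlevel sets, which
  can be enlarged to open sets.\<close>

lemma staircase_ennreal:
  fixes y :: ennreal
  assumes "0 < \<eta>"
  shows "y \<le> (\<Sum>j. if ennreal (real j * \<eta>) < y then ennreal \<eta> else 0)" (is "_ \<le> ?S")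
    and "(\<Sum>j. if ennreal (real j * \<eta>) < y then ennreal \<eta> else 0) \<le> y + ennreal \<eta>"
proof -
  have "y \<le> ?S \<and> ?S \<le> y + ennreal \<eta>"
  proof (cases y)
    case (real r)
    define N where "N = nat \<lceil>r / \<eta>\<rceil>"
    have r: "0 \<le> r / \<eta>" using real assms by simp
    have iff: "ennreal (real j * \<eta>) < y \<longleftrightarrow> j < N" for j
    proof -
      have "ennreal (real j * \<eta>) < y \<longleftrightarrow> real j < r / \<eta>"
        using real assms by (simp add: ennreal_less_iff pos_less_divide_eq)
      also have "\<dots> \<longleftrightarrow> j < N" unfolding N_def by linarith
      finally show ?thesis .
    qed
    have "?S = (\<Sum>j<N. ennreal \<eta>)"
      by (subst suminf_finite[of "{..<N}"]) (auto simp: iff)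
    also have "\<dots> = ennreal (real N * \<eta>)"
      using assms by (simp add: ennreal_mult ennreal_of_nat_eq_real_of_nat)
    finally have S: "?S = ennreal (real N * \<eta>)" .
    have "r / \<eta> \<le> real N" "real N \<le> r / \<eta> + 1" using r unfolding N_def by linarith+
    then have "r \<le> real N * \<eta>" "real N * \<eta> \<le> r + \<eta>"
      using assms by (auto simp: field_simps)
    then show ?thesis
      using real assms unfolding S by (auto simp flip: ennreal_plus intro!: ennreal_leI)
  next
    case top
    have "ennreal (real n * \<eta>) \<le> ?S" for n
    proof -
      have "ennreal (real n * \<eta>) = (\<Sum>j<n. if ennreal (real j * \<eta>) < y then ennreal \<eta> else 0)"
      proof -
        have "ennreal (real j * \<eta>) < y" for j using top by simp
        then show ?thesis using assms by (simp add: ennreal_mult ennreal_of_nat_eq_real_of_nat)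
      qed
      also have "\<dots> \<le> ?S" by (intro sum_le_suminf) auto
      finally show ?thesis .
    qed
    note le = this
    have "?S = top"
    proof (cases "?S")
      case (real r)
      obtain n where "r / \<eta> < real n" using reals_Archimedean2 by blast
      then have "r < real n * \<eta>" using assms by (simp add: pos_divide_less_eq)
      moreover have "real n * \<eta> \<le> r" using le[of n] real by (simp add: ennreal_le_iff)
      ultimately show ?thesis by simp
    qed
    then show ?thesis by (simp add: top)
  qed
  then show "y \<le> ?S" "?S \<le> y + ennreal \<eta>" by auto
qed

section \<open>Semicontinuity from outer regularity\<close>

context doubling_space
begin

lemma open_outer_diff:
  assumes A: "A \<in> sets M" "A \<subseteq> N" and N: "open N" "emeasure M N < \<infinity>" and e: "0 < (e::real)"
  obtains U where "open U" "A \<subseteq> U" "U \<subseteq> N" "emeasure M (U - A) \<le> ennreal e"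
proof -
  obtain U where U: "open U" "A \<subseteq> U" "U \<subseteq> N" "emeasure M U \<le> emeasure M A + ennreal e"
    using open_outer[OF assms] .
  have fin: "emeasure M A < \<infinity>"
    using emeasure_mono[OF A(2), of M] N by (auto intro: le_less_trans)
  have "emeasure M (U - A) = emeasure M U - emeasure M A"
    using A U fin by (intro emeasure_Diff) auto
  also have "\<dots> \<le> ennreal e"
    using U(4) fin by (auto simp: ennreal_minus_le_iff)
  finally show ?thesis using that U by blast
qed

text \<open>A form of the Vitali-Caratheodory theorem: the superlevel sets of \<open>f\<close> in
  \<open>D\<close> at multiples of \<open>\<eta>\<close> are enlarged to open sets. The term with
  \<open>emeasure M D\<close> is the rounding error, the last \<open>\<eta>\<close> the total cost
  of the enlargements. Indicators of open sets are lower semicontinuous, hence so is the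
  sum.\<close>

lemma lower_semicontinuous_majorant:
  assumes \<Omega>: "open \<Omega>" and D: "compact D" "D \<subseteq> \<Omega>" and f: "f \<in> borel_measurable (restrict_space M \<Omega>)"
    and \<eta>: "0 < (\<eta>::real)"
  obtains U :: "nat \<Rightarrow> 'a set" where "\<And>j. open (U j)"
    "\<And>x. x \<in> D \<Longrightarrow> f x \<le> (\<Sum>j. ennreal \<eta> * indicator (U j) x)"
    "(\<integral>\<^sup>+ x. (\<Sum>j. ennreal \<eta> * indicator (U j) x) \<partial>M) \<le> (\<integral>\<^sup>+ x \<in> \<Omega>. f x \<partial>M) + ennreal \<eta> * emeasure M D + ennreal \<eta>"
proof -
  obtain N where N: "open N" "D \<subseteq> N" "compact (closure N)" "closure N \<subseteq> \<Omega>"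
    using compact_nbhd[OF D(1) \<Omega> D(2)] .
  have Nfin: "emeasure M N < \<infinity>"
    using N(1,3) by (intro bounded_finite_measure) (auto intro: bounded_subset[OF compact_imp_bounded closure_subset])
  have Dm: "D \<in> sets M" using D(1) by (auto intro: compact_imp_closed)
  have fD: "f \<in> borel_measurable (restrict_space M D)"
    using f D(2) by (rule measurable_restrict_mono)
  define A where "A j = {x \<in> D. ennreal (real j * \<eta>) < f x}" for j
  have A: "A j \<in> sets M" for j
  proof -
    have "{x \<in> space (restrict_space M D). ennreal (real j * \<eta>) < f x} \<in> sets (restrict_space M D)"
      using fD by (rule borel_measurable_less[OF measurable_const, simplified])
    then show ?thesis
      using Dm by (simp add: A_def space_restrict_space sets_restrict_space_iff)
  qed
  have "\<exists>U. open U \<and> A j \<subseteq> U \<and> emeasure M U \<le> emeasure M (A j) + ennreal ((1 / 2) ^ Suc j)" for j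
  proof -
    have "A j \<subseteq> N" using N(2) by (auto simp: A_def)
    then obtain U where "open U" "A j \<subseteq> U" "U \<subseteq> N" "emeasure M U \<le> emeasure M (A j) + ennreal ((1 / 2) ^ Suc j)"
      using open_outer[OF A _ N(1) Nfin, of j "(1 / 2) ^ Suc j"] by auto
    then show ?thesis by blast
  qed
  then obtain U where U: "\<And>j. open (U j)" "\<And>j. A j \<subseteq> U j"
      "\<And>j. emeasure M (U j) \<le> emeasure M (A j) + ennreal ((1 / 2) ^ Suc j)"
    by metis
  show ?thesis
  proof (rule that[of U])
    fix x assume x: "x \<in> D"
    have "f x \<le> (\<Sum>j. if ennreal (real j * \<eta>) < f x then ennreal \<eta> else 0)"
      by (rule staircase_ennreal[OF \<eta>])
    also have "\<dots> \<le> (\<Sum>j. ennreal \<eta> * indicator (U j) x)"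
    proof (intro suminf_le)
      fix j
      show "(if ennreal (real j * \<eta>) < f x then ennreal \<eta> else 0) \<le> ennreal \<eta> * indicator (U j) x"
        using U(2)[of j] x by (auto simp: A_def indicator_def)
    qed auto
    finally show "f x \<le> (\<Sum>j. ennreal \<eta> * indicator (U j) x)" .
  next
    have "(\<integral>\<^sup>+ x. (\<Sum>j. ennreal \<eta> * indicator (U j) x) \<partial>M) = (\<Sum>j. ennreal \<eta> * emeasure M (U j))"
      using open_sets_M[OF U(1)]
      by (subst nn_integral_suminf) (auto simp: nn_integral_cmult_indicator intro!: borel_measurable_times_ennreal)
    also have "\<dots> \<le> (\<Sum>j. ennreal \<eta> * emeasure M (A j) + ennreal \<eta> * ennreal ((1 / 2) ^ Suc j))"
      unfolding distrib_left[symmetric] by (intro suminf_le mult_left_mono U(3)) auto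
    also have "\<dots> = (\<Sum>j. ennreal \<eta> * emeasure M (A j)) + (\<Sum>j. ennreal \<eta> * ennreal ((1 / 2) ^ Suc j))"
      by (intro suminf_add[symmetric]) auto
    also have "(\<Sum>j. ennreal \<eta> * ennreal ((1 / 2) ^ Suc j)) = ennreal \<eta>"
    proof -
      have "(\<Sum>j. ennreal ((1 / 2) ^ Suc j)) = ennreal 1"
        using power_half_series by (intro suminf_ennreal_eq) auto
      then show ?thesis by (subst ennreal_suminf_cmult) simp
    qed
    also have "(\<Sum>j. ennreal \<eta> * emeasure M (A j)) = (\<integral>\<^sup>+ x. (\<Sum>j. ennreal \<eta> * indicator (A j) x) \<partial>M)"
      using A by (subst nn_integral_suminf)
        (auto simp: nn_integral_cmult_indicator intro!: borel_measurable_times_ennreal)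
    also have "\<dots> \<le> (\<integral>\<^sup>+ x. f x * indicator D x + ennreal \<eta> * indicator D x \<partial>M)"
    proof (rule nn_integral_mono)
      fix x
      show "(\<Sum>j. ennreal \<eta> * indicator (A j) x) \<le> f x * indicator D x + ennreal \<eta> * indicator D x"
      proof (cases "x \<in> D")
        case True
        then have "(\<Sum>j. ennreal \<eta> * indicator (A j) x) = (\<Sum>j. if ennreal (real j * \<eta>) < f x then ennreal \<eta> else 0)"
          by (intro suminf_cong) (auto simp: A_def indicator_def)
        then show ?thesis using staircase_ennreal(2)[OF \<eta>, of "f x"] True by simp
      qed (simp add: A_def)
    qed
    also have "\<dots> = (\<integral>\<^sup>+ x \<in> D. f x \<partial>M) + ennreal \<eta> * emeasure M D"
      using fD Dm by (subst nn_integral_add)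
        (auto simp: borel_measurable_restrict_space_iff_ennreal nn_integral_cmult_indicator)
    also have "(\<integral>\<^sup>+ x \<in> D. f x \<partial>M) \<le> (\<integral>\<^sup>+ x \<in> \<Omega>. f x \<partial>M)"
      using D(2) by (intro nn_integral_mono) (auto simp: indicator_def)
    finally show "(\<integral>\<^sup>+ x. (\<Sum>j. ennreal \<eta> * indicator (U j) x) \<partial>M) \<le> (\<integral>\<^sup>+ x \<in> \<Omega>. f x \<partial>M) + ennreal \<eta> * emeasure M D + ennreal \<eta>"
      by (simp add: add_right_mono)
  qed (rule U)
qed

text \<open>One-sided Lusin theorem. Each superlevel set at a rational level is squeezed between a
  closed \<open>F k\<close> and an open \<open>U k\<close>; once all \<open>U k - F k\<close> are
  removed, it agrees on \<open>E\<close> with the open set \<open>U k\<close>. The removed set is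
  open, so \<open>E\<close> is closed.\<close>

lemma lusin_lower_semicontinuous:
  fixes u :: "'a \<Rightarrow> real"
  assumes S: "compact S" "S \<subseteq> N" and N: "open N" "emeasure M N < \<infinity>"
    and u: "u \<in> borel_measurable M" "\<And>x. 0 \<le> u x" "\<And>x. x \<notin> S \<Longrightarrow> u x = 0" and e: "0 < (e::real)"
  obtains E where "closed E" "- N \<subseteq> E" "emeasure M (- E) \<le> ennreal e"
    "\<And>y c. y \<in> E \<Longrightarrow> c < u y \<Longrightarrow> \<exists>V. open V \<and> y \<in> V \<and> (\<forall>z\<in>V \<inter> E. c < u z)"
proof -
  define q where "q k = real_of_rat (from_nat k)" for k :: nat
  \<comment> \<open>Truncating the level at 0 keeps the superlevel sets inside \<open>S\<close>. For
    negative \<open>c\<close> the final claim follows from \<open>u\<close> being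
    nonnegative.\<close>
  define A where "A k = {x. max 0 (q k) < u x}" for k
  \<comment> \<open>Each index spends this amount twice, for the outer and for the inner
    approximation; the total over all indices is \<open>e\<close>.\<close>
  define d where "d k = e / 2 * (1 / 2) ^ Suc k" for k :: nat
  have d: "0 < d k" for k using e by (simp add: d_def)
  have A: "A k \<in> sets M" for k
  proof -
    have "{x \<in> space M. max 0 (q k) < u x} \<in> sets M" using u(1) by measurable
    then show ?thesis by (simp add: A_def)
  qed
  have AS: "A k \<subseteq> S" for k using u(3) by (force simp: A_def)
  have "\<exists>U F. open U \<and> U \<subseteq> N \<and> closed F \<and> F \<subseteq> A k \<and> A k \<subseteq> U \<and> emeasure M (U - F) \<le> ennreal (d k) + ennreal (d k)" for k
  proof -
    obtain U where U: "open U" "A k \<subseteq> U" "U \<subseteq> N" "emeasure M (U - A k) \<le> ennreal (d k)"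
      using open_outer_diff[OF A _ N d] AS S(2) by (metis order_trans)
    \<comment> \<open>An open set around the complement of \<open>A k\<close> in \<open>N\<close>
      yields the closed subset \<open>S - W\<close> of \<open>A k\<close>.\<close>
    obtain W where W: "open W" "N - A k \<subseteq> W" "W \<subseteq> N" "emeasure M (W - (N - A k)) \<le> ennreal (d k)"
      using open_outer_diff[of "N - A k", OF _ _ N d] A N(1) by (metis Diff_subset open_sets_M sets.Diff)
    have cl: "closed (S - W)" using S(1) W(1) by (auto intro: closed_Diff compact_imp_closed)
    have "emeasure M (U - (S - W)) \<le> emeasure M ((U - A k) \<union> (W - (N - A k)))"
      using AS[of k] U(2,3) W(2,3) S(2) open_sets_M[OF U(1)] open_sets_M[OF W(1)] open_sets_M[OF N(1)] A[of k]
      by (intro emeasure_mono sets.Un sets.Diff) auto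
    also have "\<dots> \<le> emeasure M (U - A k) + emeasure M (W - (N - A k))"
      using open_sets_M[OF U(1)] open_sets_M[OF W(1)] open_sets_M[OF N(1)] A[of k]
      by (intro emeasure_subadditive sets.Diff)
    also have "\<dots> \<le> ennreal (d k) + ennreal (d k)" using U W by (intro add_mono)
    finally have "emeasure M (U - (S - W)) \<le> ennreal (d k) + ennreal (d k)" .
    moreover have "S - W \<subseteq> A k" using W(2) S(2) by blast
    ultimately show ?thesis using U cl by blast
  qed
  then obtain U F where UF: "\<And>k. open (U k)" "\<And>k. U k \<subseteq> N" "\<And>k. closed (F k)" "\<And>k. F k \<subseteq> A k"
    "\<And>k. A k \<subseteq> U k" "\<And>k. emeasure M (U k - F k) \<le> ennreal (d k) + ennreal (d k)"
    by metis
  define E where "E = - (\<Union>k. U k - F k)"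
  show ?thesis
  proof (rule that[of E])
    show "closed E"
      unfolding E_def closed_def double_complement by (intro open_UN ballI open_Diff UF(1,3))
    show "- N \<subseteq> E" using UF(2) by (auto simp: E_def)
    have "emeasure M (- E) \<le> (\<Sum>k. emeasure M (U k - F k))"
      unfolding E_def double_complement using UF(1,3) by (intro emeasure_subadditive_countably) auto
    also have "\<dots> \<le> (\<Sum>k. ennreal (e * (1 / 2) ^ Suc k))"
    proof (intro suminf_le)
      fix k
      show "emeasure M (U k - F k) \<le> ennreal (e * (1 / 2) ^ Suc k)"
        using UF(6)[of k] e by (simp add: d_def flip: ennreal_plus)
    qed auto
    also have "\<dots> = ennreal e"
      using e sums_mult[OF power_half_series, of e] by (intro suminf_ennreal_eq) auto
    finally show "emeasure M (- E) \<le> ennreal e" .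
    fix y c assume y: "y \<in> E" "c < u y"
    show "\<exists>V. open V \<and> y \<in> V \<and> (\<forall>z\<in>V \<inter> E. c < u z)"
    proof (cases "c < 0")
      case True
      have "c < u z" for z using True u(2)[of z] by linarith
      then show ?thesis by (intro exI[of _ UNIV]) simp
    next
      case False
      obtain p where p: "c < real_of_rat p" "real_of_rat p < u y"
        using of_rat_dense[OF y(2)] by blast
      define k where "k = to_nat p"
      have qk: "q k = real_of_rat p" by (simp add: q_def k_def)
      have "y \<in> A k" using p False by (simp add: A_def qk)
      then have yU: "y \<in> U k" using UF(5) by blast
      have "c < u z" if "z \<in> U k \<inter> E" for z
      proof -
        have "z \<in> F k" using that by (auto simp: E_def)
        then have "z \<in> A k" using UF(4) by blast
        then show ?thesis using p by (simp add: A_def qk)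
      qed
      then show ?thesis using UF(1) yU by blast
    qed
  qed
qed

end

section \<open>Discrete chains\<close>

text \<open>Only the endpoint and the cost of a chain are recorded. A step is charged at its point
  of arrival, so that the cost equals the integral of the weight over a step function that waits at
  the arrival point.\<close>

inductive chain_cost :: "('a::metric_space \<Rightarrow> real) \<Rightarrow> ('a \<Rightarrow> real) \<Rightarrow> real \<Rightarrow> 'a \<Rightarrow> real \<Rightarrow> bool"
  for b G h where
    base: "chain_cost b G h y (b y)"
  | step: "chain_cost b G h x c \<Longrightarrow> dist x y \<le> h \<Longrightarrow> chain_cost b G h y (c + G y * dist x y)"

definition chain_value :: "('a::metric_space \<Rightarrow> real) \<Rightarrow> ('a \<Rightarrow> real) \<Rightarrow> real \<Rightarrow> 'a \<Rightarrow> real" where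
  "chain_value b G h x = Inf {c. chain_cost b G h x c}"

section \<open>Bounds, Lipschitz continuity and upper gradients of chain values\<close>

lemma chain_cost_nonneg:
  assumes "chain_cost b G h x c" "\<And>x. 0 \<le> b x" "\<And>x. 0 \<le> G x"
  shows "0 \<le> c"
  using assms(1) by induction (auto simp: assms(2,3))

lemma chain_value_le_cost:
  assumes "\<And>x. 0 \<le> b x" "\<And>x. 0 \<le> G x" "chain_cost b G h x c"
  shows "chain_value b G h x \<le> c"
  unfolding chain_value_def using assms chain_cost_nonneg[OF _ assms(1,2)]
  by (intro cInf_lower bdd_belowI[of _ 0]) auto

lemma chain_value_bounds:
  assumes "\<And>x. 0 \<le> b x" "\<And>x. 0 \<le> G x"
  shows "0 \<le> chain_value b G h x" "chain_value b G h x \<le> b x"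
proof -
  show "0 \<le> chain_value b G h x"
    unfolding chain_value_def using chain_cost_nonneg[OF _ assms] chain_cost.base[of b G h x]
    by (intro cInf_greatest) auto
  show "chain_value b G h x \<le> b x"
    by (rule chain_value_le_cost[OF assms chain_cost.base])
qed

text \<open>A chain to \<open>x\<close> extends by one step to \<open>y\<close>. Used in both
  directions, this gives the local Lipschitz bound as well as the upper gradient.\<close>

lemma chain_value_step:
  assumes "\<And>x. 0 \<le> b x" "\<And>x. 0 \<le> G x" "dist x y \<le> h"
  shows "chain_value b G h y \<le> chain_value b G h x + G y * dist x y"
proof -
  have "chain_value b G h y - G y * dist x y \<le> chain_value b G h x"
    unfolding chain_value_def[of b G h x]
  proof (rule cInf_greatest)
    show "{c. chain_cost b G h x c} \<noteq> {}" using chain_cost.base[of b G h x] by auto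
    fix c assume "c \<in> {c. chain_cost b G h x c}"
    then have "chain_cost b G h y (c + G y * dist x y)"
      using assms(3) by (auto intro: chain_cost.step)
    then show "chain_value b G h y - G y * dist x y \<le> c"
      using chain_value_le_cost[OF assms(1,2)] by (simp add: algebra_simps)
  qed
  then show ?thesis by simp
qed

lemma chain_value_less_obtain:
  assumes "chain_value b G h x < d"
  obtains c where "chain_cost b G h x c" "c < d"
  using cInf_lessD[OF _ assms[unfolded chain_value_def]] chain_cost.base[of b G h x] by auto

text \<open>The ends of an arc shorter than \<open>h\<close> are one step apart, so the value
  changes by at most the weight at an end times the distance; continuity of \<open>G\<close>
  compares this with the integral along the arc.\<close>

lemma upper_gradient_chain_value:
  fixes G :: "'a::metric_space \<Rightarrow> real"
  assumes b: "\<And>x. 0 \<le> b x" and G: "\<And>x. 0 \<le> G x" "continuous_on UNIV G" and h: "0 < h"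
  shows "upper_gradient \<Omega> (\<lambda>x. ereal (chain_value b G h x)) (\<lambda>x. ennreal (G x))"
proof (rule upper_gradient_localI)
  let ?v = "chain_value b G h"
  show Gm: "(\<lambda>x. ennreal (G x)) \<in> borel_measurable (restrict_space borel \<Omega>)"
    using borel_measurable_continuous_onI[OF G(2)] by (intro measurable_restrict_space1) simp
  fix p and \<epsilon> r :: real
  assume p: "p \<in> paths_in \<Omega>" and \<epsilon>: "0 < \<epsilon>" and r: "r \<in> {0..path_len p}"
  let ?\<sigma> = "arc_length_param p"
  define x where "x = ?\<sigma> r"
  have "isCont G x" using G(2) by (simp add: continuous_on_eq_continuous_at)
  then obtain \<delta>\<^sub>1 where \<delta>\<^sub>1: "\<delta>\<^sub>1 > 0" "\<And>y. dist y x < \<delta>\<^sub>1 \<Longrightarrow> dist (G y) (G x) < \<epsilon> / 2"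
    using \<epsilon> unfolding continuous_at_eps_delta by (metis half_gt_zero)
  have est: "ennreal \<bar>?v (?\<sigma> t) - ?v (?\<sigma> s)\<bar> \<le> (\<integral>\<^sup>+ q \<in> {s..t}. ennreal (G (?\<sigma> q)) \<partial>lborel) + ennreal (\<epsilon> * (t - s))"
    if st: "0 \<le> s" "s \<le> r" "r \<le> t" "t \<le> path_len p" "t - s < min \<delta>\<^sub>1 h" for s t
  proof -
    have near: "\<bar>G (?\<sigma> q) - G x\<bar> \<le> \<epsilon> / 2" if q: "q \<in> {s..t}" for q
    proof -
      have "dist (?\<sigma> q) x \<le> \<bar>q - r\<bar>"
        using lipschitz_along_path[OF p, of q r] lipschitz_along_path[OF p, of r q] st q
        by (cases "q \<le> r") (auto simp: x_def dist_commute)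
      also have "\<dots> < \<delta>\<^sub>1" using st q by (auto simp: abs_less_iff)
      finally show ?thesis using \<delta>\<^sub>1(2) by (fastforce simp: dist_real_def)
    qed
    have d: "dist (?\<sigma> t) (?\<sigma> s) \<le> t - s" using lipschitz_along_path[OF p, of s t] st by auto
    then have dh: "dist (?\<sigma> t) (?\<sigma> s) \<le> h" using st by auto
    \<comment> \<open>The step in one direction charges \<open>G\<close> at one end, the reverse
      step charges it at the other.\<close>
    define m where "m = max (G (?\<sigma> s)) (G (?\<sigma> t))"
    have m: "0 \<le> m" using G(1) by (simp add: m_def le_max_iff_disj)
    have "\<bar>?v (?\<sigma> t) - ?v (?\<sigma> s)\<bar> \<le> m * dist (?\<sigma> t) (?\<sigma> s)"
    proof -
      have "G (?\<sigma> s) * dist (?\<sigma> t) (?\<sigma> s) \<le> m * dist (?\<sigma> t) (?\<sigma> s)"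
        "G (?\<sigma> t) * dist (?\<sigma> t) (?\<sigma> s) \<le> m * dist (?\<sigma> t) (?\<sigma> s)"
        by (auto simp: m_def intro!: mult_right_mono)
      moreover have "?v (?\<sigma> s) \<le> ?v (?\<sigma> t) + G (?\<sigma> s) * dist (?\<sigma> t) (?\<sigma> s)"
        "?v (?\<sigma> t) \<le> ?v (?\<sigma> s) + G (?\<sigma> t) * dist (?\<sigma> t) (?\<sigma> s)"
        using chain_value_step[of b G, OF b G(1) dh] chain_value_step[of b G "?\<sigma> s" "?\<sigma> t" h, OF b G(1)] dh
        by (auto simp: dist_commute)
      ultimately show ?thesis by linarith
    qed
    also have "\<dots> \<le> m * (t - s)" using d m by (rule mult_left_mono)
    finally have "ennreal \<bar>?v (?\<sigma> t) - ?v (?\<sigma> s)\<bar> \<le> ennreal (m * (t - s))" by (rule ennreal_leI)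
    also have "\<dots> \<le> (\<integral>\<^sup>+ q \<in> {s..t}. ennreal (G (?\<sigma> q)) \<partial>lborel) + ennreal (\<epsilon> * (t - s))"
    proof (rule nn_integral_Icc_ge)
      fix q assume q: "q \<in> {s..t}"
      have "m \<le> G x + \<epsilon> / 2"
        using abs_le_D1[OF near[of s]] abs_le_D1[OF near[of t]] st by (auto simp: m_def)
      also have "\<dots> \<le> G (?\<sigma> q) + \<epsilon>" using abs_le_D2[OF near[OF q]] by simp
      finally show "ennreal m \<le> ennreal (G (?\<sigma> q)) + ennreal \<epsilon>"
        using G(1) \<epsilon> by (auto simp flip: ennreal_plus intro!: ennreal_leI)
    qed (use m \<epsilon> st measurable_along_path_Icc[OF p Gm] in auto)
    finally show ?thesis .
  qed
  show "\<exists>\<delta>>0. \<forall>s t. 0 \<le> s \<longrightarrow> s \<le> r \<longrightarrow> r \<le> t \<longrightarrow> t \<le> path_len p \<longrightarrow> t - s < \<delta> \<longrightarrow>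
        ennreal \<bar>?v (?\<sigma> t) - ?v (?\<sigma> s)\<bar> \<le> (\<integral>\<^sup>+ q \<in> {s..t}. ennreal (G (?\<sigma> q)) \<partial>lborel) + ennreal (\<epsilon> * (t - s))"
    using est \<delta>\<^sub>1(1) h by (intro exI[of _ "min \<delta>\<^sub>1 h"]) auto
qed

lemma locally_lipschitz_chain_value:
  fixes G :: "'a::metric_space \<Rightarrow> real"
  assumes b: "\<And>x. 0 \<le> b x" and G: "\<And>x. 0 \<le> G x" "\<And>x. G x \<le> m" and h: "0 < h" and "open \<Omega>"
  shows "locally_lipschitz_on \<Omega> (chain_value b G h)"
  unfolding locally_lipschitz_on_def
proof
  let ?v = "chain_value b G h"
  fix x assume "x \<in> \<Omega>"
  then obtain r where r: "r > 0" "ball x r \<subseteq> \<Omega>"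
    using assms(5) by (metis open_contains_ball)
  have m: "0 \<le> m" using G order_trans by blast
  \<comment> \<open>Radius \<open>h / 2\<close> makes any two points of the ball reachable from each
    other in one step.\<close>
  have "m-lipschitz_on (ball x (min r (h / 2))) ?v"
  proof (rule lipschitz_onI[OF _ m])
    fix y z assume "y \<in> ball x (min r (h / 2))" "z \<in> ball x (min r (h / 2))"
    then have dh: "dist y z \<le> h" "dist z y \<le> h"
      using dist_triangle2[of y z x] by (auto simp: dist_commute)
    have "G y * dist y z \<le> m * dist y z" "G z * dist y z \<le> m * dist y z"
      using G by (auto intro: mult_right_mono)
    then show "dist (?v y) (?v z) \<le> m * dist y z"
      using chain_value_step[of b G, OF b G(1) dh(1)] chain_value_step[of b G, OF b G(1) dh(2)]
      by (auto simp: dist_real_def dist_commute)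
  qed
  moreover have "ball x (min r (h / 2)) \<subseteq> \<Omega>" using r by auto
  ultimately show "\<exists>r>0. \<exists>L. ball x r \<subseteq> \<Omega> \<and> L-lipschitz_on (ball x r) ?v"
    using r(1) h by (intro exI[of _ "min r (h / 2)"]) auto
qed

text \<open>
  A chain is read as a step function parametrized by the sum of its step lengths. It is restarted
  whenever it meets the complement of \<open>N\<close>, so afterwards it stays in \<open>N\<close>, where \<open>G\<close> has a positive
  lower bound which controls its length.
\<close>

lemma chain_cost_step_curve:
  fixes b G u :: "'a::metric_space \<Rightarrow> real" and E N :: "'a set"
  assumes c: "chain_cost b G h x c" and h: "0 \<le> h"
    and G: "\<And>x. 0 \<le> G x" "continuous_on UNIV G"
    and u: "\<And>x. 0 \<le> u x" "{x. u x \<noteq> 0} \<subseteq> N" and E: "- N \<subseteq> E"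
    and b: "\<And>y. b y = (if y \<in> E then u y else 1)"
  shows "0 \<le> c \<and> (1 \<le> c \<or> (\<exists>L \<gamma>. 0 \<le> L \<and> \<gamma> \<in> borel_measurable borel \<and> \<gamma> 0 \<in> E \<and> \<gamma> L = x \<and>
    (\<forall>s\<in>{0<..L}. \<gamma> s \<in> N) \<and> (\<forall>s\<in>{0..L}. dist (\<gamma> s) x \<le> L - s) \<and>
    (\<forall>s\<in>{0..L}. \<forall>t\<in>{s..L}. dist (\<gamma> s) (\<gamma> t) \<le> t - s + h) \<and>
    ennreal (u (\<gamma> 0)) + (\<integral>\<^sup>+ s \<in> {0..L}. ennreal (G (\<gamma> s)) \<partial>lborel) \<le> ennreal c))"
  using c
\<comment> \<open>The bound on \<open>dist (\<gamma> s) x\<close> serves the induction only: after a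
  jump to a new endpoint it yields the distance estimate between earlier points and the new constant
  piece. The alternative \<open>1 \<le> c\<close> covers chains that start off
  \<open>E\<close>.\<close>
proof induction
  case (base y)
  show ?case
  proof (cases "y \<in> E")
    case True
    have "(\<integral>\<^sup>+ s \<in> {0..0::real}. ennreal (G y) \<partial>lborel) = 0"
      by (simp add: nn_integral_cmult_indicator)
    then show ?thesis using True h u(1)
      by (intro conjI disjI2 exI[of _ 0] exI[of _ "\<lambda>_. y"]) (auto simp: b)
  qed (simp add: b)
next
  case (step x c y)
  define d where "d = dist x y"
  have d: "0 \<le> d" "d \<le> h" using step by (auto simp: d_def)
  have c0: "0 \<le> c" using step by blast
  have Gd: "0 \<le> G y * d" using G(1) d by simp
  have Gm: "(\<lambda>s. ennreal (G (\<gamma> s))) \<in> borel_measurable borel" if "\<gamma> \<in> borel_measurable borel" for \<gamma> :: "real \<Rightarrow> 'a"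
    using measurable_compose[OF that borel_measurable_continuous_onI[OF G(2)]] by simp
  consider "1 \<le> c" | "y \<notin> N" | "y \<in> N" "\<not> 1 \<le> c" by blast
  then show ?case
  proof cases
    case 1
    then show ?thesis using Gd by (auto simp: d_def)
  next
    case 2
    have "(\<integral>\<^sup>+ s \<in> {0..0::real}. ennreal (G y) \<partial>lborel) = 0"
      by (simp add: nn_integral_cmult_indicator)
    moreover have "y \<in> E" "u y = 0" using 2 E u(2) by auto
    ultimately have "\<exists>L \<gamma>. 0 \<le> L \<and> \<gamma> \<in> borel_measurable borel \<and> \<gamma> 0 \<in> E \<and> \<gamma> L = y \<and>
        (\<forall>s\<in>{0<..L}. \<gamma> s \<in> N) \<and> (\<forall>s\<in>{0..L}. dist (\<gamma> s) y \<le> L - s) \<and>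
        (\<forall>s\<in>{0..L}. \<forall>t\<in>{s..L}. dist (\<gamma> s) (\<gamma> t) \<le> t - s + h) \<and>
        ennreal (u (\<gamma> 0)) + (\<integral>\<^sup>+ s \<in> {0..L}. ennreal (G (\<gamma> s)) \<partial>lborel) \<le> ennreal (c + G y * dist x y)"
      using h by (intro exI[of _ 0] exI[of _ "\<lambda>_. y"]) auto
    then show ?thesis using c0 Gd by (auto simp: d_def)
  next
    case 3
    then obtain L \<gamma> where L: "0 \<le> L" and \<gamma>: "\<gamma> \<in> borel_measurable borel" "\<gamma> 0 \<in> E" "\<gamma> L = x"
      "\<forall>s\<in>{0<..L}. \<gamma> s \<in> N" "\<forall>s\<in>{0..L}. dist (\<gamma> s) x \<le> L - s"
      "\<forall>s\<in>{0..L}. \<forall>t\<in>{s..L}. dist (\<gamma> s) (\<gamma> t) \<le> t - s + h"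
      "ennreal (u (\<gamma> 0)) + (\<integral>\<^sup>+ s \<in> {0..L}. ennreal (G (\<gamma> s)) \<partial>lborel) \<le> ennreal c"
      using step.IH by (elim conjE disjE exE) auto
    \<comment> \<open>The new piece has parameter length \<open>d\<close> and stays at
      \<open>y\<close>, so the integral grows by exactly the cost \<open>G y * d\<close> of the
      step. The jump is at most \<open>h\<close>, the tolerance in the Lipschitz estimate.\<close>
    define \<gamma>' where "\<gamma>' s = (if s \<le> L then \<gamma> s else y)" for s
    have \<gamma>'m: "\<gamma>' \<in> borel_measurable borel"
      unfolding \<gamma>'_def using \<gamma>(1) by (intro measurable_If) auto
    have tail: "dist (\<gamma>' s) y \<le> L + d - s" if "s \<in> {0..L + d}" for s
    proof (cases "s \<le> L")
      case True
      then have "dist (\<gamma> s) x \<le> L - s" using \<gamma>(5) that by auto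
      then show ?thesis using True dist_triangle[of "\<gamma> s" y x] by (simp add: \<gamma>'_def d_def)
    qed (use that in \<open>simp add: \<gamma>'_def\<close>)
    have pair: "dist (\<gamma>' s) (\<gamma>' t) \<le> t - s + h" if "s \<in> {0..L + d}" "t \<in> {s..L + d}" for s t
    proof (cases "t \<le> L")
      case True
      then show ?thesis using \<gamma>(6) that by (auto simp: \<gamma>'_def)
    next
      case False
      then have "dist (\<gamma>' s) (\<gamma>' t) \<le> L + d - s" using tail[OF that(1)] by (simp add: \<gamma>'_def)
      then show ?thesis using False d by simp
    qed
    have "(\<integral>\<^sup>+ s \<in> {0..L + d}. ennreal (G (\<gamma>' s)) \<partial>lborel)
      = (\<integral>\<^sup>+ s \<in> {0..L}. ennreal (G (\<gamma>' s)) \<partial>lborel) + (\<integral>\<^sup>+ s \<in> {L..L + d}. ennreal (G (\<gamma>' s)) \<partial>lborel)"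
      using L d Gm[OF \<gamma>'m] by (intro nn_integral_Icc_split) auto
    also have "(\<integral>\<^sup>+ s \<in> {0..L}. ennreal (G (\<gamma>' s)) \<partial>lborel) = (\<integral>\<^sup>+ s \<in> {0..L}. ennreal (G (\<gamma> s)) \<partial>lborel)"
      by (intro nn_integral_cong) (auto simp: \<gamma>'_def indicator_def)
    also have "(\<integral>\<^sup>+ s \<in> {L..L + d}. ennreal (G (\<gamma>' s)) \<partial>lborel) = (\<integral>\<^sup>+ s \<in> {L..L + d}. ennreal (G y) \<partial>lborel)"
      using AE_lborel_singleton[of L]
      by (intro nn_integral_cong_AE) (auto elim!: eventually_mono simp: \<gamma>'_def indicator_def)
    also have "\<dots> = ennreal (G y * d)"
      using d G(1) by (simp add: nn_integral_cmult_indicator ennreal_mult)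
    finally have "ennreal (u (\<gamma>' 0)) + (\<integral>\<^sup>+ s \<in> {0..L + d}. ennreal (G (\<gamma>' s)) \<partial>lborel)
      = ennreal (u (\<gamma> 0)) + (\<integral>\<^sup>+ s \<in> {0..L}. ennreal (G (\<gamma> s)) \<partial>lborel) + ennreal (G y * d)"
      using L by (simp add: \<gamma>'_def add.assoc)
    also have "\<dots> \<le> ennreal c + ennreal (G y * d)" by (intro add_right_mono \<gamma>(7))
    also have "\<dots> = ennreal (c + G y * dist x y)" using c0 Gd by (simp add: d_def flip: ennreal_plus)
    finally have "ennreal (u (\<gamma>' 0)) + (\<integral>\<^sup>+ s \<in> {0..L + d}. ennreal (G (\<gamma>' s)) \<partial>lborel)
      \<le> ennreal (c + G y * dist x y)" .
    moreover have "\<gamma>' (L + d) = y" using \<gamma>(3) d by (auto simp: \<gamma>'_def d_def)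
    moreover have "\<forall>s\<in>{0<..L + d}. \<gamma>' s \<in> N" using \<gamma>(4) 3 by (auto simp: \<gamma>'_def)
    moreover have "\<gamma>' 0 \<in> E" using \<gamma>(2) L by (simp add: \<gamma>'_def)
    ultimately have "\<exists>L \<gamma>. 0 \<le> L \<and> \<gamma> \<in> borel_measurable borel \<and> \<gamma> 0 \<in> E \<and> \<gamma> L = y \<and>
        (\<forall>s\<in>{0<..L}. \<gamma> s \<in> N) \<and> (\<forall>s\<in>{0..L}. dist (\<gamma> s) y \<le> L - s) \<and>
        (\<forall>s\<in>{0..L}. \<forall>t\<in>{s..L}. dist (\<gamma> s) (\<gamma> t) \<le> t - s + h) \<and>
        ennreal (u (\<gamma> 0)) + (\<integral>\<^sup>+ s \<in> {0..L}. ennreal (G (\<gamma> s)) \<partial>lborel) \<le> ennreal (c + G y * dist x y)"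
      using L d \<gamma>'m tail pair by (intro exI[of _ "L + d"] exI[of _ \<gamma>']) auto
    then show ?thesis using c0 Gd by (auto simp: d_def)
  qed
qed

text \<open>Arzela-Ascoli for discontinuous curves whose jumps disappear in the limit. Compactness
  of a countable power of \<open>D\<close> yields convergence at all rational parameters in place of
  a diagonal argument; the coarse Lipschitz bound extends it to all parameters.\<close>

lemma coarse_curves_limit:
  fixes \<gamma> :: "nat \<Rightarrow> real \<Rightarrow> 'a::complete_space"
  assumes D: "compact D" "\<And>n s. \<gamma> n s \<in> D"
    and lip: "\<And>n s t. dist (\<gamma> n s) (\<gamma> n t) \<le> \<bar>s - t\<bar> + h n" and h: "h \<longlonglongrightarrow> 0"
  obtains r \<gamma>' where "strict_mono (r :: nat \<Rightarrow> nat)" "\<And>s. (\<lambda>n. \<gamma> (r n) s) \<longlonglongrightarrow> \<gamma>' s" "1-lipschitz_on UNIV \<gamma>'"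
proof -
  define q where "q k = real_of_rat (from_nat k)" for k :: nat
  define f where "f n = (\<lambda>k. \<gamma> n (q k))" for n
  have "compactin (product_topology (\<lambda>_::nat. euclidean) UNIV) (PiE UNIV (\<lambda>_. D))"
    using D(1) by (simp add: compactin_PiE)
  then have "compact (PiE UNIV (\<lambda>_::nat. D))"
    by (simp add: euclidean_product_topology)
  moreover have "f n \<in> PiE UNIV (\<lambda>_. D)" for n using D(2) by (auto simp: f_def)
  ultimately obtain r l where r: "strict_mono (r :: nat \<Rightarrow> nat)" and l: "(f \<circ> r) \<longlonglongrightarrow> l"
    unfolding compact_def by blast
  have conv: "(\<lambda>n. \<gamma> (r n) (q k)) \<longlonglongrightarrow> l k" for k
  proof -
    have "continuous_on UNIV (\<lambda>x::nat \<Rightarrow> 'a. x k)" by simp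
    then have "isCont (\<lambda>x::nat \<Rightarrow> 'a. x k) l" by (rule continuous_on_interior) simp
    from isCont_tendsto_compose[OF this l] show ?thesis by (simp add: f_def o_def)
  qed
  have hr: "(\<lambda>n. h (r n)) \<longlonglongrightarrow> 0"
    using LIMSEQ_subseq_LIMSEQ[OF h r] by (simp add: o_def)
  have "Cauchy (\<lambda>n. \<gamma> (r n) s)" for s
  proof (rule metric_CauchyI)
    fix e :: real assume e: "0 < e"
    \<comment> \<open>Parameter distance and jump tolerance below \<open>e / 8\<close> each make a
      comparison with the rational parameter cost less than \<open>e / 4\<close>; it is made twice,
      and the Cauchy bound at that parameter adds another \<open>e / 4\<close>.\<close>
    obtain p where p: "s < real_of_rat p" "real_of_rat p < s + e / 8"
      using of_rat_dense[of s "s + e / 8"] e by auto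
    define k where "k = to_nat p"
    have qk: "\<bar>s - q k\<bar> < e / 8" "\<bar>q k - s\<bar> < e / 8" using p by (auto simp: q_def k_def)
    have "Cauchy (\<lambda>n. \<gamma> (r n) (q k))" using conv[of k] by (rule LIMSEQ_imp_Cauchy)
    then obtain N1 where N1: "\<And>m n. m \<ge> N1 \<Longrightarrow> n \<ge> N1 \<Longrightarrow> dist (\<gamma> (r m) (q k)) (\<gamma> (r n) (q k)) < e / 4"
      using e unfolding Cauchy_def by (metis divide_pos_pos zero_less_numeral)
    have "eventually (\<lambda>n. h (r n) < e / 8) sequentially"
      using hr e by (intro order_tendstoD) auto
    then obtain N2 where N2: "\<And>n. n \<ge> N2 \<Longrightarrow> h (r n) < e / 8"
      by (auto simp: eventually_sequentially)
    have "dist (\<gamma> (r m) s) (\<gamma> (r n) s) < e" if "m \<ge> max N1 N2" "n \<ge> max N1 N2" for m n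
    proof -
      have "dist (\<gamma> (r m) s) (\<gamma> (r n) s) \<le> dist (\<gamma> (r m) s) (\<gamma> (r m) (q k))
          + dist (\<gamma> (r m) (q k)) (\<gamma> (r n) (q k)) + dist (\<gamma> (r n) (q k)) (\<gamma> (r n) s)"
        using dist_triangle[of "\<gamma> (r m) s" "\<gamma> (r n) s" "\<gamma> (r m) (q k)"]
          dist_triangle[of "\<gamma> (r m) (q k)" "\<gamma> (r n) s" "\<gamma> (r n) (q k)"] by linarith
      moreover have "dist (\<gamma> (r m) s) (\<gamma> (r m) (q k)) < e / 4" "dist (\<gamma> (r n) (q k)) (\<gamma> (r n) s) < e / 4"
        using lip[of "r m" s "q k"] lip[of "r n" "q k" s] qk N2[of m] N2[of n] that by auto
      moreover have "dist (\<gamma> (r m) (q k)) (\<gamma> (r n) (q k)) < e / 4" using N1 that by auto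
      ultimately show ?thesis using e by linarith
    qed
    then show "\<exists>M. \<forall>m\<ge>M. \<forall>n\<ge>M. dist (\<gamma> (r m) s) (\<gamma> (r n) s) < e" by blast
  qed
  then have "\<forall>s. \<exists>y. (\<lambda>n. \<gamma> (r n) s) \<longlonglongrightarrow> y"
    by (simp add: Cauchy_convergent_iff convergent_def)
  then obtain \<gamma>' where \<gamma>': "\<And>s. (\<lambda>n. \<gamma> (r n) s) \<longlonglongrightarrow> \<gamma>' s" by metis
  have "1-lipschitz_on UNIV \<gamma>'"
  proof (rule lipschitz_onI)
    fix s t :: real
    have "(\<lambda>n. dist (\<gamma> (r n) s) (\<gamma> (r n) t)) \<longlonglongrightarrow> dist (\<gamma>' s) (\<gamma>' t)"
      by (intro tendsto_dist \<gamma>')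
    moreover have "(\<lambda>n. \<bar>s - t\<bar> + h (r n)) \<longlonglongrightarrow> \<bar>s - t\<bar> + 0" by (intro tendsto_intros hr)
    ultimately have "dist (\<gamma>' s) (\<gamma>' t) \<le> \<bar>s - t\<bar> + 0"
      using lip by (intro LIMSEQ_le[of "\<lambda>n. dist (\<gamma> (r n) s) (\<gamma> (r n) t)"]) auto
    then show "dist (\<gamma>' s) (\<gamma>' t) \<le> 1 * dist s t" by (simp add: dist_real_def)
  qed simp
  then show ?thesis using that r \<gamma>' by blast
qed

text \<open>The one-point chain gives values at most \<open>u x\<close>. If they stayed below by
  \<open>e\<close>, semicontinuity of \<open>u\<close> on \<open>E\<close> would control the start
  of the limit curve and Fatou's lemma its integral, which is then too small for the values of
  \<open>u\<close> at the two ends.\<close>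

lemma chain_value_tendsto:
  fixes G :: "nat \<Rightarrow> 'a::complete_space \<Rightarrow> real"
  assumes D: "compact D" and \<delta>: "0 < \<delta>" "\<And>x. x \<in> N \<Longrightarrow> ball x \<delta> \<subseteq> D"
    and G: "\<And>n x. 0 \<le> G n x" "\<And>n. continuous_on UNIV (G n)" "\<And>x. mono (\<lambda>n. G n x)"
    and \<eta>: "0 < \<eta>" "\<And>n x. x \<in> N \<Longrightarrow> \<eta> \<le> G n x"
    and h: "\<And>n. 0 < h n" "h \<longlonglongrightarrow> 0"
    and u: "\<And>x. 0 \<le> u x" "\<And>x. u x \<le> 1" "\<And>x. x \<notin> N \<Longrightarrow> u x = 0"
    and E: "closed E" "- N \<subseteq> E"
      "\<And>y c. y \<in> E \<Longrightarrow> c < u y \<Longrightarrow> \<exists>V. open V \<and> y \<in> V \<and> (\<forall>z\<in>V \<inter> E. c < u z)"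
    and b: "\<And>y. b y = (if y \<in> E then u y else 1)"
    and ug: "\<And>p. p \<in> paths_in D \<Longrightarrow> upper_gradient_ineq (\<lambda>x. ereal (u x)) (\<lambda>x. SUP n. ennreal (G n x)) p"
    and x: "x \<in> E"
  shows "(\<lambda>n. chain_value b (G n) (h n) x) \<longlonglongrightarrow> u x"
proof (cases "x \<in> N")
  case False
  have b0: "0 \<le> b y" for y using u(1) b by simp
  have "chain_value b (G n) (h n) x = 0" for n
    using chain_value_bounds[of b "G n" "h n" x, OF b0 G(1)] u(3)[OF False] x by (simp add: b)
  then show ?thesis using u(3)[OF False] by simp
next
  case xN: True
  have b0: "0 \<le> b y" for y using u(1) b by simp
  have supp: "{x. u x \<noteq> 0} \<subseteq> N" using u(3) by blast
  let ?v = "\<lambda>n. chain_value b (G n) (h n) x"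
  have vu: "?v n \<le> u x" for n
    using chain_value_bounds(2)[of b "G n" "h n" x, OF b0 G(1)] x by (simp add: b)
  have "eventually (\<lambda>n. u x - e < ?v n) sequentially" if e: "0 < e" for e
  proof (rule ccontr)
    assume no: "\<not> eventually (\<lambda>n. u x - e < ?v n) sequentially"
    have h\<delta>: "eventually (\<lambda>n. h n < \<delta>) sequentially"
      using h(2) \<delta>(1) by (intro order_tendstoD) auto
    \<comment> \<open>The additional alternative makes a single subsequence satisfy both
      requirements: too cheap chains and steps below \<open>\<delta>\<close>.\<close>
    have "\<not> eventually (\<lambda>n. u x - e < ?v n \<or> \<not> h n < \<delta>) sequentially"
    proof (rule contrapos_nn[OF no])
      assume "eventually (\<lambda>n. u x - e < ?v n \<or> \<not> h n < \<delta>) sequentially"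
      with h\<delta>
      show "eventually (\<lambda>n. u x - e < ?v n) sequentially" by eventually_elim auto
    qed
    then obtain r where r: "strict_mono (r :: nat \<Rightarrow> nat)"
      "\<And>n. \<not> (u x - e < ?v (r n) \<or> \<not> h (r n) < \<delta>)"
      using not_eventually_sequentiallyD by blast
    \<comment> \<open>Strictly above the values on the subsequence, so that chains of cost below
      \<open>K\<close> exist, and still \<open>e / 2\<close> below \<open>u x\<close>. Moreover
      \<open>K \<le> 1\<close> excludes chains started off \<open>E\<close>.\<close>
    define K where "K = u x - e / 2"
    \<comment> \<open>The length bound holds because the weight is at least \<open>\<eta>\<close>
      along the curve after its start, while the cost is at most 1. Positivity of \<open>K\<close>
      is recorded for the conversion from \<open>ennreal\<close>.\<close>
    define Q where "Q n L \<gamma> \<longleftrightarrow> 0 < K \<and> 0 \<le> L \<and> L \<le> 1 / \<eta> \<and> \<gamma> \<in> borel_measurable borel \<and> \<gamma> 0 \<in> E \<and> \<gamma> L = x \<and>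
      (\<forall>s\<in>{0..L}. \<gamma> s \<in> D) \<and> (\<forall>s\<in>{0..L}. \<forall>t\<in>{s..L}. dist (\<gamma> s) (\<gamma> t) \<le> t - s + h (r n)) \<and>
      ennreal (u (\<gamma> 0)) + (\<integral>\<^sup>+ s \<in> {0..L}. ennreal (G (r n) (\<gamma> s)) \<partial>lborel) \<le> ennreal K" for n L \<gamma>
    have "\<exists>L \<gamma>. Q n L \<gamma>" for n
    proof -
      have "?v (r n) < K" using r(2)[of n] e by (auto simp: K_def)
      then obtain c where c: "chain_cost b (G (r n)) (h (r n)) x c" "c < K"
        by (rule chain_value_less_obtain)
      have K1: "K \<le> 1" using u(2)[of x] e by (simp add: K_def)
      note step = chain_cost_step_curve[where u = u and N = N, OF c(1) less_imp_le[OF h(1)] G(1,2) u(1) supp E(2) b]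
      have c0: "0 \<le> c" using step by blast
      from step c(2) K1 obtain L \<gamma> where L: "0 \<le> L" and \<gamma>: "\<gamma> \<in> borel_measurable borel" "\<gamma> 0 \<in> E" "\<gamma> L = x"
        "\<forall>s\<in>{0<..L}. \<gamma> s \<in> N" "\<forall>s\<in>{0..L}. \<forall>t\<in>{s..L}. dist (\<gamma> s) (\<gamma> t) \<le> t - s + h (r n)"
        "ennreal (u (\<gamma> 0)) + (\<integral>\<^sup>+ s \<in> {0..L}. ennreal (G (r n) (\<gamma> s)) \<partial>lborel) \<le> ennreal c"
        by (elim conjE disjE exE) auto
      have "ennreal (\<eta> * L) = (\<integral>\<^sup>+ s \<in> {0..L}. ennreal \<eta> \<partial>lborel)"
        using L \<eta>(1) by (simp add: nn_integral_cmult_indicator ennreal_mult)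
      also have "\<dots> \<le> (\<integral>\<^sup>+ s \<in> {0..L}. ennreal (G (r n) (\<gamma> s)) \<partial>lborel)"
        using AE_lborel_singleton[of 0] \<gamma>(4) \<eta>(2)
        by (intro nn_integral_mono_AE) (auto elim!: eventually_mono simp: indicator_def intro!: ennreal_leI)
      also have "\<dots> \<le> ennreal (u (\<gamma> 0)) + (\<integral>\<^sup>+ s \<in> {0..L}. ennreal (G (r n) (\<gamma> s)) \<partial>lborel)"
        by simp
      also have "\<dots> \<le> ennreal c" by (rule \<gamma>(6))
      also have "\<dots> \<le> ennreal 1" using c(2) K1 by (intro ennreal_leI) simp
      finally have "\<eta> * L \<le> 1" by (subst (asm) ennreal_le_iff) auto
      then have L1: "L \<le> 1 / \<eta>" using \<eta>(1) by (simp add: field_simps)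
      have ND: "y \<in> D" if "y \<in> N" for y using \<delta>(2)[OF that] \<delta>(1) by (auto dest: subsetD[of _ _ y])
      have h\<delta>: "h (r n) < \<delta>" using r(2)[of n] by simp
      \<comment> \<open>Only the starting point may lie outside \<open>N\<close>. As the jump
        tolerance is below \<open>\<delta>\<close>, it is within \<open>\<delta>\<close> of a
        slightly later point of the curve, which is in \<open>N\<close>.\<close>
      have D0: "\<gamma> 0 \<in> D"
      proof (cases "L = 0")
        case True
        then show ?thesis using \<gamma>(3) ND[OF xN] by simp
      next
        case False
        define s where "s = min L ((\<delta> - h (r n)) / 2)"
        have s: "0 < s" "s \<le> L" "s + h (r n) < \<delta>"
          using False L h\<delta> by (auto simp: s_def min_def field_simps)
        then have "dist (\<gamma> 0) (\<gamma> s) \<le> s - 0 + h (r n)" by (intro \<gamma>(5)[rule_format]) auto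
        then have "\<gamma> 0 \<in> ball (\<gamma> s) \<delta>" using s by (simp add: dist_commute)
        moreover have "\<gamma> s \<in> N" using \<gamma>(4) s by auto
        ultimately show ?thesis using \<delta>(2) by blast
      qed
      have inD: "\<gamma> s \<in> D" if "s \<in> {0..L}" for s
      proof (cases "s = 0")
        case False
        then show ?thesis using \<gamma>(4) that by (intro ND) auto
      qed (use D0 in simp)
      have "ennreal (u (\<gamma> 0)) + (\<integral>\<^sup>+ s \<in> {0..L}. ennreal (G (r n) (\<gamma> s)) \<partial>lborel) \<le> ennreal K"
        by (rule order_trans[OF \<gamma>(6)]) (use c(2) in \<open>simp add: ennreal_leI\<close>)
      then show ?thesis
        using L L1 \<gamma>(1-3,5) inD c0 c(2) unfolding Q_def by (intro exI[of _ L] exI[of _ \<gamma>]) auto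
    qed
    then obtain L \<gamma> where Q: "\<And>n. Q n (L n) (\<gamma> n)" by metis
    have K0: "0 < K"
      using Q[of 0] by (simp add: Q_def)
    have L: "\<And>n. 0 \<le> L n" "\<And>n. L n \<le> 1 / \<eta>"
      using Q by (simp_all add: Q_def)
    have \<gamma>: "\<And>n. \<gamma> n \<in> borel_measurable borel" "\<And>n. \<gamma> n 0 \<in> E" "\<And>n. \<gamma> n (L n) = x"
        "\<And>n s. s \<in> {0..L n} \<Longrightarrow> \<gamma> n s \<in> D"
        "\<And>n s t. s \<in> {0..L n} \<Longrightarrow> t \<in> {s..L n} \<Longrightarrow> dist (\<gamma> n s) (\<gamma> n t) \<le> t - s + h (r n)"
        "\<And>n. ennreal (u (\<gamma> n 0)) + (\<integral>\<^sup>+ s \<in> {0..L n}. ennreal (G (r n) (\<gamma> n s)) \<partial>lborel) \<le> ennreal K"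
      using Q by (simp_all add: Q_def)
    \<comment> \<open>The lengths vary with \<open>n\<close>; constant continuation gives curves on
      the whole line, to which the compactness argument applies.\<close>
    define \<beta> where "\<beta> n s = \<gamma> n (max 0 (min s (L n)))" for n s
    have \<beta>eq: "\<beta> n s = \<gamma> n s" if "s \<in> {0..L n}" for n s
      using that by (simp add: \<beta>_def min_def)
    have \<beta>le: "dist (\<beta> n s) (\<beta> n t) \<le> t - s + h (r n)" if "s \<le> t" for n s t
    proof -
      define s' t' where "s' = max 0 (min s (L n))" and "t' = max 0 (min t (L n))"
      have st': "s' \<in> {0..L n}" "t' \<in> {s'..L n}" "t' - s' \<le> t - s"
        using that L(1)[of n] by (auto simp: s'_def t'_def)
      have "dist (\<beta> n s) (\<beta> n t) \<le> t' - s' + h (r n)"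
        unfolding \<beta>_def s'_def[symmetric] t'_def[symmetric] by (rule \<gamma>(5)[OF st'(1,2)])
      then show ?thesis using st'(3) by simp
    qed
    have \<beta>lip: "dist (\<beta> n s) (\<beta> n t) \<le> \<bar>s - t\<bar> + h (r n)" for n s t
      using \<beta>le[of s t n] \<beta>le[of t s n] by (cases "s \<le> t") (auto simp: dist_commute)
    have hr: "(\<lambda>n. h (r n)) \<longlonglongrightarrow> 0"
      using LIMSEQ_subseq_LIMSEQ[OF h(2) r(1)] by (simp add: o_def)
    have \<beta>D: "\<beta> n s \<in> D" for n s
      unfolding \<beta>_def using L(1)[of n] by (intro \<gamma>(4)) auto
    obtain \<phi> \<gamma>' where \<phi>: "strict_mono (\<phi> :: nat \<Rightarrow> nat)" and lim\<phi>: "\<And>s. (\<lambda>n. \<beta> (\<phi> n) s) \<longlonglongrightarrow> \<gamma>' s"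
      and lip': "1-lipschitz_on UNIV \<gamma>'"
      by (rule coarse_curves_limit[OF D \<beta>D \<beta>lip hr]) blast
    have "seq_compact {0..1 / \<eta>}" by (intro compact_imp_seq_compact) simp
    moreover have "\<forall>n. L (\<phi> n) \<in> {0..1 / \<eta>}" using L by auto
    ultimately obtain l \<psi> where l: "l \<in> {0..1 / \<eta>}" and \<psi>: "strict_mono (\<psi> :: nat \<Rightarrow> nat)" and "((\<lambda>n. L (\<phi> n)) \<circ> \<psi>) \<longlonglongrightarrow> l"
      by (rule seq_compactE)
    define \<kappa> where "\<kappa> n = \<phi> (\<psi> n)" for n
    have \<kappa>: "strict_mono \<kappa>"
      unfolding \<kappa>_def using strict_mono_o[OF \<phi> \<psi>] by (simp add: o_def)
    have limL: "(\<lambda>n. L (\<kappa> n)) \<longlonglongrightarrow> l"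
      using \<open>((\<lambda>n. L (\<phi> n)) \<circ> \<psi>) \<longlonglongrightarrow> l\<close> by (simp add: \<kappa>_def o_def)
    have lim: "(\<lambda>n. \<beta> (\<kappa> n) s) \<longlonglongrightarrow> \<gamma>' s" for s
      using LIMSEQ_subseq_LIMSEQ[OF lim\<phi>[of s] \<psi>] by (simp add: \<kappa>_def o_def)
    have h\<kappa>: "(\<lambda>n. h (r (\<kappa> n))) \<longlonglongrightarrow> 0"
      using LIMSEQ_subseq_LIMSEQ[OF hr \<kappa>] by (simp add: o_def)
    have \<beta>0: "\<beta> n 0 = \<gamma> n 0" for n using \<beta>eq[of 0 n] L(1) by auto
    have start: "(\<lambda>n. \<gamma> (\<kappa> n) 0) \<longlonglongrightarrow> \<gamma>' 0" using lim[of 0] by (simp add: \<beta>0)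
    then have start_E: "\<gamma>' 0 \<in> E"
      using closed_sequentially[OF E(1) \<gamma>(2)] by blast
    have endpoint: "\<gamma>' l = x"
    proof -
      have "(\<lambda>n. dist (\<beta> (\<kappa> n) l) x) \<longlonglongrightarrow> 0"
      proof (rule tendsto_sandwich[OF _ _ tendsto_const])
        have "dist (\<beta> n l) x \<le> \<bar>l - L n\<bar> + h (r n)" for n
          using \<beta>lip[of n l "L n"] \<beta>eq[of "L n" n] L(1)[of n] by (simp add: \<gamma>(3))
        then show "eventually (\<lambda>n. dist (\<beta> (\<kappa> n) l) x \<le> \<bar>l - L (\<kappa> n)\<bar> + h (r (\<kappa> n))) sequentially"
          by simp
        have "(\<lambda>n. \<bar>l - L (\<kappa> n)\<bar> + h (r (\<kappa> n))) \<longlonglongrightarrow> \<bar>l - l\<bar> + 0"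
          by (intro tendsto_intros limL h\<kappa>)
        then show "(\<lambda>n. \<bar>l - L (\<kappa> n)\<bar> + h (r (\<kappa> n))) \<longlonglongrightarrow> 0" by simp
      qed simp
      then have "(\<lambda>n. \<beta> (\<kappa> n) l) \<longlonglongrightarrow> x" by (rule tendsto_dist_iff[THEN iffD2])
      then show ?thesis by (rule LIMSEQ_unique[OF lim])
    qed
    have in_D: "\<gamma>' s \<in> D" for s
      by (rule closed_sequentially[OF compact_imp_closed[OF D] \<beta>D lim])
    \<comment> \<open>The loss \<open>e / 4\<close> at the start is less than the gap
      \<open>e / 2\<close> between \<open>K\<close> and \<open>u x\<close>, which leaves a
      contradiction.\<close>
    define c where "c = u (\<gamma>' 0) - e / 4"
    have "c < u (\<gamma>' 0)" using e by (simp add: c_def)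
    then obtain V where V: "open V" "\<gamma>' 0 \<in> V" "\<forall>z\<in>V \<inter> E. c < u z"
      using E(3)[OF start_E] by blast
    have "eventually (\<lambda>n. \<gamma> (\<kappa> n) 0 \<in> V) sequentially"
      using start V(1,2) by (rule topological_tendstoD)
    then have ev_c: "eventually (\<lambda>n. c < u (\<gamma> (\<kappa> n) 0)) sequentially"
      by eventually_elim (use V(3) \<gamma>(2) in auto)
    have uK: "u (\<gamma> n 0) \<le> K" for n
    proof -
      have "ennreal (u (\<gamma> n 0)) \<le> ennreal K"
        using \<gamma>(6)[of n] by (meson add_increasing2 order_refl order_trans zero_le)
      then show ?thesis using K0 by (simp add: ennreal_le_iff)
    qed
    have cK: "c < K"
      using eventually_happens'[OF sequentially_bot ev_c] uK by (meson less_le_trans)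
    \<comment> \<open>The weight \<open>G m\<close> is kept fixed while the curves converge; for
      large \<open>n\<close> it lies below the weight belonging to the chain, by
      monotonicity.\<close>
    have bound: "(\<integral>\<^sup>+ s \<in> {0..l}. ennreal (G m (\<gamma>' s)) \<partial>lborel) \<le> ennreal (K - c)" for m
    proof -
      define F where "F n s = ennreal (G m (\<gamma> (\<kappa> n) s)) * indicator {0..L (\<kappa> n)} s" for n s
      have Fm: "F n \<in> borel_measurable lborel" for n
        using measurable_compose[OF \<gamma>(1)[of "\<kappa> n"] borel_measurable_continuous_onI[OF G(2)[of m]]]
        unfolding F_def by simp
      have "(\<integral>\<^sup>+ s \<in> {0..l}. ennreal (G m (\<gamma>' s)) \<partial>lborel) \<le> (\<integral>\<^sup>+ s. liminf (\<lambda>n. F n s) \<partial>lborel)"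
      proof (rule nn_integral_mono_AE)
        \<comment> \<open>Below \<open>l\<close> the parameter eventually belongs to all curves. At
          \<open>l\<close> itself this may fail, but a single point is negligible.\<close>
        have le: "ennreal (G m (\<gamma>' s)) * indicator {0..l} s \<le> liminf (\<lambda>n. F n s)" if "s \<noteq> l" for s
        proof (cases "s \<in> {0..l}")
          case True
          then have sl: "0 \<le> s" "s < l" using that by auto
          have "isCont (G m) (\<gamma>' s)" using G(2)[of m] by (simp add: continuous_on_eq_continuous_at)
          then have "(\<lambda>n. ennreal (G m (\<beta> (\<kappa> n) s))) \<longlonglongrightarrow> ennreal (G m (\<gamma>' s))"
            using lim[of s] by (intro tendsto_ennrealI isCont_tendsto_compose[of _ "G m"])
          moreover have "eventually (\<lambda>n. ennreal (G m (\<beta> (\<kappa> n) s)) = F n s) sequentially"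
          proof -
            have "eventually (\<lambda>n. s < L (\<kappa> n)) sequentially"
              using limL sl(2) by (rule order_tendstoD)
            then show ?thesis
              by eventually_elim (use sl in \<open>simp add: F_def \<beta>eq\<close>)
          qed
          ultimately have "(\<lambda>n. F n s) \<longlonglongrightarrow> ennreal (G m (\<gamma>' s))"
            by (rule Lim_transform_eventually)
          then have "liminf (\<lambda>n. F n s) = ennreal (G m (\<gamma>' s))"
            by (intro lim_imp_Liminf) auto
          then show ?thesis using True by simp
        qed simp
        show "AE s in lborel. ennreal (G m (\<gamma>' s)) * indicator {0..l} s \<le> liminf (\<lambda>n. F n s)"
          using AE_lborel_singleton[of l] by eventually_elim (rule le)
      qed
      also have "\<dots> \<le> liminf (\<lambda>n. \<integral>\<^sup>+ s. F n s \<partial>lborel)"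
        by (intro nn_integral_liminf Fm)
      also have "\<dots> \<le> ennreal (K - c)"
      proof -
        have "eventually (\<lambda>n. m \<le> r (\<kappa> n)) sequentially"
          using eventually_ge_at_top[of m]
          by eventually_elim (meson \<kappa> order_trans r(1) seq_suble)
        with ev_c have "eventually (\<lambda>n. (\<integral>\<^sup>+ s. F n s \<partial>lborel) \<le> ennreal (K - c)) sequentially"
        proof eventually_elim
          case (elim n)
          let ?X = "\<integral>\<^sup>+ s \<in> {0..L (\<kappa> n)}. ennreal (G (r (\<kappa> n)) (\<gamma> (\<kappa> n) s)) \<partial>lborel"
          have "(\<integral>\<^sup>+ s. F n s \<partial>lborel) \<le> ?X"
            unfolding F_def using monoD[OF G(3) elim(2)]
            by (intro nn_integral_mono mult_right_mono ennreal_leI) auto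
          also have "?X \<le> ennreal (K - c)"
            using \<gamma>(6)[of "\<kappa> n"] elim(1) u(1)[of "\<gamma> (\<kappa> n) 0"] K0
            by (cases ?X) (auto simp flip: ennreal_plus simp: ennreal_le_iff ennreal_leI top_unique)
          finally show ?case .
        qed
        then have "liminf (\<lambda>n. \<integral>\<^sup>+ s. F n s \<partial>lborel) \<le> liminf (\<lambda>n::nat. ennreal (K - c))"
          by (rule Liminf_mono)
        then show ?thesis by (simp add: Liminf_const)
      qed
      finally show ?thesis .
    qed
    show False
    \<comment> \<open>A limit curve with equal ends may be constant and thus not a path. Then
      \<open>c < K\<close> alone is contradictory.\<close>
    proof (cases "\<gamma>' 0 = x")
      case True
      then show ?thesis using cK e by (simp add: c_def K_def)
    next
      case False
      have lipl: "1-lipschitz_on {0..l} \<gamma>'" using lip' by (rule lipschitz_on_subset) simp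
      have p: "(0, l, \<gamma>') \<in> paths_in D"
        using l in_D False endpoint by (intro lipschitz_path[OF lipl]) auto
      let ?p = "(0, l, \<gamma>')"
      have m: "(\<lambda>q. ennreal (G n (arc_length_param ?p q)) * indicator {0..path_len ?p} q) \<in> borel_measurable borel" for n
        using borel_measurable_continuous_onI[OF G(2)[of n]]
        by (intro measurable_along_path_Icc[OF p, of "\<lambda>x. ennreal (G n x)"] measurable_restrict_space1) auto
      have "path_integral ?p (\<lambda>x. SUP n. ennreal (G n x))
        = (\<integral>\<^sup>+ q. (SUP n. ennreal (G n (arc_length_param ?p q)) * indicator {0..path_len ?p} q) \<partial>lborel)"
        unfolding path_integral_eq_lborel by (simp add: SUP_mult_right_ennreal)
      also have "\<dots> = (SUP n. path_integral ?p (\<lambda>x. ennreal (G n x)))"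
        unfolding path_integral_eq_lborel using m G(3)
        by (intro nn_integral_monotone_convergence_SUP)
          (auto simp: incseq_def le_fun_def mono_def intro!: mult_right_mono ennreal_leI)
      also have "\<dots> \<le> ennreal (K - c)"
        using bound path_integral_le_lipschitz[OF p lipl G(2) G(1)] by (intro SUP_least) (meson order_trans)
      finally have "ennreal \<bar>u (\<gamma>' 0) - u x\<bar> \<le> ennreal (K - c)"
        using ug[OF p] by (auto simp: upper_gradient_ineq_def endpoint intro: order_trans)
      then have "\<bar>u (\<gamma>' 0) - u x\<bar> \<le> K - c" using cK by (simp add: ennreal_le_iff)
      then show False using e by (simp add: K_def c_def abs_le_iff)
    qed
  qed
  then show ?thesis
    using vu unfolding tendsto_iff dist_real_def
  proof (intro allI impI)
    fix e :: real assume "0 < e"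
    with \<open>\<And>e. 0 < e \<Longrightarrow> eventually (\<lambda>n. u x - e < ?v n) sequentially\<close>
    have "eventually (\<lambda>n. u x - e < ?v n) sequentially" by blast
    then show "eventually (\<lambda>n. \<bar>?v n - u x\<bar> < e) sequentially"
      by eventually_elim (use vu \<open>0 < e\<close> in \<open>simp add: abs_less_iff less_diff_eq add.commute le_less_trans\<close>)
  qed
qed

section \<open>From Newtonian functions to functions of bounded variation\<close>

lemma paths_in_mono: "p \<in> paths_in D \<Longrightarrow> D \<subseteq> \<Omega> \<Longrightarrow> p \<in> paths_in \<Omega>"
  by (auto simp: paths_in_def)

lemma real_of_ereal_clamp:
  "real_of_ereal (max 0 (min 1 (ereal r))) = max 0 (min 1 r)"
  "real_of_ereal (max 0 (min 1 \<infinity>)) = 1"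
  "real_of_ereal (max 0 (min 1 (- \<infinity>))) = 0"
  by (auto simp: max_def min_def)

text \<open>For a fixed partial sum, finitely many bumps have to reach 1 at \<open>x\<close>; this
  happens at a common index that also exceeds the number of terms.\<close>

lemma suminf_indicator_le_SUP:
  fixes bump :: "nat \<Rightarrow> nat \<Rightarrow> 'a \<Rightarrow> real"
  assumes "0 \<le> \<eta>" "0 \<le> a" "\<And>j n. 0 \<le> bump j n x"
    and "\<And>j. x \<in> U j \<Longrightarrow> eventually (\<lambda>n. bump j n x = 1) sequentially"
  shows "(\<Sum>j. ennreal \<eta> * indicator (U j) x) \<le> (SUP n. ennreal (a + \<eta> * (\<Sum>j<n. bump j n x)))"
proof (rule suminf_le_const)
  fix k
  have "eventually (\<lambda>n. \<forall>j\<in>{j. j < k \<and> x \<in> U j}. bump j n x = 1) sequentially"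
    using assms(4) by (intro eventually_ball_finite) auto
  moreover have "eventually (\<lambda>n. k \<le> n) sequentially" by (rule eventually_ge_at_top)
  ultimately have "eventually (\<lambda>n. (\<forall>j\<in>{j. j < k \<and> x \<in> U j}. bump j n x = 1) \<and> k \<le> n) sequentially"
    by (rule eventually_conj)
  then obtain n where n: "\<And>j. j < k \<Longrightarrow> x \<in> U j \<Longrightarrow> bump j n x = 1" "k \<le> n"
    using eventually_happens'[OF sequentially_bot] by fastforce
  have "(\<Sum>j<k. ennreal \<eta> * indicator (U j) x) = (\<Sum>j<k. ennreal (\<eta> * indicator (U j) x))"
    using assms(1) by (intro sum.cong) (auto simp: indicator_def)
  also have "\<dots> = ennreal (\<Sum>j<k. \<eta> * indicator (U j) x)"
    using assms(1) by (intro sum_ennreal) auto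
  also have "\<dots> \<le> ennreal (a + \<eta> * (\<Sum>j<n. bump j n x))"
  proof (rule ennreal_leI)
    have "(\<Sum>j<k. \<eta> * indicator (U j) x) \<le> (\<Sum>j<k. \<eta> * bump j n x)"
    proof (rule sum_mono)
      fix j assume "j \<in> {..<k}"
      then have "indicator (U j) x \<le> bump j n x"
        using n(1)[of j] assms(3)[of j n] by (auto simp: indicator_def)
      then show "\<eta> * indicator (U j) x \<le> \<eta> * bump j n x"
        using assms(1) by (rule mult_left_mono)
    qed
    also have "\<dots> \<le> (\<Sum>j<n. \<eta> * bump j n x)"
      using n(2) assms(1,3) by (intro sum_mono2) auto
    finally show "(\<Sum>j<k. \<eta> * indicator (U j) x) \<le> a + \<eta> * (\<Sum>j<n. bump j n x)"
      using assms(2) by (simp add: sum_distrib_left)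
  qed
  also have "\<dots> \<le> (SUP n. ennreal (a + \<eta> * (\<Sum>j<n. bump j n x)))" by (rule SUP_upper) simp
  finally show "(\<Sum>j<k. ennreal \<eta> * indicator (U j) x) \<le> (SUP n. ennreal (a + \<eta> * (\<Sum>j<n. bump j n x)))" .
qed simp

lemma ennreal_le_suminf_indicator:
  fixes bump :: "nat \<Rightarrow> nat \<Rightarrow> 'a \<Rightarrow> real"
  assumes "0 \<le> \<eta>" "a \<le> \<eta> * indicator C x" "\<And>j. bump j n x \<le> indicator (U j) x"
  shows "ennreal (a + \<eta> * (\<Sum>j<n. bump j n x)) \<le> ennreal \<eta> * indicator C x + (\<Sum>j. ennreal \<eta> * indicator (U j) x)"
proof -
  have "(\<Sum>j<n. \<eta> * bump j n x) \<le> (\<Sum>j<n. \<eta> * indicator (U j) x)"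
    using assms(1,3) by (intro sum_mono mult_left_mono)
  then have "ennreal (a + \<eta> * (\<Sum>j<n. bump j n x)) \<le> ennreal (\<eta> * indicator C x + (\<Sum>j<n. \<eta> * indicator (U j) x))"
    using assms(2) by (intro ennreal_leI) (simp add: sum_distrib_left)
  also have "\<dots> = ennreal (\<eta> * indicator C x) + ennreal (\<Sum>j<n. \<eta> * indicator (U j) x)"
    using assms(1) by (intro ennreal_plus sum_nonneg) auto
  also have "ennreal (\<Sum>j<n. \<eta> * indicator (U j) x) = (\<Sum>j<n. ennreal (\<eta> * indicator (U j) x))"
    using assms(1) by (intro sum_ennreal[symmetric]) auto
  also have "\<dots> = (\<Sum>j<n. ennreal \<eta> * indicator (U j) x)"
    by (intro sum.cong) (auto simp: indicator_def)
  also have "ennreal (\<eta> * indicator C x) = ennreal \<eta> * indicator C x"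
    by (auto simp: indicator_def)
  also have "ennreal \<eta> * indicator C x + (\<Sum>j<n. ennreal \<eta> * indicator (U j) x)
      \<le> ennreal \<eta> * indicator C x + (\<Sum>j. ennreal \<eta> * indicator (U j) x)"
    by (intro add_left_mono sum_le_suminf) auto
  finally show ?thesis .
qed

section \<open>Lipschitz approximation of Newtonian functions\<close>

context doubling_space
begin

lemma newtonian_approx:
  fixes u :: "'a \<Rightarrow> real"
  assumes \<Omega>: "open \<Omega>" and S: "compact S" "S \<subseteq> \<Omega>"
    and u: "u \<in> borel_measurable M" "\<And>x. 0 \<le> u x" "\<And>x. u x \<le> 1" "\<And>x. x \<notin> S \<Longrightarrow> u x = 0"
    and f: "f \<in> borel_measurable (restrict_space M \<Omega>)"
    and ug: "\<And>p. p \<in> paths_in \<Omega> \<Longrightarrow> upper_gradient_ineq (\<lambda>x. ereal (u x)) f p"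
    and e: "0 < (e::real)"
  shows "\<exists>v G. locally_lipschitz_on \<Omega> v \<and> upper_gradient \<Omega> (\<lambda>x. ereal (v x)) G \<and>
    (\<integral>\<^sup>+ x \<in> \<Omega>. G x \<partial>M) \<le> (\<integral>\<^sup>+ x \<in> \<Omega>. f x \<partial>M) + ennreal e \<and>
    (\<integral>\<^sup>+ x. ennreal \<bar>v x - u x\<bar> \<partial>M) \<le> ennreal e"
proof -
  obtain N where N: "open N" "S \<subseteq> N" "compact (closure N)" "closure N \<subseteq> \<Omega>"
    using compact_nbhd[OF S(1) \<Omega> S(2)] .
  \<comment> \<open>The second neighbourhood provides a compact \<open>D\<close> containing all
    \<open>\<delta>\<close>-balls about points of \<open>N\<close>; it catches the starting points
    of chains and is where the majorant of \<open>f\<close> is built.\<close>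
  obtain N2 where N2: "open N2" "closure N \<subseteq> N2" "compact (closure N2)" "closure N2 \<subseteq> \<Omega>"
    using compact_nbhd[OF N(3) \<Omega> N(4)] .
  define D where "D = closure N2"
  have D: "compact D" "D \<subseteq> \<Omega>" using N2 by (auto simp: D_def)
  obtain \<delta> where \<delta>: "\<delta> > 0" "(\<Union>x\<in>closure N. ball x \<delta>) \<subseteq> N2"
    using compact_subset_open_imp_ball_epsilon_subset[OF N(3) N2(1,2)] by blast
  have ballD: "ball x \<delta> \<subseteq> D" if "x \<in> N" for x
    using that \<delta>(2) closure_subset[of N] closure_subset[of N2] unfolding D_def by blast
  obtain L \<theta> W C A where "cutoff_function (closure N) \<Omega> L \<theta> W C A"
    using cutoff_exists[OF N(3) \<Omega> N(4)] .
  note \<theta> = cutoff_functionD[OF this]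
  have Nfin: "emeasure M N < \<infinity>"
    using N(1,3) by (intro bounded_finite_measure) (auto intro: bounded_subset[OF compact_imp_bounded closure_subset])
  have Cm: "C \<in> sets M" using \<theta>(7) by (auto intro: compact_imp_closed)
  obtain mD mC where mD: "emeasure M D = ennreal mD" "0 \<le> mD" and mC: "emeasure M C = ennreal mC" "0 \<le> mC"
    using compact_finite_measure[OF D(1)] compact_finite_measure[OF \<theta>(7)]
    by (metis ennreal_cases infinity_ennreal_def less_irrefl)
  \<comment> \<open>The integral of the weights exceeds that of \<open>f\<close> by
    \<open>\<eta> * mC\<close> for the cutoff term, \<open>\<eta> * mD\<close> for rounding and
    \<open>\<eta>\<close> for enlarging the superlevel sets; together this is
    \<open>e\<close>.\<close>
  define \<eta> where "\<eta> = e / (mD + mC + 1)"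
  have \<eta>: "0 < \<eta>" using e mD mC by (simp add: \<eta>_def add_nonneg_pos)
  have \<eta>e: "\<eta> * mC + (\<eta> * mD + \<eta>) = e"
  proof -
    have "\<eta> * (mD + mC + 1) = e" using mD mC by (simp add: \<eta>_def)
    then show ?thesis by (simp add: algebra_simps)
  qed
  obtain U where U: "\<And>j. open (U j)" "\<And>x. x \<in> D \<Longrightarrow> f x \<le> (\<Sum>j. ennreal \<eta> * indicator (U j) x)"
    "(\<integral>\<^sup>+ x. (\<Sum>j. ennreal \<eta> * indicator (U j) x) \<partial>M) \<le> (\<integral>\<^sup>+ x \<in> \<Omega>. f x \<partial>M) + ennreal \<eta> * emeasure M D + ennreal \<eta>"
    by (rule lower_semicontinuous_majorant[OF \<Omega> D f \<eta>]) blast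
  define bump_spec where "bump_spec j f \<longleftrightarrow> (\<forall>n. \<exists>L. L-lipschitz_on UNIV (f n)) \<and> (\<forall>n x. 0 \<le> f n x) \<and>
      (\<forall>n x. f n x \<le> 1) \<and> (\<forall>x. mono (\<lambda>n. f n x)) \<and> (\<forall>n x. x \<notin> U j \<longrightarrow> f n x = 0) \<and>
      (\<forall>x. x \<in> U j \<longrightarrow> eventually (\<lambda>n. f n x = 1) sequentially)"
    for j and f :: "nat \<Rightarrow> 'a \<Rightarrow> real"
  have "\<exists>f. bump_spec j f" for j
    unfolding bump_spec_def by (rule open_lipschitz_approx[OF U(1)[of j]]) blast
  then obtain bump where "\<And>j. bump_spec j (bump j)" by metis
  then have bump: "\<And>j n. \<exists>L. L-lipschitz_on UNIV (bump j n)" "\<And>j n x. 0 \<le> bump j n x" "\<And>j n x. bump j n x \<le> 1"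
    "\<And>j x. mono (\<lambda>n. bump j n x)" "\<And>j n x. x \<notin> U j \<Longrightarrow> bump j n x = 0"
    "\<And>j x. x \<in> U j \<Longrightarrow> eventually (\<lambda>n. bump j n x = 1) sequentially"
    unfolding bump_spec_def by simp_all
  \<comment> \<open>The cutoff term supplies the lower bound \<open>\<eta>\<close> on
    \<open>N\<close>. One index \<open>n\<close> controls both the number of bumps and their
    steepness, so the sequence increases to the semicontinuous majorant plus the cutoff
    term.\<close>
  define G where "G n x = \<eta> * \<theta> x + \<eta> * (\<Sum>j<n. bump j n x)" for n x
  have Gnonneg: "0 \<le> G n x" for n x
    using \<eta> \<theta>(2) bump(2) by (auto simp: G_def intro!: add_nonneg_nonneg mult_nonneg_nonneg sum_nonneg)
  have Gcont: "continuous_on UNIV (G n)" for n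
  proof -
    have "continuous_on UNIV \<theta>" using \<theta>(1) by (rule lipschitz_on_continuous_on)
    moreover have "continuous_on UNIV (bump j n)" for j
      using bump(1) lipschitz_on_continuous_on by blast
    ultimately show ?thesis unfolding G_def by (intro continuous_intros)
  qed
  have Gmono: "mono (\<lambda>n. G n x)" for x
  proof (rule monoI)
    fix n m :: nat assume nm: "n \<le> m"
    have "(\<Sum>j<n. bump j n x) \<le> (\<Sum>j<n. bump j m x)"
      by (intro sum_mono monoD[OF bump(4)] nm)
    also have "\<dots> \<le> (\<Sum>j<m. bump j m x)" using nm bump(2) by (intro sum_mono2) auto
    finally show "G n x \<le> G m x" using \<eta> by (simp add: G_def)
  qed
  have Gle: "G n x \<le> \<eta> * 1 + \<eta> * real n" for n x
  proof -
    have "(\<Sum>j<n. bump j n x) \<le> (\<Sum>j<n. 1)" by (intro sum_mono bump(3))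
    then show ?thesis unfolding G_def using \<eta> \<theta>(3) by (intro add_mono mult_left_mono) auto
  qed
  have GN: "\<eta> \<le> G n x" if "x \<in> N" for n x
  proof -
    have "\<theta> x = 1" using that \<theta>(5,6) closure_subset[of N] by blast
    then show ?thesis using \<eta> bump(2) by (simp add: G_def sum_nonneg)
  qed
  have Gint: "(\<integral>\<^sup>+ x \<in> \<Omega>. ennreal (G n x) \<partial>M) \<le> (\<integral>\<^sup>+ x \<in> \<Omega>. f x \<partial>M) + ennreal e" for n
  proof -
    have Um: "(\<lambda>x. \<Sum>j. ennreal \<eta> * indicator (U j) x) \<in> borel_measurable M"
    proof -
      have [measurable]: "U j \<in> sets M" for j by (rule open_sets_M[OF U(1)])
      show ?thesis by measurable
    qed
    have "(\<integral>\<^sup>+ x \<in> \<Omega>. ennreal (G n x) \<partial>M)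
      \<le> (\<integral>\<^sup>+ x. ennreal \<eta> * indicator C x + (\<Sum>j. ennreal \<eta> * indicator (U j) x) \<partial>M)"
    proof (rule nn_integral_mono)
      fix x
      have "ennreal (G n x) \<le> ennreal \<eta> * indicator C x + (\<Sum>j. ennreal \<eta> * indicator (U j) x)"
        unfolding G_def
      proof (rule ennreal_le_suminf_indicator)
        show "\<eta> * \<theta> x \<le> \<eta> * indicator C x"
          using \<eta> \<theta>(3)[of x] \<theta>(9)[of x] by (intro mult_left_mono) (auto simp: indicator_def)
        show "bump j n x \<le> indicator (U j) x" for j
          using bump(3)[of j n x] bump(5)[of x j n] by (auto simp: indicator_def)
      qed (use \<eta> in simp)
      then show "ennreal (G n x) * indicator \<Omega> x \<le> ennreal \<eta> * indicator C x + (\<Sum>j. ennreal \<eta> * indicator (U j) x)"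
        by (auto simp: indicator_def[of \<Omega>])
    qed
    also have "\<dots> = ennreal \<eta> * emeasure M C + (\<integral>\<^sup>+ x. (\<Sum>j. ennreal \<eta> * indicator (U j) x) \<partial>M)"
      using Cm Um by (subst nn_integral_add) (auto simp: nn_integral_cmult_indicator)
    also have "\<dots> \<le> ennreal \<eta> * emeasure M C + ((\<integral>\<^sup>+ x \<in> \<Omega>. f x \<partial>M) + ennreal \<eta> * emeasure M D + ennreal \<eta>)"
      by (intro add_left_mono U(3))
    also have "\<dots> = (\<integral>\<^sup>+ x \<in> \<Omega>. f x \<partial>M) + ennreal (\<eta> * mC + (\<eta> * mD + \<eta>))"
      using \<eta> mD mC by (simp add: ennreal_mult ac_simps)
    finally show ?thesis by (simp only: \<eta>e)
  qed
  \<comment> \<open>Half of the error is reserved for the complement of \<open>E\<close>, where the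
    difference is at most 1; the other half is for the convergence on \<open>E\<close>.\<close>
  obtain E where E: "closed E" "- N \<subseteq> E" "emeasure M (- E) \<le> ennreal (e / 2)"
    "\<And>y c. y \<in> E \<Longrightarrow> c < u y \<Longrightarrow> \<exists>V. open V \<and> y \<in> V \<and> (\<forall>z\<in>V \<inter> E. c < u z)"
    by (rule lusin_lower_semicontinuous[OF S(1) N(2,1) Nfin u(1,2,4) half_gt_zero[OF e]]) blast+
  define b where "b y = (if y \<in> E then u y else 1)" for y
  have b: "0 \<le> b y" "b y \<le> 1" for y using u(2,3) by (auto simp: b_def)
  define h :: "nat \<Rightarrow> real" where "h n = 1 / real (Suc n)" for n
  have h: "0 < h n" "h \<longlonglongrightarrow> 0" for n
    using LIMSEQ_inverse_real_of_nat by (auto simp: h_def[abs_def] inverse_eq_divide)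
  define v where "v n = chain_value b (G n) (h n)" for n
  have uN: "u x = 0" if "x \<notin> N" for x using that N(2) u(4) by blast
  have lim: "(\<lambda>n. v n x) \<longlonglongrightarrow> u x" if "x \<in> E" for x
    unfolding v_def
  proof (rule chain_value_tendsto[OF D(1) \<delta>(1) ballD Gnonneg Gcont Gmono \<eta> GN h u(2,3) uN E(1,2,4) b_def _ that])
    fix p assume p: "p \<in> paths_in D"
    have "path_integral p f \<le> path_integral p (\<lambda>x. SUP n. ennreal (G n x))"
    proof (rule path_integral_mono[OF p])
      fix x assume "x \<in> D"
      then have "f x \<le> (\<Sum>j. ennreal \<eta> * indicator (U j) x)" by (rule U(2))
      also have "\<dots> \<le> (SUP n. ennreal (G n x))"
        unfolding G_def using \<eta> \<theta>(2) bump(2,6) by (intro suminf_indicator_le_SUP) auto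
      finally show "f x \<le> (SUP n. ennreal (G n x))" .
    qed
    then show "upper_gradient_ineq (\<lambda>x. ereal (u x)) (\<lambda>x. SUP n. ennreal (G n x)) p"
      using ug[OF paths_in_mono[OF p D(2)]] upper_gradient_ineq_real[OF p, of u] by (auto intro: order_trans)
  qed
  have bounds: "0 \<le> v n x" "v n x \<le> b x" for n x
    unfolding v_def using chain_value_bounds[of b "G n", OF b(1) Gnonneg] by auto
  have loc: "locally_lipschitz_on V (v n)" if "open V" for n V
    unfolding v_def by (rule locally_lipschitz_chain_value[OF b(1) Gnonneg Gle h(1) that])
  have vm [measurable]: "v n \<in> borel_measurable M" for n
    using locally_lipschitz_on_continuous_on[OF loc[OF open_UNIV]]
    by (intro measurable_M borel_measurable_continuous_onI)
  note u(1)[measurable]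
  have [measurable]: "E \<in> sets M" "N \<in> sets M" using E(1) N(1) by auto
  \<comment> \<open>Off \<open>N\<close> the function \<open>u\<close> and the chain values both
    vanish, so the limit is needed only on a set of finite measure, where the difference is
    dominated by 1.\<close>
  have "(\<lambda>n. \<integral>\<^sup>+ x. ennreal \<bar>v n x - u x\<bar> * indicator (E \<inter> N) x \<partial>M) \<longlonglongrightarrow> (\<integral>\<^sup>+ x. 0 \<partial>M)"
  proof (rule nn_integral_dominated_convergence[where w = "indicator N"])
    show "AE x in M. ennreal \<bar>v n x - u x\<bar> * indicator (E \<inter> N) x \<le> indicator N x" for n
    proof (rule AE_I2)
      fix x
      have "\<bar>v n x - u x\<bar> \<le> 1"
        using bounds[of n x] b(2)[of x] u(2,3)[of x] by (simp add: abs_le_iff)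
      then show "ennreal \<bar>v n x - u x\<bar> * indicator (E \<inter> N) x \<le> indicator N x"
        using ennreal_leI[of "\<bar>v n x - u x\<bar>" 1] by (auto simp: indicator_def)
    qed
    show "AE x in M. (\<lambda>n. ennreal \<bar>v n x - u x\<bar> * indicator (E \<inter> N) x) \<longlonglongrightarrow> 0"
    proof (rule AE_I2)
      fix x
      show "(\<lambda>n. ennreal \<bar>v n x - u x\<bar> * indicator (E \<inter> N) x) \<longlonglongrightarrow> 0"
      proof (cases "x \<in> E")
        case True
        have "(\<lambda>n. \<bar>v n x - u x\<bar>) \<longlonglongrightarrow> \<bar>u x - u x\<bar>" by (intro tendsto_intros lim True)
        then have "(\<lambda>n. ennreal \<bar>v n x - u x\<bar>) \<longlonglongrightarrow> ennreal \<bar>u x - u x\<bar>" by (rule tendsto_ennrealI)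
        then show ?thesis by (cases "x \<in> N") (simp_all add: True)
      qed simp
    qed
  qed (use Nfin in auto)
  then have "eventually (\<lambda>n. (\<integral>\<^sup>+ x. ennreal \<bar>v n x - u x\<bar> * indicator (E \<inter> N) x \<partial>M) < ennreal (e / 2)) sequentially"
    using e by (intro order_tendstoD) auto
  then obtain n where n: "(\<integral>\<^sup>+ x. ennreal \<bar>v n x - u x\<bar> * indicator (E \<inter> N) x \<partial>M) < ennreal (e / 2)"
    using eventually_happens'[OF sequentially_bot] by blast
  have "(\<integral>\<^sup>+ x. ennreal \<bar>v n x - u x\<bar> \<partial>M)
    \<le> (\<integral>\<^sup>+ x. ennreal \<bar>v n x - u x\<bar> * indicator (E \<inter> N) x + indicator (- E) x \<partial>M)"
  proof (rule nn_integral_mono)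
    fix x
    consider "x \<in> E" "x \<in> N" | "x \<in> E" "x \<notin> N" | "x \<notin> E" by blast
    then show "ennreal \<bar>v n x - u x\<bar> \<le> ennreal \<bar>v n x - u x\<bar> * indicator (E \<inter> N) x + indicator (- E) x"
    proof cases
      case 2
      then have "v n x = 0" using bounds[of n x] uN[of x] by (simp add: b_def)
      then show ?thesis using uN[OF 2(2)] by simp
    next
      case 3
      have "\<bar>v n x - u x\<bar> \<le> 1"
        using bounds[of n x] b(2)[of x] u(2,3)[of x] by (simp add: abs_le_iff)
      then show ?thesis using 3 ennreal_leI[of "\<bar>v n x - u x\<bar>" 1] by simp
    qed simp
  qed
  also have "\<dots> = (\<integral>\<^sup>+ x. ennreal \<bar>v n x - u x\<bar> * indicator (E \<inter> N) x \<partial>M) + emeasure M (- E)"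
  proof -
    have "- E \<in> sets M" by (intro open_sets_M open_Compl E(1))
    then show ?thesis by (subst nn_integral_add) (auto simp: nn_integral_indicator)
  qed
  also have "\<dots> \<le> ennreal (e / 2) + ennreal (e / 2)"
    using n E(3) by (intro add_mono) auto
  also have "\<dots> = ennreal e" using e by (simp flip: ennreal_plus)
  finally have "(\<integral>\<^sup>+ x. ennreal \<bar>v n x - u x\<bar> \<partial>M) \<le> ennreal e" .
  moreover have "upper_gradient \<Omega> (\<lambda>x. ereal (v n x)) (\<lambda>x. ennreal (G n x))"
    unfolding v_def by (rule upper_gradient_chain_value[OF b(1) Gnonneg Gcont h(1)])
  ultimately show ?thesis using loc[OF \<Omega>] Gint by blast
qed

text \<open>
  As \<open>u\<close> takes values in \<open>[0, 1]\<close>, adding to \<open>g\<close> a function whose integral over each exceptional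
  path is at least 1 yields the upper gradient inequality along all paths.
\<close>

lemma total_variation_le:
  fixes u :: "'a \<Rightarrow> real"
  assumes \<Omega>: "open \<Omega>" and S: "compact S" "S \<subseteq> \<Omega>"
    and u: "u \<in> borel_measurable M" "\<And>x. 0 \<le> u x" "\<And>x. u x \<le> 1" "\<And>x. x \<notin> S \<Longrightarrow> u x = 0"
    and g: "weak_upper_gradient mu \<Omega> (\<lambda>x. ereal (u x)) g"
  shows "total_variation mu \<Omega> (\<lambda>x. ereal (u x)) \<le> (\<integral>\<^sup>+ x \<in> \<Omega>. g x \<partial>M)"
proof -
  let ?I = "\<integral>\<^sup>+ x \<in> \<Omega>. g x \<partial>M"
  have gm: "g \<in> borel_measurable (restrict_space M \<Omega>)"
    using g by (simp add: weak_upper_gradient_def)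
  obtain \<Gamma> where \<Gamma>: "modulus1 mu \<Omega> \<Gamma> = 0"
    "\<And>p. p \<in> paths_in \<Omega> - \<Gamma> \<Longrightarrow> upper_gradient_ineq (\<lambda>x. ereal (u x)) g p"
    using g unfolding weak_upper_gradient_def by blast
  define \<epsilon> :: "nat \<Rightarrow> real" where "\<epsilon> i = 1 / real (Suc i)" for i
  have \<epsilon>: "0 < \<epsilon> i" "\<epsilon> \<longlonglongrightarrow> 0" for i
    using LIMSEQ_inverse_real_of_nat by (auto simp: \<epsilon>_def[abs_def] inverse_eq_divide)
  \<comment> \<open>The first integral error has two equal parts: one from the function added for
    the exceptional paths, one from the Lipschitz approximation.\<close>
  define P where "P i v G \<longleftrightarrow> locally_lipschitz_on \<Omega> v \<and> upper_gradient \<Omega> (\<lambda>x. ereal (v x)) G \<and>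
      (\<integral>\<^sup>+ x \<in> \<Omega>. G x \<partial>M) \<le> ?I + ennreal (2 * \<epsilon> i) \<and> (\<integral>\<^sup>+ x. ennreal \<bar>v x - u x\<bar> \<partial>M) \<le> ennreal (\<epsilon> i)"
    for i v G
  have "\<exists>v G. P i v G" for i
  proof -
    have "modulus1 mu \<Omega> \<Gamma> < ennreal (\<epsilon> i)" using \<Gamma>(1) \<epsilon>(1) by simp
    then obtain \<rho> where \<rho>: "\<rho> \<in> borel_measurable (restrict_space borel \<Omega>)"
      "\<And>p. p \<in> \<Gamma> \<Longrightarrow> 1 \<le> path_integral p \<rho>" "(\<integral>\<^sup>+ x \<in> \<Omega>. \<rho> x \<partial>M) < ennreal (\<epsilon> i)"
      unfolding modulus1_def INF_less_iff by blast
    have \<rho>m: "\<rho> \<in> borel_measurable (restrict_space M \<Omega>)" by (rule measurable_restrict_M[OF \<rho>(1)])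
    define f where "f x = g x + \<rho> x" for x
    have fm: "f \<in> borel_measurable (restrict_space M \<Omega>)"
      unfolding f_def using gm \<rho>m by (rule borel_measurable_add)
    have ineq: "upper_gradient_ineq (\<lambda>x. ereal (u x)) f p" if p: "p \<in> paths_in \<Omega>" for p
    proof (cases "p \<in> \<Gamma>")
      case True
      have "\<bar>u (arc_length_param p (path_len p)) - u (arc_length_param p 0)\<bar> \<le> 1"
        using u(2,3)[of "arc_length_param p (path_len p)"] u(2,3)[of "arc_length_param p 0"]
        by (simp add: abs_le_iff)
      then have "ennreal \<bar>u (arc_length_param p (path_len p)) - u (arc_length_param p 0)\<bar> \<le> 1"
        using ennreal_leI[of _ 1] by simp
      also have "1 \<le> path_integral p \<rho>" by (rule \<rho>(2)[OF True])
      also have "\<dots> \<le> path_integral p f" by (rule path_integral_mono[OF p]) (simp add: f_def)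
      finally show ?thesis unfolding upper_gradient_ineq_real[OF p] .
    next
      case False
      then have "upper_gradient_ineq (\<lambda>x. ereal (u x)) g p" using \<Gamma>(2) p by blast
      moreover have "path_integral p g \<le> path_integral p f"
        by (rule path_integral_mono[OF p]) (simp add: f_def)
      ultimately show ?thesis unfolding upper_gradient_ineq_real[OF p] by (rule order_trans)
    qed
    obtain v G where vG: "locally_lipschitz_on \<Omega> v" "upper_gradient \<Omega> (\<lambda>x. ereal (v x)) G"
      "(\<integral>\<^sup>+ x \<in> \<Omega>. G x \<partial>M) \<le> (\<integral>\<^sup>+ x \<in> \<Omega>. f x \<partial>M) + ennreal (\<epsilon> i)"
      "(\<integral>\<^sup>+ x. ennreal \<bar>v x - u x\<bar> \<partial>M) \<le> ennreal (\<epsilon> i)"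
      using newtonian_approx[OF \<Omega> S u fm ineq \<epsilon>(1)] by blast
    have "(\<integral>\<^sup>+ x \<in> \<Omega>. f x \<partial>M) = ?I + (\<integral>\<^sup>+ x \<in> \<Omega>. \<rho> x \<partial>M)"
    proof -
      have "\<Omega> \<inter> space M \<in> sets M" using \<Omega> by auto
      note iff = borel_measurable_restrict_space_iff_ennreal[OF this, THEN iffD1]
      show ?thesis
        unfolding f_def distrib_right by (rule nn_integral_add[OF iff[OF gm] iff[OF \<rho>m]])
    qed
    then have "(\<integral>\<^sup>+ x \<in> \<Omega>. G x \<partial>M) \<le> ?I + (\<integral>\<^sup>+ x \<in> \<Omega>. \<rho> x \<partial>M) + ennreal (\<epsilon> i)"
      using vG(3) by simp
    also have "\<dots> \<le> ?I + ennreal (\<epsilon> i) + ennreal (\<epsilon> i)"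
      using \<rho>(3) by (intro add_right_mono add_left_mono) simp
    also have "\<dots> = ?I + ennreal (2 * \<epsilon> i)"
      using \<epsilon>(1)[of i] by (simp add: add.assoc flip: ennreal_plus)
    finally show ?thesis using vG unfolding P_def by blast
  qed
  then obtain v G where P: "\<And>i. P i (v i) (G i)" by metis
  then have v: "\<And>i. locally_lipschitz_on \<Omega> (v i)" "\<And>i. upper_gradient \<Omega> (\<lambda>x. ereal (v i x)) (G i)"
      "\<And>i. (\<integral>\<^sup>+ x \<in> \<Omega>. G i x \<partial>M) \<le> ?I + ennreal (2 * \<epsilon> i)"
      "\<And>i. (\<integral>\<^sup>+ x. ennreal \<bar>v i x - u x\<bar> \<partial>M) \<le> ennreal (\<epsilon> i)"
    by (simp_all add: P_def)
  have "converges_L1_loc mu \<Omega> v (\<lambda>x. ereal (u x))"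
    unfolding converges_L1_loc_def
  proof
    fix x assume "x \<in> \<Omega>"
    then obtain r where r: "r > 0" "ball x r \<subseteq> \<Omega>" using \<Omega> by (metis open_contains_ball)
    have "(\<lambda>i. \<integral>\<^sup>+ y \<in> ball x r. e2ennreal \<bar>ereal (v i y) - ereal (u y)\<bar> \<partial>M) \<longlonglongrightarrow> 0"
    proof (rule tendsto_sandwich[OF _ _ tendsto_const])
      have "(\<integral>\<^sup>+ y \<in> ball x r. e2ennreal \<bar>ereal (v i y) - ereal (u y)\<bar> \<partial>M) \<le> ennreal (\<epsilon> i)" for i
        by (rule order_trans[OF nn_integral_mono v(4)]) (simp add: indicator_def)
      then show "eventually (\<lambda>i. (\<integral>\<^sup>+ y \<in> ball x r. e2ennreal \<bar>ereal (v i y) - ereal (u y)\<bar> \<partial>M) \<le> ennreal (\<epsilon> i)) sequentially"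
        by simp
      show "(\<lambda>i. ennreal (\<epsilon> i)) \<longlonglongrightarrow> 0" using tendsto_ennrealI[OF \<epsilon>(2)] by simp
    qed simp
    then show "\<exists>r>0. ball x r \<subseteq> \<Omega> \<and> (\<lambda>i. \<integral>\<^sup>+ y \<in> ball x r. e2ennreal \<bar>ereal (v i y) - ereal (u y)\<bar> \<partial>M) \<longlonglongrightarrow> 0"
      using r by blast
  qed
  then have "total_variation mu \<Omega> (\<lambda>x. ereal (u x)) \<le> liminf (\<lambda>i. \<integral>\<^sup>+ x \<in> \<Omega>. G i x \<partial>M)"
    unfolding total_variation_def using v(1,2) by (intro INF_lower2[of "(v, G)"]) auto
  also have "\<dots> \<le> liminf (\<lambda>i. ?I + ennreal (2 * \<epsilon> i))"
    using v(3) by (intro Liminf_mono) simp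
  also have "\<dots> = ?I"
  proof (rule lim_imp_Liminf)
    have "(\<lambda>i. 2 * \<epsilon> i) \<longlonglongrightarrow> 2 * 0" by (intro tendsto_intros \<epsilon>(2))
    then have "(\<lambda>i. ennreal (2 * \<epsilon> i)) \<longlonglongrightarrow> ennreal (2 * 0)" by (rule tendsto_ennrealI)
    then have "(\<lambda>i. ?I + ennreal (2 * \<epsilon> i)) \<longlonglongrightarrow> ?I + ennreal (2 * 0)" by (intro tendsto_add tendsto_const)
    then show "(\<lambda>i. ?I + ennreal (2 * \<epsilon> i)) \<longlonglongrightarrow> ?I" by simp
  qed simp
  finally show ?thesis .
qed

text \<open>Clamping is 1-Lipschitz on finite values. If \<open>u\<close> is infinite at an end of a
  path, the original inequality already makes the path integral infinite, which dominates the
  clamped difference.\<close>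

lemma weak_upper_gradient_clamp:
  assumes "weak_upper_gradient mu \<Omega> u g"
  shows "weak_upper_gradient mu \<Omega> (\<lambda>x. ereal (if x \<in> \<Omega> then real_of_ereal (max 0 (min 1 (u x))) else 0)) g"
proof -
  let ?w = "\<lambda>x. if x \<in> \<Omega> then real_of_ereal (max 0 (min 1 (u x))) else 0"
  obtain \<Gamma> where \<Gamma>: "\<Gamma> \<subseteq> paths_in \<Omega>" "modulus1 mu \<Omega> \<Gamma> = 0"
    "\<And>p. p \<in> paths_in \<Omega> - \<Gamma> \<Longrightarrow> path_integral_defined p g \<and> upper_gradient_ineq u g p"
    using assms unfolding weak_upper_gradient_def by blast
  have "upper_gradient_ineq (\<lambda>x. ereal (?w x)) g p" if p: "p \<in> paths_in \<Omega> - \<Gamma>" for p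
  proof -
    obtain a b \<gamma> where pe: "p = (a, b, \<gamma>)" by (cases p)
    have ab: "\<gamma> a \<in> \<Omega>" "\<gamma> b \<in> \<Omega>" using p by (auto simp: pe paths_in_def image_subset_iff)
    have ineq: "upper_gradient_ineq u g p" using \<Gamma>(3)[OF p] by simp
    show ?thesis
    proof (cases "\<bar>u (\<gamma> a)\<bar> \<noteq> \<infinity> \<and> \<bar>u (\<gamma> b)\<bar> \<noteq> \<infinity>")
      case True
      then obtain y z where yz: "u (\<gamma> a) = ereal y" "u (\<gamma> b) = ereal z"
        by (cases "u (\<gamma> a)"; cases "u (\<gamma> b)") auto
      have w: "?w (\<gamma> a) = max 0 (min 1 y)" "?w (\<gamma> b) = max 0 (min 1 z)"
        using ab by (simp_all add: yz real_of_ereal_clamp)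
      have "\<bar>max 0 (min 1 y) - max 0 (min 1 z)\<bar> \<le> \<bar>y - z\<bar>" by (simp add: max_def min_def)
      then have "ennreal \<bar>?w (\<gamma> a) - ?w (\<gamma> b)\<bar> \<le> ennreal \<bar>y - z\<bar>" unfolding w by (rule ennreal_leI)
      also have "\<dots> \<le> path_integral p g"
        using ineq by (simp add: pe upper_gradient_ineq_def yz)
      finally show ?thesis by (simp add: pe upper_gradient_ineq_def)
    next
      case False
      then have "path_integral p g = \<infinity>" using ineq by (auto simp: pe upper_gradient_ineq_def)
      then show ?thesis by (simp add: pe upper_gradient_ineq_def)
    qed
  qed
  then show ?thesis
    using assms \<Gamma> unfolding weak_upper_gradient_def by blast
qed

text \<open>Truncation to [0, 1] fixes 0 and 1, so it preserves the conditions at \<open>K\<close>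
  and on the support and keeps \<open>g\<close> as a weak upper gradient. The bound on its total
  variation also shows that it is in \<open>BV\<close>, once the integral of \<open>g\<close> is
  finite.\<close>

lemma cap_BV_O_le_cap_1_O:
  assumes \<Omega>: "open \<Omega>"
  shows "cap_BV_O mu K \<Omega> \<le> cap_1_O mu K \<Omega>"
  unfolding cap_1_O_def
proof (rule INF_greatest, clarify)
  fix u g
  assume u: "u \<in> N11 mu \<Omega>" and S: "compact (supt \<Omega> u)" "supt \<Omega> u \<subseteq> \<Omega>"
    and one: "one_near K \<Omega> u" and g: "weak_upper_gradient mu \<Omega> u g"
  show "cap_BV_O mu K \<Omega> \<le> (\<integral>\<^sup>+ x \<in> \<Omega>. g x \<partial>M)"
  proof (cases "(\<integral>\<^sup>+ x \<in> \<Omega>. g x \<partial>M) < \<infinity>")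
    case True
    define w where "w x = (if x \<in> \<Omega> then real_of_ereal (max 0 (min 1 (u x))) else 0)" for x
    have wu: "\<bar>ereal (w x)\<bar> \<le> \<bar>u x\<bar>" and w01: "0 \<le> w x" "w x \<le> 1" for x
    proof -
      show "\<bar>ereal (w x)\<bar> \<le> \<bar>u x\<bar>" by (cases "u x") (auto simp: w_def real_of_ereal_clamp)
      show "0 \<le> w x" "w x \<le> 1" by (cases "u x"; simp add: w_def real_of_ereal_clamp)+
    qed
    have um: "u \<in> borel_measurable (restrict_space M \<Omega>)" and ufin: "(\<integral>\<^sup>+ x \<in> \<Omega>. e2ennreal \<bar>u x\<bar> \<partial>M) < \<infinity>"
      using u by (auto simp: N11_def L1_def)
    have "(\<lambda>x. real_of_ereal (max 0 (min 1 (u x)))) \<in> borel_measurable (restrict_space M \<Omega>)"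
      using um by measurable
    then have wm: "w \<in> borel_measurable M"
      unfolding w_def using \<Omega> by (subst (asm) measurable_restrict_space_iff[of _ _ "0::real"]) auto
    have w0: "w x = 0" if "x \<notin> supt \<Omega> u" for x
      using that closure_subset[of "{x \<in> \<Omega>. u x \<noteq> 0}"] by (auto simp: w_def supt_def)
    have weak: "weak_upper_gradient mu \<Omega> (\<lambda>x. ereal (w x)) g"
      unfolding w_def by (rule weak_upper_gradient_clamp[OF g])
    have tv: "total_variation mu \<Omega> (\<lambda>x. ereal (w x)) \<le> (\<integral>\<^sup>+ x \<in> \<Omega>. g x \<partial>M)"
      by (rule total_variation_le[OF \<Omega> S wm w01 _ weak]) (rule w0)
    have "(\<integral>\<^sup>+ x \<in> \<Omega>. e2ennreal \<bar>ereal (w x)\<bar> \<partial>M) \<le> (\<integral>\<^sup>+ x \<in> \<Omega>. e2ennreal \<bar>u x\<bar> \<partial>M)"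
      using wu by (intro nn_integral_mono mult_right_mono e2ennreal_mono) auto
    then have "(\<lambda>x. ereal (w x)) \<in> L1 mu \<Omega>"
      using ufin wm by (auto simp: L1_def intro!: borel_measurable_ereal measurable_restrict_space1)
    then have BV: "(\<lambda>x. ereal (w x)) \<in> BV mu \<Omega>"
      using tv True by (auto simp: BV_def)
    have sub: "supt \<Omega> (\<lambda>x. ereal (w x)) \<subseteq> supt \<Omega> u"
      unfolding supt_def[of _ "\<lambda>x. ereal (w x)"] using w0 S(1)
      by (intro closure_minimal) (auto simp: zero_ereal_def intro: compact_imp_closed)
    have "compact (supt \<Omega> (\<lambda>x. ereal (w x)))"
      using compact_Int_closed[OF S(1), of "supt \<Omega> (\<lambda>x. ereal (w x))"] sub
      by (simp add: supt_def inf.absorb2)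
    moreover obtain V where "open V" "K \<subseteq> V" "V \<subseteq> \<Omega>" "\<And>x. x \<in> V \<Longrightarrow> u x = 1"
      using one unfolding one_near_def by blast
    then have "one_near K \<Omega> (\<lambda>x. ereal (w x))"
      unfolding one_near_def by (intro exI[of _ V]) (auto simp: w_def one_ereal_def zero_ereal_def)
    ultimately have "cap_BV_O mu K \<Omega> \<le> total_variation mu \<Omega> (\<lambda>x. ereal (w x))"
      unfolding cap_BV_O_def using BV sub S(2) w01
      by (intro INF_lower) (auto simp: zero_ereal_def one_ereal_def)
    then show ?thesis using tv by (rule order_trans)
  qed (simp add: less_top[symmetric])
qed

end

theorem theorem4p3:
  fixes mu :: "'a::complete_space set \<Rightarrow> ennreal" and \<Omega> K :: "'a set"
  assumes "borel_regular_outer_measure mu"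
    and "\<And>x r. r > 0 \<Longrightarrow> 0 < mu (ball x r) \<and> mu (ball x r) < \<infinity>"
    and "doubling mu"
    and "weak_poincare_1_1 mu"
    and "open \<Omega>" and "compact K" and "K \<subseteq> \<Omega>"
  shows "cap_1_O mu K \<Omega> = cap_BV_O mu K \<Omega>"
proof -
  interpret doubling_space mu using assms(1-3) by unfold_locales auto
  show ?thesis
    using cap_1_O_le_cap_BV_O[OF assms(5-7)] cap_BV_O_le_cap_1_O[OF assms(5)] by (rule antisym)
qed

end
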